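(* Fix $\epsilon>0$ and let $p=p(n)$ satisfy $d=pn\ge 1+\epsilon$. Then there are constants $0<a\le b$ such that a.a.s. \[a\min\left\{\frac{d}{\ln n},1\right\}\le\Phi(H_{n,p})\le b\min\left\{\frac{d}{\ln n},1\right\}.\]
   Context: $G_{n,p}$ is the random graph on $V_n=\{1,\dots,n\}$ with each possible edge present independently with probability $p$; $d=pn$; $H_{n,p}$ is the largest component of $G_{n,p}$; a.a.s. means with probability tending to $1$. For the simple random walk on a connected graph $H$ with $e^*$ edges, $\pi(v)=d(v)/(2e^* )$; for $S\subseteq V(H)$, $\pi(S)=\sum_{v\in S}\pi(v)$ and $Q(S)=\sum_{i\in S,j\notin S}\pi(i)P_{i,j}=e^{\mathrm{out}}(S)/(2e^* )$, where $e^{\mathrm{out}}(S)$ is the number of edges with exactly one endpoint in $S$. The conductance of $S$ is $\Phi(S)=\frac{Q(S)}{\pi(S)\pi(V(H)\setminus S)}$, and $\Phi(H)$ is the minimum of $\Phi(S)$ over all $S\subseteq V(H)$ with $0<\pi(S)<1$. *)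

theory Defs
  imports "HOL-Probability.Probability"
begin

text \<open>Potential edges, each unordered pair {i,j} encoded once as (i,j) with i < j.\<close>
definition pairs :: "nat \<Rightarrow> (nat \<times> nat) set" where
  "pairs n = {(i, j). 1 \<le> i \<and> i < j \<and> j \<le> n}"

definition Gnp :: "nat \<Rightarrow> real \<Rightarrow> (nat \<times> nat \<Rightarrow> bool) pmf" where
  "Gnp n p = Pi_pmf (pairs n) False (\<lambda>_. bernoulli_pmf p)"

definition adj :: "(nat \<times> nat \<Rightarrow> bool) \<Rightarrow> nat \<Rightarrow> nat \<Rightarrow> bool" where
  "adj g u v \<longleftrightarrow> g (u, v) \<or> g (v, u)"

definition component :: "nat \<Rightarrow> (nat \<times> nat \<Rightarrow> bool) \<Rightarrow> nat set \<Rightarrow> bool" where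
  "component n g C \<longleftrightarrow> (\<exists>v\<in>{1..n}. C = {u. (adj g)\<^sup>*\<^sup>* v u})"

definition largest_component :: "nat \<Rightarrow> (nat \<times> nat \<Rightarrow> bool) \<Rightarrow> nat set \<Rightarrow> bool" where
  "largest_component n g C \<longleftrightarrow> component n g C \<and> (\<forall>C'. component n g C' \<longrightarrow> card C' \<le> card C)"

section \<open>Conductance of the simple random walk on the graph (V, adj)\<close>

definition degree :: "(nat \<Rightarrow> nat \<Rightarrow> bool) \<Rightarrow> nat set \<Rightarrow> nat \<Rightarrow> nat" where
  "degree E V v = card {u\<in>V. E v u}"

definition num_edges :: "(nat \<Rightarrow> nat \<Rightarrow> bool) \<Rightarrow> nat set \<Rightarrow> nat" where
  "num_edges E V = card {{u, w} | u w. u \<in> V \<and> w \<in> V \<and> E u w}"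

definition edges_out :: "(nat \<Rightarrow> nat \<Rightarrow> bool) \<Rightarrow> nat set \<Rightarrow> nat set \<Rightarrow> nat" where
  "edges_out E V S = card {{u, w} | u w. u \<in> S \<and> w \<in> V - S \<and> E u w}"

definition stat :: "(nat \<Rightarrow> nat \<Rightarrow> bool) \<Rightarrow> nat set \<Rightarrow> nat set \<Rightarrow> real" where
  "stat E V S = (\<Sum>v\<in>S. real (degree E V v)) / (2 * real (num_edges E V))"

definition Qflow :: "(nat \<Rightarrow> nat \<Rightarrow> bool) \<Rightarrow> nat set \<Rightarrow> nat set \<Rightarrow> real" where
  "Qflow E V S = real (edges_out E V S) / (2 * real (num_edges E V))"

definition set_conductance :: "(nat \<Rightarrow> nat \<Rightarrow> bool) \<Rightarrow> nat set \<Rightarrow> nat set \<Rightarrow> real" where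
  "set_conductance E V S = Qflow E V S / (stat E V S * stat E V (V - S))"

definition conductance :: "(nat \<Rightarrow> nat \<Rightarrow> bool) \<Rightarrow> nat set \<Rightarrow> real" where
  "conductance E V = Min {set_conductance E V S | S. S \<subseteq> V \<and> 0 < stat E V S \<and> stat E V S < 1}"

end

theory Submission
  imports Defs "HOL-Real_Asymp.Real_Asymp"
begin

text \<open>Write \<open>d = p n\<close> and \<open>L = ln n\<close>. Since both the cut and the volume are additive over the connected
  pieces of a vertex set, the lower bound only has to be shown for connected sets \<open>S\<close> with at most
  half of the vertices of the component. Such a set of size below \<open>C L / d\<close> spans few edges and has at
  least one outgoing edge. For \<open>C L / d \<le> |S| \<le> \<delta> n\<close> a first moment argument gives linearly many outgoing
  edges. For large \<open>d\<close> a union bound over all sets covers the remaining sizes, while for bounded \<open>d\<close>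
  it suffices to find \<open>c n / L\<close> outgoing edges, which is a sprinkling argument: after the cut edges and
  the sprinkled edges are removed, the two sides still consist mostly of at most \<open>n / L\<close> components of
  size at least \<open>L\<close>, so there are too few candidate partitions for the sprinkled edges to miss one.
  For the upper bound, a second moment argument finds a bare path of about \<open>c L / d\<close> vertices hanging
  off the giant component.\<close>

section \<open>Independent random bits\<close>

text \<open>For bounded d a union bound over all vertex sets of linear size fails: there are
  exp(Theta(n)) of them, and a given cut is empty with probability exp(-Theta(n)). But
  \<open>min (d / L) 1\<close> is of order 1 / L there, so n / L boundary edges suffice, and the
  candidate cuts then have entropy only of order n ln L / L. Sprinkling with edge probability of
  order 1 / (n sqrt L) leaves a fixed linear cross section almost empty with probability exp(-c n /
  sqrt L), which beats that entropy. Trees are not counted and no branching process is used. The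
  first moments of connected sets come from the identity that component sizes add up to the number
  of vertices, in expectation. The giant exists because small components have concentrated total
  mass with mean at most about n exp(1 - d) < n; for bounded d its uniqueness is again the absence
  of sparse cuts. All estimates are uniform in p, since p(n) may oscillate between the bounded and
  the dense regime, and since the pendant paths need the giant on fewer vertices with the same
  p.\<close>

definition rbits :: "'a set \<Rightarrow> real \<Rightarrow> ('a \<Rightarrow> bool) pmf" where
  "rbits A p = Pi_pmf A False (\<lambda>_. bernoulli_pmf p)"

definition depends_only_on :: "'a set \<Rightarrow> (('a \<Rightarrow> bool) \<Rightarrow> bool) \<Rightarrow> bool" where
  "depends_only_on A P \<longleftrightarrow> (\<forall>g h. (\<forall>x\<in>A. g x = h x) \<longrightarrow> P g = P h)"

definition cnt :: "'a set \<Rightarrow> ('a \<Rightarrow> bool) \<Rightarrow> nat" where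
  "cnt D g = card {x\<in>D. g x}"

lemma set_rbits: "finite A \<Longrightarrow> g \<in> set_pmf (rbits A p) \<Longrightarrow> g x \<Longrightarrow> x \<in> A"
  unfolding rbits_def using set_Pi_pmf_subset[of A False] by blast

lemma finite_set_rbits [simp]: "finite A \<Longrightarrow> finite (set_pmf (rbits A p))"
  unfolding rbits_def
  by (rule finite_subset[OF set_Pi_pmf_subset']) (auto intro!: finite_PiE_dflt)

lemma rbits_integrable [simp]:
  "finite A \<Longrightarrow> integrable (measure_pmf (rbits A p)) (f :: _ \<Rightarrow> real)"
  by (simp add: integrable_measure_pmf_finite)

lemma prob_mono_support:
  assumes "\<And>x. x \<in> set_pmf M \<Longrightarrow> P x \<Longrightarrow> Q x"
  shows "measure_pmf.prob M {x. P x} \<le> measure_pmf.prob M {x. Q x}"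
proof -
  have "measure_pmf.prob M {x. P x} = measure_pmf.prob M ({x. P x} \<inter> set_pmf M)"
    by (simp add: measure_Int_set_pmf)
  also have "\<dots> \<le> measure_pmf.prob M {x. Q x}"
    using assms by (intro measure_pmf.finite_measure_mono) auto
  finally show ?thesis .
qed

lemma prob_cong_support:
  assumes "\<And>x. x \<in> set_pmf M \<Longrightarrow> P x = Q x"
  shows "measure_pmf.prob M {x. P x} = measure_pmf.prob M {x. Q x}"
  by (intro antisym prob_mono_support) (use assms in auto)

lemma prob_UN_le:
  assumes "finite I"
  shows "measure_pmf.prob M {x. \<exists>i\<in>I. P i x} \<le> (\<Sum>i\<in>I. measure_pmf.prob M {x. P i x})"
proof -
  have "{x. \<exists>i\<in>I. P i x} = (\<Union>i\<in>I. {x. P i x})" by auto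
  then show ?thesis
    using measure_pmf.finite_measure_subadditive_finite[OF assms, of "\<lambda>i. {x. P i x}" M] by simp
qed

lemma prob_disj_le:
  "measure_pmf.prob M {x. P x \<or> Q x} \<le> measure_pmf.prob M {x. P x} + measure_pmf.prob M {x. Q x}"
proof -
  have "{x. P x \<or> Q x} = {x. P x} \<union> {x. Q x}" by auto
  then show ?thesis using measure_Un_le[of "{x. P x}" M "{x. Q x}"] by simp
qed

lemma pmf_Markov:
  fixes u :: "_ \<Rightarrow> real"
  assumes "finite (set_pmf M)" "\<And>x. u x \<ge> 0" "c > 0"
  shows "measure_pmf.prob M {x. u x \<ge> c} \<le> measure_pmf.expectation M u / c"
proof -
  have "integrable (measure_pmf M) u" using assms(1) by (rule integrable_measure_pmf_finite)
  then show ?thesis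
    using integral_Markov_inequality_measure[where M = "measure_pmf M" and u = u and c = c and A = "{}"]
      assms by (auto intro: AE_pmfI)
qed

lemma expectation_weighted_count:
  assumes "finite (set_pmf M)" "finite I"
  shows "measure_pmf.expectation M (\<lambda>x. \<Sum>i\<in>I. w i * of_bool (P i x)) =
     (\<Sum>i\<in>I. w i * measure_pmf.prob M {x. P i x})"
proof -
  have int: "integrable (measure_pmf M) (f :: _ \<Rightarrow> real)" for f
    using assms(1) by (rule integrable_measure_pmf_finite)
  have "measure_pmf.expectation M (\<lambda>x. of_bool (P i x)) = measure_pmf.prob M {x. P i x}" for i
  proof -
    have "(\<lambda>x. of_bool (P i x) :: real) = indicator {x. P i x}" by (auto simp: indicator_def)
    then show ?thesis by simp
  qed
  then show ?thesis by (subst Bochner_Integration.integral_sum) (auto simp: int)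
qed

lemma prob_pair_pmf:
  "measure_pmf.prob (pair_pmf M N) {z. P (fst z) \<and> Q (snd z)} =
     measure_pmf.prob M {x. P x} * measure_pmf.prob N {y. Q y}"
proof -
  \<comment> \<open>The product rule asks for countable sets; intersecting with the supports
    provides them without changing any probability.\<close>
  let ?A = "{x. P x} \<inter> set_pmf M" and ?B = "{y. Q y} \<inter> set_pmf N"
  have "measure_pmf.prob (pair_pmf M N) {z. P (fst z) \<and> Q (snd z)} =
      measure_pmf.prob (pair_pmf M N) ({z. P (fst z) \<and> Q (snd z)} \<inter> set_pmf (pair_pmf M N))"
    by (simp only: measure_Int_set_pmf)
  also have "{z. P (fst z) \<and> Q (snd z)} \<inter> set_pmf (pair_pmf M N) = ?A \<times> ?B" by auto
  also have "measure_pmf.prob (pair_pmf M N) (?A \<times> ?B) = measure_pmf.prob M ?A * measure_pmf.prob N ?B"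
    by (intro measure_pmf_prob_product) auto
  finally show ?thesis by (simp only: measure_Int_set_pmf)
qed

section \<open>Restriction to fewer bits and independence of events on disjoint sets of bits\<close>

lemma rbits_restrict:
  assumes "finite A" "B \<subseteq> A" "depends_only_on B P"
  shows "measure_pmf.prob (rbits A p) {g. P g} = measure_pmf.prob (rbits B p) {g. P g}"
proof -
  \<comment> \<open>The restricted model fills in the default False outside B, where P does not
    look.\<close>
  have "P (\<lambda>x. if x \<in> B then g x else False) = P g" for g
    using assms(3) unfolding depends_only_on_def by (elim allE impE) auto
  then show ?thesis
    unfolding rbits_def Pi_pmf_subset[OF assms(1,2)] by (simp add: vimage_def)
qed

lemma rbits_union:
  assumes "finite A" "finite B" "A \<inter> B = {}"
  shows "rbits (A \<union> B) p = map_pmf (\<lambda>(f,g) x. if x \<in> A then f x else g x) (pair_pmf (rbits A p) (rbits B p))"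
  unfolding rbits_def by (rule Pi_pmf_union[OF assms])

lemma depends_only_on_conj:
  assumes "depends_only_on A P" "depends_only_on B Q"
  shows "depends_only_on (A \<union> B) (\<lambda>g. P g \<and> Q g)"
  using assms unfolding depends_only_on_def by (metis UnCI)

lemma depends_only_on_cnt: "depends_only_on D (\<lambda>g. P (cnt D g))"
proof -
  have "{x \<in> D. g x} = {x \<in> D. h x}" if "\<forall>x\<in>D. g x = h x" for g h using that by auto
  then show ?thesis unfolding depends_only_on_def cnt_def by metis
qed

text \<open>Both events live in the model on \<open>A1 \<union> A2\<close>, which is a product of
  two models; there their conjunction is a rectangle.\<close>

lemma rbits_indep:
  assumes fin: "finite A" and sub: "A1 \<subseteq> A" "A2 \<subseteq> A" and disj: "A1 \<inter> A2 = {}"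
    and P: "depends_only_on A1 P" and Q: "depends_only_on A2 Q"
  shows "measure_pmf.prob (rbits A p) {g. P g \<and> Q g} =
    measure_pmf.prob (rbits A p) {g. P g} * measure_pmf.prob (rbits A p) {g. Q g}"
proof -
  have fin': "finite A1" "finite A2" using fin sub by (auto intro: finite_subset)
  have P': "P (\<lambda>x. if x \<in> A1 then f x else g x) = P f" for f g
    using P unfolding depends_only_on_def by (elim allE impE) auto
  have Q': "Q (\<lambda>x. if x \<in> A1 then f x else g x) = Q g" for f g
    using Q disj unfolding depends_only_on_def by (elim allE impE) auto
  have "measure_pmf.prob (rbits A p) {g. P g \<and> Q g} = measure_pmf.prob (rbits (A1 \<union> A2) p) {g. P g \<and> Q g}"
    using sub by (intro rbits_restrict[OF fin] depends_only_on_conj P Q) auto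
  also have "\<dots> = measure_pmf.prob (pair_pmf (rbits A1 p) (rbits A2 p)) {z. P (fst z) \<and> Q (snd z)}"
    unfolding rbits_union[OF fin' disj] by (simp add: vimage_def case_prod_unfold P' Q')
  also have "\<dots> = measure_pmf.prob (rbits A1 p) {g. P g} * measure_pmf.prob (rbits A2 p) {g. Q g}"
    by (rule prob_pair_pmf)
  finally show ?thesis using rbits_restrict[OF fin] sub P Q by metis
qed

lemma rbits_pattern:
  assumes "finite A" "D \<subseteq> A" "0 \<le> p" "p \<le> 1"
  shows "measure_pmf.prob (rbits A p) {g. \<forall>x\<in>D. g x = h x} =
    p ^ card {x\<in>D. h x} * (1 - p) ^ card {x\<in>D. \<not> h x}"
proof -
  have fD: "finite D" using assms by (auto intro: finite_subset)
  have "measure_pmf.prob (rbits A p) {g. \<forall>x\<in>D. g x = h x} = measure_pmf.prob (rbits D p) {g. \<forall>x\<in>D. g x = h x}"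
    by (intro rbits_restrict assms) (auto simp: depends_only_on_def)
  also have "\<dots> = measure_pmf.prob (rbits D p) (Pi D (\<lambda>x. {h x}))"
    by (intro arg_cong[where f = "measure_pmf.prob _"]) auto
  also have "\<dots> = (\<Prod>x\<in>D. measure_pmf.prob (bernoulli_pmf p) {h x})"
    unfolding rbits_def by (rule measure_Pi_pmf_Pi[OF fD])
  also have "\<dots> = (\<Prod>x\<in>D. if h x then p else 1 - p)"
    using assms by (intro prod.cong) (auto simp: measure_pmf_single)
  also have "\<dots> = (\<Prod>x\<in>{x\<in>D. h x}. p) * (\<Prod>x\<in>{x\<in>D. \<not> h x}. 1 - p)"
    using fD by (simp add: prod.If_cases Int_def)
  also have "\<dots> = p ^ card {x\<in>D. h x} * (1 - p) ^ card {x\<in>D. \<not> h x}" by simp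
  finally show ?thesis .
qed

lemma rbits_no_bits:
  assumes "finite A" "D \<subseteq> A" "0 \<le> p" "p \<le> 1"
  shows "measure_pmf.prob (rbits A p) {g. cnt D g = 0} = (1 - p) ^ card D"
proof -
  have "finite D" using assms by (auto intro: finite_subset)
  then have "cnt D g = 0 \<longleftrightarrow> (\<forall>x\<in>D. g x = False)" for g by (auto simp: cnt_def)
  then show ?thesis using rbits_pattern[OF assms, of "\<lambda>_. False"] by simp
qed

section \<open>Exponential moments, tail bounds and the second moment method\<close>

lemma rbits_mgf:
  assumes "finite A" "D \<subseteq> A" "0 \<le> p" "p \<le> 1"
  shows "measure_pmf.expectation (rbits A p) (\<lambda>g. exp (s * real (cnt D g))) = (1 + p * (exp s - 1)) ^ card D"
proof -
  have fD: "finite D" using assms by (auto intro: finite_subset)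
  define f where "f = (\<lambda>x (b::bool). if x \<in> D \<and> b then exp s else (1::real))"
  have "exp (s * real (cnt D g)) = (\<Prod>x\<in>A. f x (g x))" for g
  proof -
    have "(\<Prod>x\<in>A. f x (g x)) = (\<Prod>x\<in>{x\<in>D. g x}. exp s)"
      using assms by (intro prod.mono_neutral_cong_right) (auto simp: f_def)
    then show ?thesis by (simp add: cnt_def exp_of_nat_mult[symmetric] mult.commute)
  qed
  then have "measure_pmf.expectation (rbits A p) (\<lambda>g. exp (s * real (cnt D g))) =
      measure_pmf.expectation (rbits A p) (\<lambda>g. \<Prod>x\<in>A. f x (g x))" by simp
  also have "\<dots> = (\<Prod>x\<in>A. measure_pmf.expectation (bernoulli_pmf p) (f x))"
    unfolding rbits_def using assms
    by (intro expectation_prod_Pi_pmf) (auto simp: f_def intro!: integrable_measure_pmf_finite)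
  also have "\<dots> = (\<Prod>x\<in>D. 1 + p * (exp s - 1))"
    using assms by (intro prod.mono_neutral_cong_right) (auto simp: f_def algebra_simps)
  finally show ?thesis by simp
qed

text \<open>Markov's inequality for \<open>exp (s * cnt D g)\<close>. The sign of s is left open, so
  that both tails below are instances. The mean enters as \<open>p * card D\<close> times
  \<open>exp s - 1\<close>, and the tilt s is tuned anew at each use.\<close>

lemma rbits_chernoff:
  assumes "finite A" "D \<subseteq> A" "0 \<le> p" "p \<le> 1"
  shows "measure_pmf.prob (rbits A p) {g. s * real (cnt D g) \<ge> y} \<le> exp (p * (exp s - 1) * real (card D) - y)"
proof -
  have "measure_pmf.prob (rbits A p) {g. s * real (cnt D g) \<ge> y} =
      measure_pmf.prob (rbits A p) {g. exp (s * real (cnt D g)) \<ge> exp y}" by simp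
  also have "\<dots> \<le> measure_pmf.expectation (rbits A p) (\<lambda>g. exp (s * real (cnt D g))) / exp y"
    using assms by (intro pmf_Markov) auto
  also have "\<dots> = (1 + p * (exp s - 1)) ^ card D / exp y" using assms by (simp add: rbits_mgf)
  also have "\<dots> \<le> exp (p * (exp s - 1)) ^ card D / exp y"
  proof (intro divide_right_mono power_mono)
    have "p * (exp s - 1) \<ge> p * (- 1)" using assms by (intro mult_left_mono) auto
    then show "0 \<le> 1 + p * (exp s - 1)" using assms by simp
  qed auto
  also have "\<dots> = exp (p * (exp s - 1) * real (card D) - y)"
    by (simp add: exp_diff exp_of_nat_mult[symmetric] mult.commute)
  finally show ?thesis .
qed

lemma rbits_lower_tail:
  assumes "finite A" "D \<subseteq> A" "0 \<le> p" "p \<le> 1" "t \<ge> 0"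
  shows "measure_pmf.prob (rbits A p) {g. real (cnt D g) \<le> m} \<le> exp (t * m - p * (1 - exp (- t)) * real (card D))"
proof -
  have "measure_pmf.prob (rbits A p) {g. real (cnt D g) \<le> m} \<le>
      measure_pmf.prob (rbits A p) {g. (- t) * real (cnt D g) \<ge> - t * m}"
    using assms(5) by (intro prob_mono_support) (auto intro: mult_left_mono)
  also have "\<dots> \<le> exp (p * (exp (- t) - 1) * real (card D) - (- t * m))"
    by (rule rbits_chernoff[OF assms(1-4)])
  finally show ?thesis by (simp add: algebra_simps)
qed

lemma rbits_upper_tail:
  assumes "finite A" "D \<subseteq> A" "0 \<le> p" "p \<le> 1" "t \<ge> 0"
  shows "measure_pmf.prob (rbits A p) {g. real (cnt D g) \<ge> m} \<le> exp (p * (exp t - 1) * real (card D) - t * m)"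
proof -
  have "measure_pmf.prob (rbits A p) {g. real (cnt D g) \<ge> m} \<le>
      measure_pmf.prob (rbits A p) {g. t * real (cnt D g) \<ge> t * m}"
    using assms(5) by (intro prob_mono_support) (auto intro: mult_left_mono)
  also have "\<dots> \<le> exp (p * (exp t - 1) * real (card D) - t * m)"
    by (rule rbits_chernoff[OF assms(1-4)])
  finally show ?thesis .
qed

text \<open>Chebyshev's inequality for a weighted sum of nearly independent indicators. The diagonal
  contributes \<open>K * \<mu>\<close> because weights are at most K, the rest at most
  \<open>(\<rho> - 1) * \<mu>\<^sup>2\<close>. It serves twice: with weight \<open>card S\<close>
  for small components, where distinct components cannot overlap, and with weight 1 for pendant
  paths.\<close>

lemma second_moment:
  fixes w :: "'i \<Rightarrow> real"
  assumes fin: "finite (set_pmf M)" "finite I" and w: "\<And>i. i \<in> I \<Longrightarrow> 0 \<le> w i \<and> w i \<le> K"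
    and pairs: "\<And>i j. i \<in> I \<Longrightarrow> j \<in> I \<Longrightarrow> i \<noteq> j \<Longrightarrow> measure_pmf.prob M {x. P i x \<and> P j x} \<le>
        \<rho> * (measure_pmf.prob M {x. P i x} * measure_pmf.prob M {x. P j x})"
    and rho: "\<rho> \<ge> 0" and \<mu>: "\<mu> = (\<Sum>i\<in>I. w i * measure_pmf.prob M {x. P i x})" and t: "t > 0"
  shows "measure_pmf.prob M {x. \<bar>(\<Sum>i\<in>I. w i * of_bool (P i x)) - \<mu>\<bar> \<ge> t} \<le> (K * \<mu> + (\<rho> - 1) * \<mu>\<^sup>2) / t\<^sup>2"
proof -
  define X where "X = (\<lambda>x. \<Sum>i\<in>I. w i * of_bool (P i x))"
  define q where "q = (\<lambda>i. measure_pmf.prob M {x. P i x})"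
  have int: "integrable (measure_pmf M) (f :: _ \<Rightarrow> real)" for f
    using fin(1) by (rule integrable_measure_pmf_finite)
  have EX: "measure_pmf.expectation M X = \<mu>"
    unfolding X_def \<mu> by (rule expectation_weighted_count[OF fin])
  have "(X x)\<^sup>2 = (\<Sum>z\<in>I \<times> I. (w (fst z) * w (snd z)) * of_bool (P (fst z) x \<and> P (snd z) x))" for x
    unfolding X_def power2_eq_square sum_product sum.cartesian_product
    by (intro sum.cong) auto
  then have "measure_pmf.expectation M (\<lambda>x. (X x)\<^sup>2) =
      (\<Sum>z\<in>I \<times> I. (w (fst z) * w (snd z)) * measure_pmf.prob M {x. P (fst z) x \<and> P (snd z) x})"
    using expectation_weighted_count[OF fin(1), of "I \<times> I" "\<lambda>z. w (fst z) * w (snd z)"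
        "\<lambda>z x. P (fst z) x \<and> P (snd z) x"] fin(2) by simp
  \<comment> \<open>The off-diagonal bound is added on the diagonal as well, so that its sum factors
    into the square of the mean.\<close>
  also have "\<dots> \<le> (\<Sum>z\<in>I \<times> I. (if fst z = snd z then K * (w (fst z) * q (fst z)) else 0)
      + \<rho> * ((w (fst z) * q (fst z)) * (w (snd z) * q (snd z))))"
  proof (intro sum_mono)
    fix z assume "z \<in> I \<times> I"
    then obtain i j where z: "z = (i, j)" "i \<in> I" "j \<in> I" by auto
    have q: "q i \<ge> 0" "q j \<ge> 0" by (auto simp: q_def)
    show "w (fst z) * w (snd z) * measure_pmf.prob M {x. P (fst z) x \<and> P (snd z) x} \<le>
      (if fst z = snd z then K * (w (fst z) * q (fst z)) else 0)
      + \<rho> * ((w (fst z) * q (fst z)) * (w (snd z) * q (snd z)))"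
    proof (cases "i = j")
      case True
      have "w i * (w i * q i) \<le> K * (w i * q i)" "0 \<le> \<rho> * ((w i * q i) * (w i * q i))"
        using w[of i] z q rho by (auto intro!: mult_right_mono)
      then show ?thesis using True z by (auto simp: q_def mult_ac)
    next
      case False
      have "(w i * w j) * measure_pmf.prob M {x. P i x \<and> P j x} \<le> (w i * w j) * (\<rho> * (q i * q j))"
        using pairs[of i j] False z w[of i] w[of j] by (intro mult_left_mono) (auto simp: q_def)
      then show ?thesis using False z by (simp add: mult_ac)
    qed
  qed
  also have "\<dots> = (\<Sum>i\<in>I. \<Sum>j\<in>I. if i = j then K * (w i * q i) else 0)
      + \<rho> * (\<Sum>i\<in>I. \<Sum>j\<in>I. (w i * q i) * (w j * q j))"
    by (simp add: sum.distrib sum_distrib_left sum.cartesian_product case_prod_unfold)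
  also have "(\<Sum>i\<in>I. \<Sum>j\<in>I. if i = j then K * (w i * q i) else 0) = K * \<mu>"
    using fin(2) by (simp add: sum.delta \<mu> q_def sum_distrib_left)
  also have "(\<Sum>i\<in>I. \<Sum>j\<in>I. (w i * q i) * (w j * q j)) = \<mu>\<^sup>2"
    by (simp add: \<mu> q_def sum_product power2_eq_square)
  finally have EX2: "measure_pmf.expectation M (\<lambda>x. (X x)\<^sup>2) \<le> K * \<mu> + \<rho> * \<mu>\<^sup>2" .
  have "measure_pmf.expectation M (\<lambda>x. (X x - \<mu>)\<^sup>2) =
      measure_pmf.expectation M (\<lambda>x. (X x)\<^sup>2 + (\<mu>\<^sup>2 - 2 * \<mu> * X x))"
    by (intro Bochner_Integration.integral_cong) (auto simp: power2_eq_square algebra_simps)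
  also have "\<dots> = measure_pmf.expectation M (\<lambda>x. (X x)\<^sup>2) + (\<mu>\<^sup>2 - 2 * \<mu> * measure_pmf.expectation M X)"
    by (simp add: int)
  also have "\<dots> \<le> K * \<mu> + (\<rho> - 1) * \<mu>\<^sup>2"
    using EX2 by (simp add: EX power2_eq_square algebra_simps)
  finally have E: "measure_pmf.expectation M (\<lambda>x. (X x - \<mu>)\<^sup>2) \<le> K * \<mu> + (\<rho> - 1) * \<mu>\<^sup>2" .
  have "measure_pmf.prob M {x. \<bar>X x - \<mu>\<bar> \<ge> t} \<le> measure_pmf.prob M {x. (X x - \<mu>)\<^sup>2 \<ge> t\<^sup>2}"
    using t by (intro prob_mono_support) (simp add: abs_le_square_iff[symmetric])
  also have "\<dots> \<le> measure_pmf.expectation M (\<lambda>x. (X x - \<mu>)\<^sup>2) / t\<^sup>2"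
    using t by (intro pmf_Markov fin) auto
  also have "\<dots> \<le> (K * \<mu> + (\<rho> - 1) * \<mu>\<^sup>2) / t\<^sup>2"
    using E by (intro divide_right_mono) auto
  finally show ?thesis unfolding X_def .
qed

section \<open>Cuts, components and conductance\<close>

definition inner_pairs :: "nat set \<Rightarrow> (nat \<times> nat) set" where
  "inner_pairs S = {(i, j). i \<in> S \<and> j \<in> S \<and> i < j}"

definition cut_pairs :: "nat set \<Rightarrow> nat set \<Rightarrow> (nat \<times> nat) set" where
  "cut_pairs S T = {(i, j). i < j \<and> (i \<in> S \<and> j \<in> T \<or> i \<in> T \<and> j \<in> S)}"

definition touch :: "(nat \<times> nat \<Rightarrow> bool) \<Rightarrow> nat set \<Rightarrow> nat set \<Rightarrow> bool" where
  "touch g S T \<longleftrightarrow> (\<exists>e\<in>cut_pairs S T. g e)"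

text \<open>Connectedness through cuts instead of walks. It is then visibly an event about the bits
  in \<open>inner_pairs S\<close>, and a set that is not connected splits at once into two parts
  without an edge between them.\<close>

definition conn :: "(nat \<times> nat \<Rightarrow> bool) \<Rightarrow> nat set \<Rightarrow> bool" where
  "conn g S \<longleftrightarrow> S \<noteq> {} \<and> (\<forall>T. T \<subseteq> S \<and> T \<noteq> {} \<and> T \<noteq> S \<longrightarrow> touch g T (S - T))"

definition iscomp :: "(nat \<times> nat \<Rightarrow> bool) \<Rightarrow> nat set \<Rightarrow> nat set \<Rightarrow> bool" where
  "iscomp g V S \<longleftrightarrow> S \<subseteq> V \<and> conn g S \<and> \<not> touch g S (V - S)"

definition graph_on :: "nat \<Rightarrow> (nat \<times> nat \<Rightarrow> bool) \<Rightarrow> bool" where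
  "graph_on n g \<longleftrightarrow> (\<forall>e. g e \<longrightarrow> e \<in> pairs n)"

abbreviation cut :: "(nat \<times> nat \<Rightarrow> bool) \<Rightarrow> nat set \<Rightarrow> nat set \<Rightarrow> nat" where
  "cut g V S \<equiv> cnt (cut_pairs S (V - S)) g"

text \<open>This is the degree sum of S inside V, see \<open>vol_eq_sum\<close>. Written through
  inner and boundary edges it can be bounded by edge counts directly.\<close>

definition vol :: "(nat \<times> nat \<Rightarrow> bool) \<Rightarrow> nat set \<Rightarrow> nat set \<Rightarrow> nat" where
  "vol g V S = 2 * cnt (inner_pairs S) g + cut g V S"

section \<open>Potential edges inside a set and between two sets\<close>

lemma pairs_eq: "pairs n = inner_pairs {1..n}"
  by (auto simp: pairs_def inner_pairs_def)

lemma finite_inner_pairs [simp]: "finite S \<Longrightarrow> finite (inner_pairs S)"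
  by (rule finite_subset[of _ "S \<times> S"]) (auto simp: inner_pairs_def)

lemma finite_cut_pairs [simp]: "finite S \<Longrightarrow> finite T \<Longrightarrow> finite (cut_pairs S T)"
  by (rule finite_subset[of _ "(S \<union> T) \<times> (S \<union> T)"]) (auto simp: cut_pairs_def)

lemma finite_pairs [simp]: "finite (pairs n)"
  by (simp add: pairs_eq)

lemma inner_pairs_mono: "S \<subseteq> T \<Longrightarrow> inner_pairs S \<subseteq> inner_pairs T"
  by (auto simp: inner_pairs_def)

lemma cut_pairs_subset_inner: "S \<subseteq> V \<Longrightarrow> T \<subseteq> V \<Longrightarrow> cut_pairs S T \<subseteq> inner_pairs V"
  by (auto simp: inner_pairs_def cut_pairs_def)

lemma cut_pairs_mono: "S \<subseteq> S' \<Longrightarrow> T \<subseteq> T' \<Longrightarrow> cut_pairs S T \<subseteq> cut_pairs S' T'"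
  by (auto simp: cut_pairs_def)

lemma cut_pairs_commute: "cut_pairs S T = cut_pairs T S"
  by (auto simp: cut_pairs_def)

lemma inner_cut_disjoint: "inner_pairs S \<inter> cut_pairs S (V - S) = {}"
  by (auto simp: inner_pairs_def cut_pairs_def)

lemma cut_pairs_Un: "cut_pairs S (T \<union> U) = cut_pairs S T \<union> cut_pairs S U"
  by (auto simp: cut_pairs_def)

lemma inner_pairs_Un: "inner_pairs (S \<union> T) = inner_pairs S \<union> inner_pairs T \<union> cut_pairs S T"
  by (auto simp: inner_pairs_def cut_pairs_def)

lemma cut_pairs_inter: "T \<inter> U = {} \<Longrightarrow> S \<inter> T = {} \<Longrightarrow> S \<inter> U = {} \<Longrightarrow> cut_pairs S T \<inter> cut_pairs S U = {}"
  by (auto simp: cut_pairs_def)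

lemma cnt_Un: "finite A \<Longrightarrow> finite B \<Longrightarrow> A \<inter> B = {} \<Longrightarrow> cnt (A \<union> B) g = cnt A g + cnt B g"
  unfolding cnt_def by (subst card_Un_disjoint[symmetric]) (auto intro!: arg_cong[where f = card])

lemma cnt_mono: "finite B \<Longrightarrow> A \<subseteq> B \<Longrightarrow> cnt A g \<le> cnt B g"
  unfolding cnt_def by (rule card_mono) auto

lemma cnt_empty [simp]: "cnt {} g = 0"
  by (simp add: cnt_def)

lemma cut_pairs_empty [simp]: "cut_pairs {} T = {}" "cut_pairs S {} = {}"
  by (auto simp: cut_pairs_def)

lemma inner_pairs_empty [simp]: "inner_pairs {} = {}"
  by (auto simp: inner_pairs_def)

lemma inner_pairs_singleton [simp]: "inner_pairs {v} = {}"
  by (auto simp: inner_pairs_def)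

lemma touch_iff_cnt: "finite S \<Longrightarrow> finite T \<Longrightarrow> touch g S T \<longleftrightarrow> cnt (cut_pairs S T) g > 0"
  unfolding touch_def cnt_def by (auto simp: card_gt_0_iff)

lemma touch_mono: "touch g S T \<Longrightarrow> S \<subseteq> S' \<Longrightarrow> T \<subseteq> T' \<Longrightarrow> touch g S' T'"
  unfolding touch_def using cut_pairs_mono by blast

lemma touch_commute: "touch g S T = touch g T S"
  unfolding touch_def by (simp add: cut_pairs_commute)

lemma touch_Un: "touch g S (T \<union> U) \<longleftrightarrow> touch g S T \<or> touch g S U"
  unfolding touch_def cut_pairs_Un by blast

lemma card_cut_pairs:
  assumes "finite S" "finite T" "S \<inter> T = {}"
  shows "card (cut_pairs S T) = card S * card T"
proof -
  have "bij_betw (\<lambda>(a, b). (min a b, max a b)) (S \<times> T) (cut_pairs S T)"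
    unfolding bij_betw_def
  proof
    show "inj_on (\<lambda>(a, b). (min a b, max a b)) (S \<times> T)"
      using assms(3) by (auto simp: inj_on_def min_def max_def split: if_splits)
    show "(\<lambda>(a, b). (min a b, max a b)) ` (S \<times> T) = cut_pairs S T"
    proof (intro equalityI subsetI)
      fix e assume "e \<in> cut_pairs S T"
      then consider i j where "e = (i, j)" "i < j" "i \<in> S" "j \<in> T" | i j where "e = (i, j)" "i < j" "i \<in> T" "j \<in> S"
        by (auto simp: cut_pairs_def)
      then show "e \<in> (\<lambda>(a, b). (min a b, max a b)) ` (S \<times> T)"
      proof cases
        case 1
        then show ?thesis by (intro image_eqI[of _ _ "(i, j)"]) auto
      next
        case 2
        then show ?thesis by (intro image_eqI[of _ _ "(j, i)"]) auto
      qed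
    qed (use assms(3) in \<open>auto simp: cut_pairs_def min_def max_def order.order_iff_strict\<close>)
  qed
  then have "card (S \<times> T) = card (cut_pairs S T)" by (rule bij_betw_same_card)
  then show ?thesis by (simp add: card_cartesian_product)
qed

lemma card_inner_pairs: "finite S \<Longrightarrow> 2 * card (inner_pairs S) + card S = (card S)\<^sup>2"
proof (induction S rule: finite_induct)
  case (insert v S)
  have "inner_pairs (insert v S) = inner_pairs S \<union> cut_pairs {v} S"
    using inner_pairs_Un[of "{v}" S] by (simp add: Un_commute)
  moreover have "inner_pairs S \<inter> cut_pairs {v} S = {}"
    using insert by (auto simp: inner_pairs_def cut_pairs_def)
  ultimately have "card (inner_pairs (insert v S)) = card (inner_pairs S) + card S"
    using insert by (simp add: card_Un_disjoint card_cut_pairs)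
  then show ?case using insert by (simp add: power2_eq_square algebra_simps)
qed simp

lemma card_inner_pairs_le: "finite S \<Longrightarrow> real (card (inner_pairs S)) \<le> (real (card S))\<^sup>2 / 2"
proof -
  assume "finite S"
  then have "real (2 * card (inner_pairs S) + card S) = real ((card S)\<^sup>2)"
    by (simp only: card_inner_pairs)
  then show ?thesis by simp
qed

section \<open>Connected sets and components\<close>

lemma conn_depends: "depends_only_on (inner_pairs S) (\<lambda>g. conn g S)"
proof -
  have "conn g S \<Longrightarrow> conn h S" if e: "\<forall>e\<in>inner_pairs S. g e = h e" for g h
  proof -
    have "touch g T (S - T) \<longrightarrow> touch h T (S - T)" if "T \<subseteq> S" for T
      unfolding touch_def using e cut_pairs_subset_inner[OF that, of "S - T"] by blast
    then show "conn g S \<Longrightarrow> conn h S" unfolding conn_def by blast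
  qed
  then show ?thesis unfolding depends_only_on_def by metis
qed

lemma iscomp_disjoint_aux:
  assumes "iscomp g V S" "iscomp g V T" "S \<inter> T \<noteq> {}"
  shows "S \<subseteq> T"
proof (rule ccontr)
  assume "\<not> S \<subseteq> T"
  then have "S \<inter> T \<subseteq> S" "S \<inter> T \<noteq> S" by auto
  then have "touch g (S \<inter> T) (S - S \<inter> T)"
    using assms(1,3) unfolding iscomp_def conn_def by blast
  moreover have "S - S \<inter> T \<subseteq> V - T" using assms unfolding iscomp_def by auto
  ultimately have "touch g T (V - T)" by (rule touch_mono[OF _ Int_lower2])
  then show False using assms unfolding iscomp_def by auto
qed

lemma iscomp_disjoint:
  assumes "iscomp g V S" "iscomp g V T" "S \<noteq> T"
  shows "S \<inter> T = {}"
  using iscomp_disjoint_aux[OF assms(1,2)] iscomp_disjoint_aux[OF assms(2,1)] assms(3) by blast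

text \<open>Take a smallest set containing v that no edge leaves. If it split into two parts without
  an edge between them, the part containing v would be a smaller such set.\<close>

lemma ex_iscomp:
  assumes "finite V" "v \<in> V"
  obtains Q where "v \<in> Q" "iscomp g V Q"
proof -
  define P where "P = (\<lambda>Q. v \<in> Q \<and> Q \<subseteq> V \<and> \<not> touch g Q (V - Q))"
  have "P V" using assms by (auto simp: P_def touch_def)
  then obtain Q where Q: "P Q" and min: "\<And>R. P R \<Longrightarrow> card Q \<le> card R"
    using ex_has_least_nat[of P V card] by blast
  have "conn g Q"
    unfolding conn_def
  proof (intro conjI allI impI)
    show "Q \<noteq> {}" using Q by (auto simp: P_def)
    fix T assume T: "T \<subseteq> Q \<and> T \<noteq> {} \<and> T \<noteq> Q"
    show "touch g T (Q - T)"
    proof (rule ccontr)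
      assume nt: "\<not> touch g T (Q - T)"
      have fQ: "finite Q" using Q assms by (auto simp: P_def intro: finite_subset)
      have QV: "Q \<subseteq> V" "v \<in> Q" "\<not> touch g Q (V - Q)" using Q by (auto simp: P_def)
      have "\<exists>R. P R \<and> R \<subset> Q"
      proof (cases "v \<in> T")
        case True
        have "V - T = (Q - T) \<union> (V - Q)" using T QV by auto
        then have "\<not> touch g T (V - T)"
          using nt QV(3) T touch_mono[of g T "V - Q" Q "V - Q"] by (auto simp: touch_Un)
        moreover have "T \<subset> Q" "T \<subseteq> V" using T QV(1) by auto
        ultimately show ?thesis using True unfolding P_def by blast
      next
        case False
        have "V - (Q - T) = T \<union> (V - Q)" using T QV by auto
        moreover have "\<not> touch g (Q - T) T" using nt by (simp add: touch_commute)
        ultimately have "\<not> touch g (Q - T) (V - (Q - T))"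
          using QV(3) touch_mono[of g "Q - T" "V - Q" Q "V - Q"] by (auto simp: touch_Un)
        moreover have "Q - T \<subset> Q" "Q - T \<subseteq> V" "v \<in> Q - T" using T QV(1,2) False by auto
        ultimately show ?thesis unfolding P_def by blast
      qed
      then obtain R where "P R" "R \<subset> Q" by blast
      then show False using min[of R] psubset_card_mono[OF fQ, of R] by simp
    qed
  qed
  then have "iscomp g V Q" using Q by (auto simp: iscomp_def P_def)
  then show ?thesis using that Q by (auto simp: P_def)
qed

lemma conn_subset_iscomp:
  assumes "conn g S" "S \<subseteq> V" "iscomp g V C" "S \<inter> C \<noteq> {}"
  shows "S \<subseteq> C"
proof (rule ccontr)
  assume "\<not> S \<subseteq> C"
  then have "S \<inter> C \<subseteq> S" "S \<inter> C \<noteq> S" by auto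
  then have "touch g (S \<inter> C) (S - S \<inter> C)"
    using assms(1,4) unfolding conn_def by blast
  moreover have "S - S \<inter> C \<subseteq> V - C" using assms by auto
  ultimately have "touch g C (V - C)" by (rule touch_mono[OF _ Int_lower2])
  then show False using assms unfolding iscomp_def by auto
qed

text \<open>Components partition V. In expectation this yields the upper bound on the number of
  connected sets; combined with concentration it yields the giant.\<close>

lemma sum_card_iscomp_eq:
  assumes "finite V"
  shows "(\<Sum>S | S \<subseteq> V \<and> iscomp g V S. card S) = card V"
proof -
  let ?F = "{S. S \<subseteq> V \<and> iscomp g V S}"
  have "(\<Sum>S\<in>?F. card S) = card (\<Union>?F)"
    using assms iscomp_disjoint[of g V]
    by (intro card_Union_disjoint[symmetric]) (auto simp: pairwise_def disjnt_def intro: finite_subset)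
  also have "\<Union>?F = V"
  proof
    show "V \<subseteq> \<Union>?F"
    proof
      fix v assume "v \<in> V"
      then obtain Q where "v \<in> Q" "iscomp g V Q" using ex_iscomp[OF assms] by blast
      then show "v \<in> \<Union>?F" by (auto simp: iscomp_def)
    qed
  qed auto
  finally show ?thesis .
qed

section \<open>Translation of reachability, degrees and edge counts into sets of pairs\<close>

lemma adj_sym: "adj g u v = adj g v u"
  by (auto simp: adj_def)

lemma touch_iff_adj:
  assumes "graph_on n g" "S \<inter> T = {}"
  shows "touch g S T \<longleftrightarrow> (\<exists>u\<in>S. \<exists>v\<in>T. adj g u v)"
proof
  assume "touch g S T"
  then show "\<exists>u\<in>S. \<exists>v\<in>T. adj g u v" unfolding touch_def cut_pairs_def adj_def by blast
next
  assume "\<exists>u\<in>S. \<exists>v\<in>T. adj g u v"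
  then obtain u v where "u \<in> S" "v \<in> T" "g (u, v) \<or> g (v, u)" by (auto simp: adj_def)
  then show "touch g S T"
    using assms(1) unfolding touch_def cut_pairs_def graph_on_def pairs_def by fastforce
qed

lemma graph_on_support: "g \<in> set_pmf (Gnp n p) \<Longrightarrow> graph_on n g"
  unfolding Gnp_def graph_on_def using set_rbits[of "pairs n" g p] by (auto simp: rbits_def)

lemma component_iff_iscomp:
  assumes g: "graph_on n g"
  shows "component n g C \<longleftrightarrow> iscomp g {1..n} C"
proof
  assume "component n g C"
  then obtain v where v: "v \<in> {1..n}" and C: "C = {u. (adj g)\<^sup>*\<^sup>* v u}" unfolding component_def by blast
  \<comment> \<open>Induction over reachability, where closedness of T is only demanded at vertices
    already in C. It is applied to the vertex set and to either side of a supposed split of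
    C.\<close>
  have closed: "u \<in> T" if "(adj g)\<^sup>*\<^sup>* v u" "v \<in> T" "\<And>a b. a \<in> T \<Longrightarrow> a \<in> C \<Longrightarrow> adj g a b \<Longrightarrow> b \<in> T" for u T
    using that(1)
  proof (induction rule: rtranclp_induct)
    case (step a b)
    then show ?case using that(3) C by blast
  qed (use that in auto)
  have step: "b \<in> C" if "a \<in> C" "adj g a b" for a b
    using that C rtranclp.rtrancl_into_rtrancl[of "adj g" v a b] by simp
  have sub: "C \<subseteq> {1..n}"
  proof
    fix u assume "u \<in> C"
    then have "(adj g)\<^sup>*\<^sup>* v u" using C by simp
    then show "u \<in> {1..n}"
    proof (rule closed[OF _ v])
      fix a b assume "adj g a b"
      then show "b \<in> {1..n}" using g by (fastforce simp: adj_def graph_on_def pairs_def)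
    qed
  qed
  have "conn g C"
    unfolding conn_def
  proof (intro conjI allI impI)
    show "C \<noteq> {}" using C by auto
    fix T assume T: "T \<subseteq> C \<and> T \<noteq> {} \<and> T \<noteq> C"
    show "touch g T (C - T)"
    proof (rule ccontr)
      assume "\<not> touch g T (C - T)"
      then have nt: "\<And>a b. a \<in> T \<Longrightarrow> b \<in> C - T \<Longrightarrow> \<not> adj g a b" using touch_iff_adj[OF g, of T "C - T"] by auto
      show False
      proof (cases "v \<in> T")
        case True
        have "C \<subseteq> T"
        proof
          fix u assume "u \<in> C"
          then have "(adj g)\<^sup>*\<^sup>* v u" using C by simp
          then show "u \<in> T"
          proof (rule closed[OF _ True])
            fix a b assume ab: "a \<in> T" "a \<in> C" "adj g a b"
            have "b \<in> C" by (rule step[OF ab(2,3)])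
            then show "b \<in> T" using nt[of a b] ab by blast
          qed
        qed
        then show False using T by auto
      next
        case False
        then have v: "v \<in> C - T" unfolding C by blast
        have "C \<subseteq> C - T"
        proof
          fix u assume "u \<in> C"
          then have "(adj g)\<^sup>*\<^sup>* v u" using C by simp
          then show "u \<in> C - T"
          proof (rule closed[OF _ v])
            fix a b assume ab: "a \<in> C - T" "a \<in> C" "adj g a b"
            have "b \<in> C" by (rule step[OF ab(2,3)])
            moreover have "adj g b a" using ab(3) by (simp only: adj_sym)
            then have "b \<notin> T" using nt[of b a] ab(1) by blast
            ultimately show "b \<in> C - T" by simp
          qed
        qed
        then show False using T by auto
      qed
    qed
  qed
  moreover have "\<not> touch g C ({1..n} - C)" using touch_iff_adj[OF g, of C "{1..n} - C"] step by blast
  ultimately show "iscomp g {1..n} C" using sub by (simp add: iscomp_def)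
next
  assume C: "iscomp g {1..n} C"
  then obtain v where v: "v \<in> C" unfolding iscomp_def conn_def by auto
  have sub: "C \<subseteq> {1..n}" using C by (auto simp: iscomp_def)
  define D where "D = {u. (adj g)\<^sup>*\<^sup>* v u}"
  have step: "b \<in> C" if "a \<in> C" "adj g a b" for a b
  proof (rule ccontr)
    assume "b \<notin> C"
    moreover have "b \<in> {1..n}" using that g by (fastforce simp: adj_def graph_on_def pairs_def)
    ultimately have "touch g C ({1..n} - C)" using that touch_iff_adj[OF g, of C "{1..n} - C"] by auto
    then show False using C by (simp add: iscomp_def)
  qed
  have "D \<subseteq> C"
  proof
    fix u assume "u \<in> D"
    then have "(adj g)\<^sup>*\<^sup>* v u" by (simp add: D_def)
    then show "u \<in> C" by (induction rule: rtranclp_induct) (use v step in auto)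
  qed
  moreover have "D = C"
  proof (rule ccontr)
    assume "D \<noteq> C"
    moreover have "D \<noteq> {}" by (auto simp: D_def)
    ultimately have "touch g D (C - D)" using \<open>D \<subseteq> C\<close> C unfolding iscomp_def conn_def by auto
    then obtain a b where "a \<in> D" "b \<notin> D" "adj g a b" using touch_iff_adj[OF g, of D "C - D"] by auto
    then show False unfolding D_def by (auto intro: rtranclp.rtrancl_into_rtrancl)
  qed
  ultimately show "component n g C"
    unfolding component_def using v sub by (intro bexI[of _ v]) (auto simp: D_def)
qed

lemma degree_eq_cnt:
  assumes "graph_on n g"
  shows "degree (adj g) V v = cnt (cut_pairs {v} (V - {v})) g"
proof -
  have "bij_betw (\<lambda>u. (min u v, max u v)) {u\<in>V. adj g v u} {e\<in>cut_pairs {v} (V - {v}). g e}"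
    unfolding bij_betw_def
  proof
    show "inj_on (\<lambda>u. (min u v, max u v)) {u\<in>V. adj g v u}"
      by (auto simp: inj_on_def min_def max_def split: if_splits)
    show "(\<lambda>u. (min u v, max u v)) ` {u\<in>V. adj g v u} = {e\<in>cut_pairs {v} (V - {v}). g e}"
    proof (intro equalityI subsetI)
      fix e assume "e \<in> (\<lambda>u. (min u v, max u v)) ` {u\<in>V. adj g v u}"
      then obtain u where u: "u \<in> V" "adj g v u" "e = (min u v, max u v)" by auto
      then have "(v < u \<and> g (v, u)) \<or> (u < v \<and> g (u, v))"
        using assms by (auto simp: adj_def graph_on_def pairs_def)
      then show "e \<in> {e\<in>cut_pairs {v} (V - {v}). g e}" using u by (auto simp: cut_pairs_def min_def max_def)
    next
      fix e assume "e \<in> {e\<in>cut_pairs {v} (V - {v}). g e}"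
      then consider u where "e = (v, u)" "v < u" "u \<in> V" "g e" | u where "e = (u, v)" "u < v" "u \<in> V" "g e"
        by (auto simp: cut_pairs_def)
      then show "e \<in> (\<lambda>u. (min u v, max u v)) ` {u\<in>V. adj g v u}"
      proof cases
        case 1
        then show ?thesis by (intro image_eqI[of _ _ u]) (auto simp: adj_def)
      next
        case 2
        then show ?thesis by (intro image_eqI[of _ _ u]) (auto simp: adj_def)
      qed
    qed
  qed
  then show ?thesis unfolding degree_def cnt_def by (rule bij_betw_same_card)
qed

lemma edge_sets_card:
  assumes "\<And>e. e \<in> D \<Longrightarrow> fst e < (snd e :: nat)"
  shows "card ((\<lambda>e. {fst e, snd e}) ` D) = card D"
proof (rule card_image)
  show "inj_on (\<lambda>e. {fst e, snd e}) D"
  proof (rule inj_onI)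
    fix e f assume "e \<in> D" "f \<in> D" "{fst e, snd e} = {fst f, snd f}"
    then show "e = f" using assms[of e] assms[of f] by (auto simp: doubleton_eq_iff prod_eq_iff)
  qed
qed

lemma num_edges_eq_cnt:
  assumes "graph_on n g"
  shows "num_edges (adj g) V = cnt (inner_pairs V) g"
proof -
  have "{{u, w} | u w. u \<in> V \<and> w \<in> V \<and> adj g u w} = (\<lambda>e. {fst e, snd e}) ` {e\<in>inner_pairs V. g e}"
    (is "?L = ?R")
  proof (intro equalityI subsetI)
    fix x assume "x \<in> ?L"
    then obtain u w where x: "x = {u, w}" "u \<in> V" "w \<in> V" "g (u, w) \<or> g (w, u)" by (auto simp: adj_def)
    then consider "g (u, w)" "u < w" | "g (w, u)" "w < u"
      using assms by (auto simp: graph_on_def pairs_def)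
    then show "x \<in> ?R"
    proof cases
      case 1
      then show ?thesis using x by (intro image_eqI[of _ _ "(u, w)"]) (auto simp: inner_pairs_def)
    next
      case 2
      then show ?thesis using x by (intro image_eqI[of _ _ "(w, u)"]) (auto simp: inner_pairs_def)
    qed
  next
    fix x assume "x \<in> ?R"
    then obtain a b where "x = {a, b}" "a \<in> V" "b \<in> V" "g (a, b)" by (auto simp: inner_pairs_def)
    then show "x \<in> ?L" by (auto simp: adj_def)
  qed
  then show ?thesis unfolding num_edges_def cnt_def
    by (simp only:) (rule edge_sets_card, auto simp: inner_pairs_def)
qed

lemma edges_out_eq_cut:
  assumes "graph_on n g"
  shows "edges_out (adj g) V S = cut g V S"
proof -
  have "{{u, w} | u w. u \<in> S \<and> w \<in> V - S \<and> adj g u w} = (\<lambda>e. {fst e, snd e}) ` {e\<in>cut_pairs S (V - S). g e}"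
    (is "?L = ?R")
  proof (intro equalityI subsetI)
    fix x assume "x \<in> ?L"
    then obtain u w where x: "x = {u, w}" "u \<in> S" "w \<in> V - S" "g (u, w) \<or> g (w, u)" by (auto simp: adj_def)
    then consider "g (u, w)" "u < w" | "g (w, u)" "w < u"
      using assms by (auto simp: graph_on_def pairs_def)
    then show "x \<in> ?R"
    proof cases
      case 1
      then show ?thesis using x by (intro image_eqI[of _ _ "(u, w)"]) (auto simp: cut_pairs_def)
    next
      case 2
      then show ?thesis using x by (intro image_eqI[of _ _ "(w, u)"]) (auto simp: cut_pairs_def)
    qed
  next
    fix x assume "x \<in> ?R"
    then obtain a b where x: "x = {a, b}" "g (a, b)" "(a \<in> S \<and> b \<in> V - S) \<or> (a \<in> V - S \<and> b \<in> S)"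
      by (auto simp: cut_pairs_def)
    then have "adj g a b" "adj g b a" by (auto simp: adj_def)
    then show "x \<in> ?L" using x by (auto simp: insert_commute)
  qed
  then show ?thesis unfolding edges_out_def cnt_def
    by (simp only:) (rule edge_sets_card, auto simp: cut_pairs_def)
qed

section \<open>Additivity of volumes and cuts, and bounds on the conductance\<close>

lemma vol_insert:
  assumes "finite V" "insert v S \<subseteq> V" "v \<notin> S"
  shows "vol g V (insert v S) = vol g V S + cnt (cut_pairs {v} (V - {v})) g"
proof -
  have fin: "finite S" using assms finite_subset by auto
  let ?R = "V - insert v S"
  have "inner_pairs (insert v S) = inner_pairs S \<union> cut_pairs {v} S"
    using inner_pairs_Un[of "{v}" S] by (simp add: Un_commute)
  moreover have "inner_pairs S \<inter> cut_pairs {v} S = {}"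
    using assms by (auto simp: inner_pairs_def cut_pairs_def)
  ultimately have 1: "cnt (inner_pairs (insert v S)) g = cnt (inner_pairs S) g + cnt (cut_pairs {v} S) g"
    using fin by (simp add: cnt_Un)
  have "cut_pairs (insert v S) ?R = cut_pairs {v} ?R \<union> cut_pairs S ?R" by (auto simp: cut_pairs_def)
  moreover have "cut_pairs {v} ?R \<inter> cut_pairs S ?R = {}" using assms by (auto simp: cut_pairs_def)
  ultimately have 2: "cut g V (insert v S) = cnt (cut_pairs {v} ?R) g + cnt (cut_pairs S ?R) g"
    using fin assms by (simp add: cnt_Un)
  have "V - {v} = S \<union> ?R" using assms by auto
  then have "cut_pairs {v} (V - {v}) = cut_pairs {v} S \<union> cut_pairs {v} ?R" by (simp only: cut_pairs_Un)
  moreover have "cut_pairs {v} S \<inter> cut_pairs {v} ?R = {}" using assms by (intro cut_pairs_inter) auto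
  ultimately have 3: "cnt (cut_pairs {v} (V - {v})) g = cnt (cut_pairs {v} S) g + cnt (cut_pairs {v} ?R) g"
    using fin assms by (simp add: cnt_Un)
  have "V - S = {v} \<union> ?R" using assms by auto
  then have "cut_pairs S (V - S) = cut_pairs S {v} \<union> cut_pairs S ?R" by (simp only: cut_pairs_Un)
  moreover have "cut_pairs S {v} \<inter> cut_pairs S ?R = {}" using assms by (intro cut_pairs_inter) auto
  ultimately have 4: "cut g V S = cnt (cut_pairs {v} S) g + cnt (cut_pairs S ?R) g"
    using fin assms by (simp add: cnt_Un cut_pairs_commute)
  \<comment> \<open>An edge from v to S turns from a boundary edge (counted once) into an inner edge
    (counted twice), and an edge from v to the outside becomes a boundary edge: each edge at v adds
    exactly one.\<close>
  show ?thesis unfolding vol_def using 1 2 3 4 by simp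
qed

lemma vol_eq_sum:
  assumes "finite V" "S \<subseteq> V"
  shows "vol g V S = (\<Sum>v\<in>S. cnt (cut_pairs {v} (V - {v})) g)"
proof -
  have "finite S" using assms finite_subset by auto
  then show ?thesis using assms(2)
  proof (induction S rule: finite_induct)
    case (insert v S)
    then show ?case using vol_insert[OF assms(1), of v S] by simp
  qed (simp add: vol_def)
qed

lemma vol_Un:
  assumes "finite V" "S \<subseteq> V" "T \<subseteq> V" "S \<inter> T = {}"
  shows "vol g V (S \<union> T) = vol g V S + vol g V T"
  using assms by (simp add: vol_eq_sum sum.union_disjoint finite_subset[OF _ assms(1)])

lemma cut_split:
  assumes "finite V" "S \<subseteq> V" "T \<subseteq> S" "\<not> touch g T (S - T)"
  shows "cut g V S = cut g V T + cut g V (S - T)"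
proof -
  have fin: "finite S" "finite T"
    using assms finite_subset[of S V] finite_subset[of T S] by auto
  have z: "cnt (cut_pairs T (S - T)) g = 0" using assms(4) fin by (simp add: touch_iff_cnt)
  have "V - T = (S - T) \<union> (V - S)" using assms by auto
  then have "cut_pairs T (V - T) = cut_pairs T (S - T) \<union> cut_pairs T (V - S)" by (simp only: cut_pairs_Un)
  moreover have "cut_pairs T (S - T) \<inter> cut_pairs T (V - S) = {}" using assms by (intro cut_pairs_inter) auto
  ultimately have 1: "cut g V T = cnt (cut_pairs T (V - S)) g" using fin assms z by (simp add: cnt_Un)
  have "V - (S - T) = T \<union> (V - S)" using assms by auto
  then have "cut_pairs (S - T) (V - (S - T)) = cut_pairs T (S - T) \<union> cut_pairs (S - T) (V - S)"
    by (simp only: cut_pairs_Un cut_pairs_commute)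
  moreover have "cut_pairs T (S - T) \<inter> cut_pairs (S - T) (V - S) = {}"
    using assms by (auto simp: cut_pairs_def)
  ultimately have 2: "cut g V (S - T) = cnt (cut_pairs (S - T) (V - S)) g" using fin assms z by (simp add: cnt_Un)
  have "cut_pairs S (V - S) = cut_pairs T (V - S) \<union> cut_pairs (S - T) (V - S)"
    using assms by (auto simp: cut_pairs_def)
  moreover have "cut_pairs T (V - S) \<inter> cut_pairs (S - T) (V - S) = {}" using assms by (auto simp: cut_pairs_def)
  ultimately show ?thesis using 1 2 fin assms by (simp add: cnt_Un)
qed

lemma expansion_from_connected:
  fixes \<beta> :: real
  assumes "finite V" and conn: "\<And>S. S \<subseteq> V \<Longrightarrow> conn g S \<Longrightarrow> 2 * card S \<le> m \<Longrightarrow> \<beta> * vol g V S \<le> cut g V S"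
    and "S \<subseteq> V" "2 * card S \<le> m"
  shows "\<beta> * vol g V S \<le> cut g V S"
  using assms(3,4)
proof (induction "card S" arbitrary: S rule: less_induct)
  case less
  have fin: "finite S" using less.prems assms(1) finite_subset by auto
  show ?case
  proof (cases "S = {} \<or> conn g S")
    case True
    then show ?thesis using conn less.prems by (auto simp: vol_def)
  next
    case False
    then obtain T where T: "T \<subseteq> S" "T \<noteq> {}" "T \<noteq> S" "\<not> touch g T (S - T)" unfolding conn_def by blast
    have c: "card T < card S" using T fin by (intro psubset_card_mono) auto
    moreover have c': "card (S - T) < card S" using T fin by (intro psubset_card_mono) auto
    ultimately have IH: "\<beta> * vol g V T \<le> cut g V T" "\<beta> * vol g V (S - T) \<le> cut g V (S - T)"
      using less.hyps[of T] less.hyps[of "S - T"] less.prems T by auto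
    have "vol g V (T \<union> (S - T)) = vol g V T + vol g V (S - T)"
      using less.prems T by (intro vol_Un assms(1)) auto
    moreover have "T \<union> (S - T) = S" using T by auto
    ultimately have "vol g V S = vol g V T + vol g V (S - T)" by simp
    then show ?thesis using cut_split[OF assms(1) less.prems(1) T(1,4)] IH by (simp add: algebra_simps)
  qed
qed

lemma vol_whole: "vol g V V = 2 * cnt (inner_pairs V) g"
  by (simp add: vol_def)

text \<open>The factored form isolates the ratio of boundary to volume. The remaining factor
  \<open>vol g V V / vol g V (V - S)\<close> is always at least 1, and at most 2 once S has at most
  half of the volume.\<close>

lemma set_conductance_eq:
  assumes g: "graph_on n g" and V: "finite V" "S \<subseteq> V"
  shows "stat (adj g) V S = vol g V S / vol g V V"
    "vol g V V > 0 \<Longrightarrow> set_conductance (adj g) V S = (cut g V S / vol g V S) * (vol g V V / vol g V (V - S))"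
proof -
  have st: "stat (adj g) V S = vol g V S / vol g V V" if "S \<subseteq> V" for S
    unfolding stat_def using V that
    by (simp add: degree_eq_cnt[OF g] num_edges_eq_cnt[OF g] vol_whole vol_eq_sum[of V S])
  show "stat (adj g) V S = vol g V S / vol g V V" using V by (intro st)
  have "Qflow (adj g) V S = cut g V S / vol g V V"
    unfolding Qflow_def by (simp add: edges_out_eq_cut[OF g] num_edges_eq_cnt[OF g] vol_whole)
  then show "set_conductance (adj g) V S = (cut g V S / vol g V S) * (vol g V V / vol g V (V - S))"
    if "vol g V V > 0"
    unfolding set_conductance_def using that V by (simp add: st)
qed

lemma vol_compl: "finite V \<Longrightarrow> S \<subseteq> V \<Longrightarrow> vol g V S + vol g V (V - S) = vol g V V"
  using vol_Un[of V S "V - S" g] by (simp add: Un_absorb1)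

lemma cut_compl: "S \<subseteq> V \<Longrightarrow> cut g V (V - S) = cut g V S"
  by (simp add: cut_pairs_commute double_diff)

lemma conductance_le:
  assumes g: "graph_on n g" and V: "finite V" "S \<subseteq> V" and vol: "vol g V S > 0" "2 * vol g V S \<le> vol g V V"
  shows "conductance (adj g) V \<le> 2 * (cut g V S / vol g V S)"
proof -
  let ?A = "{set_conductance (adj g) V S | S. S \<subseteq> V \<and> 0 < stat (adj g) V S \<and> stat (adj g) V S < 1}"
  have fin: "finite ?A" using V by (intro finite_subset[of ?A "set_conductance (adj g) V ` Pow V"]) auto
  have pos: "vol g V V > 0" and le: "vol g V V \<le> 2 * vol g V (V - S)" "vol g V (V - S) > 0"
    using vol vol_compl[OF V, of g] by auto
  have "0 < stat (adj g) V S" "stat (adj g) V S < 1"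
    unfolding set_conductance_eq(1)[OF g V] using vol pos by (auto simp: divide_simps)
  then have "conductance (adj g) V \<le> set_conductance (adj g) V S"
    unfolding conductance_def using fin V by (intro Min_le) auto
  also have "\<dots> = (cut g V S / vol g V S) * (vol g V V / vol g V (V - S))"
    by (rule set_conductance_eq(2)[OF g V pos])
  also have "\<dots> \<le> (cut g V S / vol g V S) * 2"
  proof (rule mult_left_mono)
    have "real (vol g V V) \<le> 2 * real (vol g V (V - S))" using le by linarith
    then show "real (vol g V V) / real (vol g V (V - S)) \<le> 2" using le(2) by (simp add: divide_le_eq)
  qed simp
  finally show ?thesis by (simp add: mult.commute)
qed

lemma singleton_vol:
  assumes "finite V" "v \<in> V"
  shows "vol g V {v} = cut g V {v}" "2 * vol g V {v} \<le> vol g V V"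
proof -
  show 1: "vol g V {v} = cut g V {v}" by (simp add: vol_def)
  have "cut g V {v} \<le> cnt (inner_pairs V) g"
    using assms by (intro cnt_mono cut_pairs_subset_inner) auto
  then show "2 * vol g V {v} \<le> vol g V V" unfolding vol_whole 1 by simp
qed

lemma conn_singleton_cut:
  assumes "finite V" "conn g V" "v \<in> V" "card V \<ge> 2"
  shows "cut g V {v} > 0"
proof -
  have "V \<noteq> {v}" using assms by auto
  then have "touch g {v} (V - {v})" using assms unfolding conn_def by auto
  then show ?thesis using assms by (simp add: touch_iff_cnt)
qed

lemma conductance_le_2:
  assumes g: "graph_on n g" and V: "finite V" "conn g V" "card V \<ge> 2"
  shows "conductance (adj g) V \<le> 2"
proof -
  obtain v where v: "v \<in> V" using V unfolding conn_def by auto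
  have pos: "vol g V {v} > 0" using conn_singleton_cut[OF V(1,2) v V(3)] singleton_vol[OF V(1) v, of g] by simp
  then have "conductance (adj g) V \<le> 2 * (cut g V {v} / vol g V {v})"
    using v V singleton_vol[OF V(1) v, of g] by (intro conductance_le[OF g]) auto
  then show ?thesis using singleton_vol[OF V(1) v, of g] pos by simp
qed

text \<open>The hypothesis restricts S by its number of vertices although conductance speaks of
  volume. This is harmless: S or its complement qualifies, both have the same boundary, and the
  discarded factor is at least 1 for either of them.\<close>

lemma conductance_ge:
  fixes \<beta> :: real
  assumes g: "graph_on n g" and V: "finite V" "conn g V" "card V \<ge> 2" and \<beta>: "\<beta> \<ge> 0"
    and conn: "\<And>S. S \<subseteq> V \<Longrightarrow> conn g S \<Longrightarrow> 2 * card S \<le> card V \<Longrightarrow> \<beta> * vol g V S \<le> cut g V S"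
  shows "\<beta> \<le> conductance (adj g) V"
proof -
  let ?A = "{set_conductance (adj g) V S | S. S \<subseteq> V \<and> 0 < stat (adj g) V S \<and> stat (adj g) V S < 1}"
  have fin: "finite ?A" using V by (intro finite_subset[of ?A "set_conductance (adj g) V ` Pow V"]) auto
  obtain v where v: "v \<in> V" using V unfolding conn_def by auto
  have vpos: "vol g V {v} > 0" using conn_singleton_cut[OF V(1,2) v V(3)] singleton_vol[OF V(1) v, of g] by simp
  then have pos: "vol g V V > 0" using singleton_vol(2)[OF V(1) v, of g] by simp
  \<comment> \<open>A single vertex has positive volume and at most half of the total, so the
    minimum ranges over a nonempty family.\<close>
  have "0 < stat (adj g) V {v}" "stat (adj g) V {v} < 1"
    using set_conductance_eq(1)[OF g V(1), of "{v}"] v vpos pos singleton_vol(2)[OF V(1) v, of g]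
    by (simp_all add: divide_less_eq)
  then have ne: "?A \<noteq> {}" using v by blast
  have "\<beta> \<le> set_conductance (adj g) V S" if S: "S \<subseteq> V" "0 < stat (adj g) V S" "stat (adj g) V S < 1" for S
  proof -
    have s: "vol g V S > 0" "vol g V S < vol g V V"
      using S pos by (auto simp: set_conductance_eq(1)[OF g V(1) S(1)] divide_simps split: if_splits)
    then have s': "vol g V (V - S) > 0" "vol g V (V - S) < vol g V V" using vol_compl[OF V(1) S(1), of g] by auto
    have half: "\<beta> * vol g V T \<le> cut g V T" if "T \<subseteq> V" "2 * card T \<le> card V" for T
      using expansion_from_connected[OF V(1) conn that] by blast
    have aux: "\<beta> \<le> x / y * (w / z)" if "\<beta> * y \<le> x" "0 < y" "0 < z" "z \<le> w" for x y z w :: real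
    proof -
      have "\<beta> \<le> x / y" using that by (simp add: le_divide_eq)
      moreover have "1 \<le> w / z" using that by simp
      ultimately show ?thesis using \<beta> mult_mono[of \<beta> "x / y" 1 "w / z"] by simp
    qed
    have "\<beta> \<le> (cut g V S / vol g V S) * (vol g V V / vol g V (V - S))"
    proof (cases "2 * card S \<le> card V")
      case True
      then show ?thesis using half[of S] S s s' by (intro aux) auto
    next
      case False
      then have "2 * card (V - S) \<le> card V" using card_Diff_subset[of S V] S V finite_subset[of S V] by auto
      then have "\<beta> * vol g V (V - S) \<le> cut g V S" using half[of "V - S"] cut_compl[OF S(1), of g] by simp
      then have "\<beta> \<le> (cut g V S / vol g V (V - S)) * (vol g V V / vol g V S)"
        using s s' by (intro aux) auto
      then show ?thesis by (simp add: mult_ac)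
    qed
    then show ?thesis unfolding set_conductance_eq(2)[OF g V(1) S(1) pos] .
  qed
  then show ?thesis unfolding conductance_def using fin ne by (subst Min_ge_iff) auto
qed

lemma conn_cut_pos:
  assumes "conn g V" "finite V" "S \<subseteq> V" "S \<noteq> {}" "S \<noteq> V"
  shows "cut g V S > 0"
  using assms unfolding conn_def by (metis finite_Diff finite_subset touch_iff_cnt)

lemma card_le_vol:
  assumes "finite V" "conn g V" "card V \<ge> 2"
  shows "card V \<le> vol g V V"
proof -
  have "(\<Sum>v\<in>V. 1) \<le> (\<Sum>v\<in>V. cut g V {v})"
    using conn_singleton_cut[OF assms(1,2) _ assms(3)] by (intro sum_mono) (simp add: Suc_leI)
  then show ?thesis using assms by (simp add: vol_eq_sum)
qed

text \<open>No edge leaves a component, so expansion proved in the whole graph carries over to the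
  component without loss.\<close>

lemma cut_comp_eq:
  assumes "iscomp g V C" "finite V" "S \<subseteq> C"
  shows "cut g C S = cut g V S"
proof -
  have sub: "S \<subseteq> V" "C \<subseteq> V" using assms by (auto simp: iscomp_def)
  have fin: "finite C" "finite S" using sub assms finite_subset[of S V] finite_subset[of C V] by auto
  have "V - S = (C - S) \<union> (V - C)" using sub assms by auto
  then have "cut_pairs S (V - S) = cut_pairs S (C - S) \<union> cut_pairs S (V - C)" by (simp only: cut_pairs_Un)
  moreover have "cut_pairs S (C - S) \<inter> cut_pairs S (V - C) = {}" using assms by (intro cut_pairs_inter) auto
  moreover have "cnt (cut_pairs S (V - C)) g = 0"
  proof -
    have "\<not> touch g S (V - C)" using assms touch_mono[of g S "V - C" C "V - C"] by (auto simp: iscomp_def)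
    then show ?thesis using assms fin by (simp add: touch_iff_cnt)
  qed
  ultimately show ?thesis using assms fin by (simp add: cnt_Un)
qed

section \<open>First moments of connected sets\<close>

lemma Gnp_eq_rbits: "Gnp n p = rbits (inner_pairs {1..n}) p"
  by (simp add: Gnp_def rbits_def pairs_eq)

text \<open>The probability is taken in the model on the pairs inside S alone. Hence the same number
  occurs whether S is viewed inside V or inside any smaller W containing S, which makes averaging
  over W possible.\<close>

definition pconn :: "real \<Rightarrow> nat set \<Rightarrow> real" where
  "pconn p S = measure_pmf.prob (rbits (inner_pairs S) p) {g. conn g S}"

lemma pconn_nonneg [simp]: "pconn p S \<ge> 0"
  by (simp add: pconn_def)

lemma prob_conn_cut:
  assumes "finite V" "S \<subseteq> V"
  shows "measure_pmf.prob (rbits (inner_pairs V) p) {g. conn g S \<and> Q (cut g V S)} =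
    pconn p S * measure_pmf.prob (rbits (inner_pairs V) p) {g. Q (cut g V S)}"
proof -
  have "measure_pmf.prob (rbits (inner_pairs V) p) {g. conn g S} = pconn p S"
    unfolding pconn_def using assms by (intro rbits_restrict conn_depends inner_pairs_mono) auto
  moreover have "measure_pmf.prob (rbits (inner_pairs V) p) {g. conn g S \<and> Q (cut g V S)} =
    measure_pmf.prob (rbits (inner_pairs V) p) {g. conn g S} * measure_pmf.prob (rbits (inner_pairs V) p) {g. Q (cut g V S)}"
    using assms
    by (intro rbits_indep[OF _ _ _ _ conn_depends depends_only_on_cnt] inner_pairs_mono
        cut_pairs_subset_inner inner_cut_disjoint) auto
  ultimately show ?thesis by simp
qed

lemma iscomp_iff_cut: "finite V \<Longrightarrow> S \<subseteq> V \<Longrightarrow> iscomp g V S \<longleftrightarrow> conn g S \<and> cut g V S = 0"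
  unfolding iscomp_def by (subst touch_iff_cnt) (auto intro: finite_subset)

lemma card_cut_pairs_compl: "finite V \<Longrightarrow> S \<subseteq> V \<Longrightarrow> card (cut_pairs S (V - S)) = card S * (card V - card S)"
  using card_cut_pairs[of S "V - S"] finite_subset[of S V] by (simp add: card_Diff_subset)

lemma prob_iscomp:
  assumes "finite V" "S \<subseteq> V" "0 \<le> p" "p \<le> 1"
  shows "measure_pmf.prob (rbits (inner_pairs V) p) {g. iscomp g V S} =
    pconn p S * (1 - p) ^ (card S * (card V - card S))"
proof -
  have "measure_pmf.prob (rbits (inner_pairs V) p) {g. cut g V S = 0} = (1 - p) ^ card (cut_pairs S (V - S))"
    using assms by (intro rbits_no_bits cut_pairs_subset_inner) auto
  then show ?thesis
    using assms prob_conn_cut[OF assms(1,2), of p "\<lambda>k. k = 0"]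
    by (simp add: iscomp_iff_cut card_cut_pairs_compl)
qed

text \<open>The expectation of \<open>sum_card_iscomp_eq\<close>. Read as an inequality for the
  weights \<open>pconn p S\<close>, it bounds them from above.\<close>

lemma component_mass:
  assumes "finite W" "0 \<le> p" "p \<le> 1"
  shows "(\<Sum>S\<in>Pow W. real (card S) * (pconn p S * (1 - p) ^ (card S * (card W - card S)))) \<le> real (card W)"
proof -
  let ?M = "rbits (inner_pairs W) p"
  have "(\<Sum>S\<in>Pow W. real (card S) * (pconn p S * (1 - p) ^ (card S * (card W - card S)))) =
      (\<Sum>S\<in>Pow W. real (card S) * measure_pmf.prob ?M {g. iscomp g W S})"
    using assms by (intro sum.cong) (auto simp: prob_iscomp)
  also have "\<dots> = measure_pmf.expectation ?M (\<lambda>g. \<Sum>S\<in>Pow W. real (card S) * of_bool (iscomp g W S))"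
    using assms by (subst expectation_weighted_count) auto
  also have "\<dots> \<le> measure_pmf.expectation ?M (\<lambda>g. real (card W))"
  proof (intro integral_mono)
    fix g
    have "(\<Sum>S\<in>Pow W. real (card S) * of_bool (iscomp g W S)) = real (\<Sum>S | S \<subseteq> W \<and> iscomp g W S. card S)"
      using assms by (auto simp: Pow_def sum.If_cases of_bool_def if_distrib Int_def conj_commute intro!: sum.mono_neutral_cong_right)
    then show "(\<Sum>S\<in>Pow W. real (card S) * of_bool (iscomp g W S)) \<le> real (card W)"
      by (simp only: sum_card_iscomp_eq[OF assms(1)])
  qed (use assms in auto)
  finally show ?thesis by simp
qed

lemma card_supersets:
  assumes "finite V" "S \<subseteq> V" "card S \<le> N"
  shows "card {W. S \<subseteq> W \<and> W \<subseteq> V \<and> card W = N} = (card V - card S) choose (N - card S)"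
proof -
  have fin: "finite S" using assms finite_subset by auto
  have "bij_betw (\<lambda>U. S \<union> U) {U. U \<subseteq> V - S \<and> card U = N - card S} {W. S \<subseteq> W \<and> W \<subseteq> V \<and> card W = N}"
    unfolding bij_betw_def
  proof
    show "inj_on (\<lambda>U. S \<union> U) {U. U \<subseteq> V - S \<and> card U = N - card S}"
      by (rule inj_onI) blast
    show "(\<lambda>U. S \<union> U) ` {U. U \<subseteq> V - S \<and> card U = N - card S} = {W. S \<subseteq> W \<and> W \<subseteq> V \<and> card W = N}"
    proof (intro equalityI subsetI)
      fix W assume "W \<in> (\<lambda>U. S \<union> U) ` {U. U \<subseteq> V - S \<and> card U = N - card S}"
      then obtain U where U: "W = S \<union> U" "U \<subseteq> V - S" "card U = N - card S" by auto
      then have "finite U" using assms(1) finite_subset[of U "V - S"] by auto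
      then have "card W = card S + card U" using U fin by (subst U(1), subst card_Un_disjoint) auto
      then show "W \<in> {W. S \<subseteq> W \<and> W \<subseteq> V \<and> card W = N}" using U assms by auto
    next
      fix W assume "W \<in> {W. S \<subseteq> W \<and> W \<subseteq> V \<and> card W = N}"
      then show "W \<in> (\<lambda>U. S \<union> U) ` {U. U \<subseteq> V - S \<and> card U = N - card S}"
        using fin by (intro image_eqI[of _ _ "W - S"]) (auto simp: card_Diff_subset)
    qed
  qed
  then have "card {U. U \<subseteq> V - S \<and> card U = N - card S} = card {W. S \<subseteq> W \<and> W \<subseteq> V \<and> card W = N}"
    by (rule bij_betw_same_card)
  then show ?thesis using n_subsets[of "V - S" "N - card S"] assms fin by (simp add: card_Diff_subset)
qed

text \<open>Double counting: add up \<open>component_mass\<close> over all W of size N; a set S of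
  size k lies in \<open>(card V - k) choose (N - k)\<close> of them.\<close>

lemma component_mass_averaged:
  assumes V: "finite V" and N: "N \<le> card V" and p: "0 \<le> p" "p \<le> 1"
  shows "(\<Sum>S | S \<subseteq> V \<and> card S \<le> N. real (card S) * (pconn p S * (1 - p) ^ (card S * (N - card S)))
      * ((card V - card S) choose (N - card S))) \<le> N * (card V choose N)"
proof -
  define f where "f = (\<lambda>S. real (card S) * (pconn p S * (1 - p) ^ (card S * (N - card S))))"
  let ?W = "{W. W \<subseteq> V \<and> card W = N}" and ?S = "{S. S \<subseteq> V \<and> card S \<le> N}"
  have fin: "finite ?W" "finite ?S" using V by (auto intro: finite_subset[of _ "Pow V"])
  have "(\<Sum>S\<in>?S. f S * ((card V - card S) choose (N - card S))) = (\<Sum>S\<in>?S. \<Sum>W | W \<in> ?W \<and> S \<subseteq> W. f S)"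
  proof (rule sum.cong)
    fix S assume S: "S \<in> ?S"
    have "{W. W \<in> ?W \<and> S \<subseteq> W} = {W. S \<subseteq> W \<and> W \<subseteq> V \<and> card W = N}" by auto
    then show "f S * ((card V - card S) choose (N - card S)) = (\<Sum>W | W \<in> ?W \<and> S \<subseteq> W. f S)"
      using card_supersets[OF V, of S N] S by simp
  qed simp
  also have "\<dots> = (\<Sum>W\<in>?W. \<Sum>S | S \<in> ?S \<and> S \<subseteq> W. f S)"
    by (rule sum.swap_restrict[OF fin(2,1)])
  also have "\<dots> \<le> (\<Sum>W\<in>?W. real N)"
  proof (rule sum_mono)
    fix W assume W: "W \<in> ?W"
    then have fW: "finite W" using V finite_subset by auto
    have "{S. S \<in> ?S \<and> S \<subseteq> W} = Pow W"
      using W card_mono[OF fW] by auto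
    then show "(\<Sum>S | S \<in> ?S \<and> S \<subseteq> W. f S) \<le> real N"
      using component_mass[OF fW p] W by (simp add: f_def)
  qed
  also have "\<dots> = N * (card V choose N)" using n_subsets[OF V, of N] by simp
  finally show ?thesis by (simp add: f_def)
qed

section \<open>Elementary estimates for powers of 1 - p and for ratios of binomial
  coefficients\<close>

lemma exp_le_one_minus: "0 \<le> x \<Longrightarrow> x \<le> 1 / 2 \<Longrightarrow> exp (- 2 * x) \<le> 1 - (x :: real)"
proof -
  assume x: "0 \<le> x" "x \<le> 1 / 2"
  have "exp (2 * x) * (1 - x) \<ge> (1 + 2 * x) * (1 - x)"
    using x exp_ge_add_one_self[of "2 * x"] by (intro mult_right_mono) auto
  moreover have "(1 + 2 * x) * (1 - x) = 1 + x * (1 - 2 * x)" by (simp add: algebra_simps)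
  moreover have "x * (1 - 2 * x) \<ge> 0" using x by simp
  ultimately have "exp (2 * x) * (1 - x) \<ge> 1" by linarith
  then have "exp (- 2 * x) * 1 \<le> exp (- 2 * x) * (exp (2 * x) * (1 - x))" by (intro mult_left_mono) auto
  also have "\<dots> = 1 - x" by (simp add: mult.assoc[symmetric] exp_add[symmetric])
  finally show ?thesis by simp
qed

text \<open>The leading coefficient 1 is essential: about k / p factors 1 - p have to give exp(-k)
  up to lower order. The cruder \<open>exp_le_one_minus\<close> would give exp(-2 k) and ruin the
  exponential rate.\<close>

lemma exp_le_one_minus_square:
  fixes x :: real
  assumes "0 \<le> x" "x \<le> 1 / 2"
  shows "exp (- (x + x\<^sup>2)) \<le> 1 - x"
proof -
  define y where "y = x + x\<^sup>2"
  have y: "y \<ge> 0" using assms by (auto simp: y_def)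
  have "exp y \<ge> 1 + y + y\<^sup>2 / 2" using y by (rule exp_lower_Taylor_quadratic)
  then have "exp y * (1 - x) \<ge> (1 + y + y\<^sup>2 / 2) * (1 - x)" using assms by (intro mult_right_mono) auto
  moreover have "(1 + y + y\<^sup>2 / 2) * (1 - x) = 1 + x\<^sup>2 / 2 * (1 - x - x\<^sup>2 - x ^ 3)"
    by (simp add: y_def field_simps power2_eq_square power3_eq_cube)
  moreover have "x\<^sup>2 / 2 * (1 - x - x\<^sup>2 - x ^ 3) \<ge> 0"
  proof -
    have "x\<^sup>2 \<le> (1 / 2)\<^sup>2" "x ^ 3 \<le> (1 / 2) ^ 3" using assms by (intro power_mono; simp)+
    then have "1 - x - x\<^sup>2 - x ^ 3 \<ge> 0" using assms by (simp add: power2_eq_square power3_eq_cube)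
    then show ?thesis by (intro mult_nonneg_nonneg) auto
  qed
  ultimately have "exp y * (1 - x) \<ge> 1" by linarith
  then have "exp (- y) * 1 \<le> exp (- y) * (exp y * (1 - x))" by (intro mult_left_mono) auto
  also have "\<dots> = 1 - x" by (simp add: mult.assoc[symmetric] exp_add[symmetric])
  finally show ?thesis by (simp add: y_def)
qed

text \<open>The quotient of the binomials is the product over j < k of (N - j) / (n - j), and each
  factor is at least N / n times 1 - j / N, hence at least N / n times exp(-2 j / N). The last step
  needs j at most N / 2.\<close>

lemma binomial_ratio_ge:
  assumes "N \<le> n" "2 * k \<le> N" "N > 0"
  shows "real (n choose N) * (real N / real n) ^ k * exp (- 2 * (real k)\<^sup>2 / real N) \<le> real ((n - k) choose (N - k))"
  using assms(2)
proof (induction k)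
  case (Suc k)
  have k: "k < N" "k < n" "2 * k \<le> N" using Suc.prems assms by auto
  have "(n - k) * ((n - Suc k) choose (N - Suc k)) = ((n - k) choose (N - k)) * (N - k)"
    using binomial_absorption[of "N - Suc k" "n - k"] k
      Suc_diff_Suc[of k N] Suc_diff_Suc[of k n]
    by (metis diff_Suc_1 diff_diff_left mult.commute plus_1_eq_Suc add.commute)
  then have "real (n - k) * real ((n - Suc k) choose (N - Suc k)) = real ((n - k) choose (N - k)) * real (N - k)"
    by (metis of_nat_mult)
  then have eq: "real ((n - Suc k) choose (N - Suc k)) = real ((n - k) choose (N - k)) * (real (N - k) / real (n - k))"
    using k by (simp add: field_simps)
  have "real N / real n * exp (- 2 * (real k / real N)) \<le> real N / real n * (1 - real k / real N)"
    using k assms by (intro mult_left_mono exp_le_one_minus) (auto simp: field_simps)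
  also have "\<dots> = real (N - k) / real n" using k assms by (simp add: field_simps of_nat_diff)
  also have "\<dots> \<le> real (N - k) / real (n - k)" using k by (intro divide_left_mono) auto
  finally have step: "real N / real n * exp (- 2 * (real k / real N)) \<le> real (N - k) / real (n - k)" .
  have "real (n choose N) * (real N / real n) ^ Suc k * exp (- 2 * (real (Suc k))\<^sup>2 / real N) \<le>
      real (n choose N) * (real N / real n) ^ Suc k * (exp (- 2 * (real k)\<^sup>2 / real N) * exp (- 2 * (real k / real N)))"
  proof (rule mult_left_mono)
    have "- 2 * (real (Suc k))\<^sup>2 / real N \<le> - 2 * (real k)\<^sup>2 / real N + - 2 * (real k / real N)"
    proof -
      have "2 * (real k)\<^sup>2 + 2 * real k \<le> 2 * (real (Suc k))\<^sup>2" by (simp add: power2_eq_square algebra_simps)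
      then have "(2 * (real k)\<^sup>2 + 2 * real k) / real N \<le> 2 * (real (Suc k))\<^sup>2 / real N"
        by (intro divide_right_mono) auto
      then show ?thesis by (simp add: add_divide_distrib)
    qed
    then show "exp (- 2 * (real (Suc k))\<^sup>2 / real N) \<le> exp (- 2 * (real k)\<^sup>2 / real N) * exp (- 2 * (real k / real N))"
      unfolding exp_add[symmetric] by simp
  qed simp
  also have "\<dots> = (real (n choose N) * (real N / real n) ^ k * exp (- 2 * (real k)\<^sup>2 / real N)) *
      (real N / real n * exp (- 2 * (real k / real N)))" by simp
  also have "\<dots> \<le> real ((n - k) choose (N - k)) * (real (N - k) / real (n - k))"
    using Suc.IH k step by (intro mult_mono) auto
  finally show ?case using eq by simp
qed simp

text \<open>The components of a random graph on \<open>N = \<lfloor>1/p\<rfloor>\<close> vertices have total size at most \<open>N\<close>. Averaging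
  this trivial fact over all \<open>N\<close>-subsets of \<open>V\<close> bounds the expected number of connected \<open>k\<close>-sets with
  the same exponential rate that Cayley's formula for the number of spanning trees would give.\<close>

lemma connected_sets_mass:
  assumes V: "finite V" "card V = n" and p: "0 < p" "p \<le> 1 / 4" and d: "1 \<le> p * n" and K: "4 * p * real K \<le> 1"
  shows "(\<Sum>S | S \<subseteq> V \<and> card S \<le> K. real (card S) * pconn p S /
       ((p * n * exp 1) ^ card S * exp (6 * p * (real (card S))\<^sup>2))) \<le> 1 / p"
proof -
  \<comment> \<open>On N vertices the average degree is about 1: (1 - p)^(k N) is then close to
    exp(-k), while the binomial ratio supplies about (p n)^(-k). Together they form the weight (p n
    e)^k in the statement.\<close>
  define N where "N = nat \<lfloor>1 / p\<rfloor>"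
  have N1: "real N \<le> 1 / p" and N2: "1 / p < real N + 1"
    using p by (auto simp: N_def)
  have pN: "p * N \<le> 1" "1 - p < p * N" using N1 N2 p by (auto simp: field_simps)
  have Npos: "real N > 0" using pN p by (cases N) auto
  have "p * N \<le> p * n" using pN d by linarith
  then have Nn: "N \<le> n" using p by simp
  have invN: "1 / N \<le> 3 / 2 * p"
  proof -
    have "1 \<le> 3 / 2 * (p * N)" using pN p by linarith
    then show ?thesis using Npos by (simp add: field_simps)
  qed
  have npos: "real n > 0" using d p by (cases n) auto
  have pos: "real (n choose N) > 0" using Nn by simp
  let ?S = "{S. S \<subseteq> V \<and> card S \<le> K}"
  have "(n choose N) * (\<Sum>S\<in>?S. real (card S) * pconn p S / ((p * n * exp 1) ^ card S * exp (6 * p * (real (card S))\<^sup>2)))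
     \<le> (\<Sum>S | S \<subseteq> V \<and> card S \<le> N. real (card S) * (pconn p S * (1 - p) ^ (card S * (N - card S)))
      * ((card V - card S) choose (N - card S)))"
    unfolding sum_distrib_left
  proof (rule order_trans[OF sum_mono sum_mono2])
    show "finite {S. S \<subseteq> V \<and> card S \<le> N}" using V by (auto intro: finite_subset[of _ "Pow V"])
    have "4 * p * real K \<le> 2 * (p * real N)" using pN p K by linarith
    then have "p * (2 * real K) \<le> p * real N" by simp
    then have KN: "2 * K \<le> N" using p by simp
    then show "?S \<subseteq> {S. S \<subseteq> V \<and> card S \<le> N}" by auto
    fix S assume "S \<in> ?S"
    define k where "k = card S"
    have k: "k \<le> K" "2 * k \<le> N" using \<open>S \<in> ?S\<close> KN by (auto simp: k_def)
    have a: "exp (- (real k * (1 + p))) \<le> (1 - p) ^ (k * (N - k))"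
    proof -
      have "exp (- (real k * (1 + p))) \<le> exp (- (p + p\<^sup>2)) ^ (k * N)"
      proof -
        have "(p + p\<^sup>2) * (k * N) = real k * (p * N) * (1 + p)" by (simp add: power2_eq_square algebra_simps)
        also have "\<dots> \<le> real k * 1 * (1 + p)" using pN p by (intro mult_right_mono mult_left_mono) auto
        finally have "- (real k * (1 + p)) \<le> real (k * N) * (- (p + p\<^sup>2))" by (simp add: algebra_simps)
        then show ?thesis unfolding exp_of_nat_mult[symmetric] by simp
      qed
      also have "\<dots> \<le> (1 - p) ^ (k * N)" using p by (intro power_mono exp_le_one_minus_square) auto
      also have "\<dots> \<le> (1 - p) ^ (k * (N - k))" using p by (intro power_decreasing) auto
      finally show ?thesis .
    qed
    have b: "exp (- (2 * p * k)) / (p * n) ^ k \<le> (N / n) ^ k"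
    proof -
      have "exp (- 2 * p) / (p * n) \<le> (1 - p) / (p * n)"
        using p npos by (intro divide_right_mono exp_le_one_minus) auto
      also have "\<dots> \<le> (p * N) / (p * n)" using p npos pN by (intro divide_right_mono) auto
      finally have "exp (- 2 * p) / (p * n) \<le> N / n" using p by simp
      then have "(exp (- 2 * p) / (p * n)) ^ k \<le> (N / n) ^ k" using p by (intro power_mono) auto
      then show ?thesis by (simp add: power_divide exp_of_nat_mult[symmetric] mult_ac)
    qed
    have c: "exp (- (3 * p * (real k)\<^sup>2)) \<le> exp (- 2 * (real k)\<^sup>2 / N)"
    proof -
      have "2 * (real k)\<^sup>2 * (1 / N) \<le> 2 * (real k)\<^sup>2 * (3 / 2 * p)" by (intro mult_left_mono invN) auto
      then show ?thesis by simp
    qed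
    have "1 / ((p * n * exp 1) ^ k * exp (6 * p * (real k)\<^sup>2)) =
        exp (- real k - 6 * p * (real k)\<^sup>2) / (p * n) ^ k"
      by (simp add: power_mult_distrib exp_of_nat_mult[symmetric] exp_diff exp_minus field_simps)
    also have "\<dots> \<le> exp (- (real k * (1 + p)) - 2 * p * k - 3 * p * (real k)\<^sup>2) / (p * n) ^ k"
    proof -
      \<comment> \<open>The three corrections are p k from (a), 2 p k from (b) and 3 p k^2 from (c).
        With k at most k^2 they add up to the 6 p k^2 in the statement.\<close>
      have "real k \<le> (real k)\<^sup>2" by (cases k) (auto simp: power2_eq_square)
      then have "p * real k \<le> p * (real k)\<^sup>2" using p by simp
      then show ?thesis using p by (intro divide_right_mono) (auto simp: algebra_simps)
    qed
    also have "\<dots> = exp (- (real k * (1 + p))) * (exp (- (2 * p * k)) / (p * n) ^ k * exp (- (3 * p * (real k)\<^sup>2)))"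
      by (simp add: exp_add[symmetric] algebra_simps)
    also have "\<dots> \<le> (1 - p) ^ (k * (N - k)) * ((N / n) ^ k * exp (- 2 * (real k)\<^sup>2 / N))"
      using a b c p by (intro mult_mono) auto
    finally have w: "1 / ((p * n * exp 1) ^ k * exp (6 * p * (real k)\<^sup>2)) \<le>
      (1 - p) ^ (k * (N - k)) * ((N / n) ^ k * exp (- 2 * (real k)\<^sup>2 / N))" .
    have "(n choose N) * (real k * pconn p S / ((p * n * exp 1) ^ k * exp (6 * p * (real k)\<^sup>2))) =
      (real k * pconn p S) * ((n choose N) * (1 / ((p * n * exp 1) ^ k * exp (6 * p * (real k)\<^sup>2))))" by simp
    also have "\<dots> \<le> (real k * pconn p S) * ((n choose N) * ((1 - p) ^ (k * (N - k)) * ((N / n) ^ k * exp (- 2 * (real k)\<^sup>2 / N))))"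
      by (intro mult_left_mono w) auto
    also have "\<dots> = (real k * pconn p S * (1 - p) ^ (k * (N - k))) * (real (n choose N) * (N / n) ^ k * exp (- 2 * (real k)\<^sup>2 / N))" by simp
    also have "\<dots> \<le> (real k * pconn p S * (1 - p) ^ (k * (N - k))) * real ((n - k) choose (N - k))"
      using p Npos by (intro mult_left_mono binomial_ratio_ge Nn k) auto
    finally show "(n choose N) * (real (card S) * pconn p S / ((p * n * exp 1) ^ card S * exp (6 * p * (real (card S))\<^sup>2))) \<le>
      real (card S) * (pconn p S * (1 - p) ^ (card S * (N - card S))) * ((card V - card S) choose (N - card S))"
      unfolding k_def V(2) by (simp add: mult_ac)
  qed (use p in auto)
  also have "\<dots> \<le> N * (n choose N)" using component_mass_averaged[OF V(1), of N p] Nn p V by simp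
  finally have "(\<Sum>S\<in>?S. real (card S) * pconn p S / ((p * n * exp 1) ^ card S * exp (6 * p * (real (card S))\<^sup>2))) \<le> N"
    using pos by (simp add: mult.commute)
  then show ?thesis using N1 by linarith
qed

section \<open>Events holding with high probability, uniformly in the edge probability\<close>

definition whp :: "(nat \<Rightarrow> real \<Rightarrow> bool) \<Rightarrow> (nat \<Rightarrow> real \<Rightarrow> (nat \<times> nat \<Rightarrow> bool) \<Rightarrow> bool) \<Rightarrow> bool" where
  "whp R E \<longleftrightarrow> (\<exists>f. f \<longlonglongrightarrow> 0 \<and> (\<forall>\<^sub>F n in sequentially. \<forall>p. 0 \<le> p \<and> p \<le> 1 \<and> R n p \<longrightarrow>
     measure_pmf.prob (Gnp n p) {g. \<not> E n p g} \<le> f n))"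

lemma whpI:
  assumes "f \<longlonglongrightarrow> 0"
    and "\<forall>\<^sub>F n in sequentially. \<forall>p :: real. 0 \<le> p \<longrightarrow> p \<le> 1 \<longrightarrow> R n p \<longrightarrow> measure_pmf.prob (Gnp n p) {g. \<not> E n p g} \<le> f n"
  shows "whp R E"
  unfolding whp_def using assms by (auto intro!: exI[of _ f] elim!: eventually_mono)

lemma whp_mono:
  assumes "whp R E" "\<And>n p. R' n p \<Longrightarrow> R n p"
    and "\<forall>\<^sub>F n in sequentially. \<forall>p g. 0 \<le> p \<longrightarrow> p \<le> 1 \<longrightarrow> R' n p \<longrightarrow> graph_on n g \<longrightarrow> E n p g \<longrightarrow> E' n p g"
  shows "whp R' E'"
proof -
  obtain f where f: "f \<longlonglongrightarrow> 0" and ev: "\<forall>\<^sub>F n in sequentially. \<forall>p. 0 \<le> p \<and> p \<le> 1 \<and> R n p \<longrightarrow>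
     measure_pmf.prob (Gnp n p) {g. \<not> E n p g} \<le> f n" using assms(1) unfolding whp_def by blast
  show ?thesis
  proof (rule whpI[OF f], use ev assms(3) in eventually_elim, intro allI impI)
    fix n p assume ev: "\<forall>p. 0 \<le> p \<and> p \<le> 1 \<and> R n p \<longrightarrow> measure_pmf.prob (Gnp n p) {g. \<not> E n p g} \<le> f n"
      and imp: "\<forall>p g. 0 \<le> p \<longrightarrow> p \<le> 1 \<longrightarrow> R' n p \<longrightarrow> graph_on n g \<longrightarrow> E n p g \<longrightarrow> E' n p g"
      and p: "0 \<le> p" "p \<le> 1" "R' n p"
    have "measure_pmf.prob (Gnp n p) {g. \<not> E' n p g} \<le> measure_pmf.prob (Gnp n p) {g. \<not> E n p g}"
      using imp p graph_on_support by (intro prob_mono_support) blast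
    also have "\<dots> \<le> f n" using ev p assms(2) by blast
    finally show "measure_pmf.prob (Gnp n p) {g. \<not> E' n p g} \<le> f n" .
  qed
qed

lemma whp_conj:
  assumes "whp R E1" "whp R E2"
  shows "whp R (\<lambda>n p g. E1 n p g \<and> E2 n p g)"
proof -
  obtain f1 f2 where f: "f1 \<longlonglongrightarrow> 0" "f2 \<longlonglongrightarrow> 0"
    and ev1: "\<forall>\<^sub>F n in sequentially. \<forall>p. 0 \<le> p \<and> p \<le> 1 \<and> R n p \<longrightarrow> measure_pmf.prob (Gnp n p) {g. \<not> E1 n p g} \<le> f1 n"
    and ev2: "\<forall>\<^sub>F n in sequentially. \<forall>p. 0 \<le> p \<and> p \<le> 1 \<and> R n p \<longrightarrow> measure_pmf.prob (Gnp n p) {g. \<not> E2 n p g} \<le> f2 n"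
    using assms unfolding whp_def by blast
  have "(\<lambda>n. f1 n + f2 n) \<longlonglongrightarrow> 0" using tendsto_add[OF f] by simp
  then show ?thesis
  proof (rule whpI, use ev1 ev2 in eventually_elim, intro allI impI)
    fix n p assume "\<forall>p. 0 \<le> p \<and> p \<le> 1 \<and> R n p \<longrightarrow> measure_pmf.prob (Gnp n p) {g. \<not> E1 n p g} \<le> f1 n"
      "\<forall>p. 0 \<le> p \<and> p \<le> 1 \<and> R n p \<longrightarrow> measure_pmf.prob (Gnp n p) {g. \<not> E2 n p g} \<le> f2 n" "0 \<le> p" "p \<le> 1" "R n p"
    then have "measure_pmf.prob (Gnp n p) {g. \<not> E1 n p g} \<le> f1 n" "measure_pmf.prob (Gnp n p) {g. \<not> E2 n p g} \<le> f2 n"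
      by auto
    moreover have "measure_pmf.prob (Gnp n p) {g. \<not> (E1 n p g \<and> E2 n p g)} \<le>
        measure_pmf.prob (Gnp n p) {g. \<not> E1 n p g} + measure_pmf.prob (Gnp n p) {g. \<not> E2 n p g}"
      using prob_disj_le[of "Gnp n p" "\<lambda>g. \<not> E1 n p g" "\<lambda>g. \<not> E2 n p g"] by (simp only: de_Morgan_conj)
    ultimately show "measure_pmf.prob (Gnp n p) {g. \<not> (E1 n p g \<and> E2 n p g)} \<le> f1 n + f2 n" by linarith
  qed
qed

lemma whp_cases:
  assumes "whp (\<lambda>n p. R n p \<and> Q n p) E" "whp (\<lambda>n p. R n p \<and> \<not> Q n p) E"
  shows "whp R E"
proof -
  obtain f1 f2 where f: "f1 \<longlonglongrightarrow> 0" "f2 \<longlonglongrightarrow> 0"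
    and ev1: "\<forall>\<^sub>F n in sequentially. \<forall>p. 0 \<le> p \<and> p \<le> 1 \<and> R n p \<and> Q n p \<longrightarrow> measure_pmf.prob (Gnp n p) {g. \<not> E n p g} \<le> f1 n"
    and ev2: "\<forall>\<^sub>F n in sequentially. \<forall>p. 0 \<le> p \<and> p \<le> 1 \<and> R n p \<and> \<not> Q n p \<longrightarrow> measure_pmf.prob (Gnp n p) {g. \<not> E n p g} \<le> f2 n"
    using assms unfolding whp_def by blast
  have "(\<lambda>n. max (f1 n) (f2 n)) \<longlonglongrightarrow> 0" using tendsto_max[OF f] by simp
  then show ?thesis
    by (rule whpI, use ev1 ev2 in eventually_elim) (auto simp: le_max_iff_disj)
qed

lemma union_over_subsets:
  assumes V: "finite V" and \<beta>: "\<beta> \<ge> 0"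
    and k: "\<And>k. k \<le> card V \<Longrightarrow> R k \<Longrightarrow> (\<Sum>S | S \<subseteq> V \<and> card S = k. measure_pmf.prob M {g. B S g}) \<le> \<beta>"
  shows "measure_pmf.prob M {g. \<exists>S\<subseteq>V. R (card S) \<and> B S g} \<le> (real (card V) + 1) * \<beta>"
proof -
  let ?k = "{k. k \<le> card V \<and> R k}"
  have "{g. \<exists>S\<subseteq>V. R (card S) \<and> B S g} \<subseteq> {g. \<exists>k\<in>?k. \<exists>S\<in>{S. S \<subseteq> V \<and> card S = k}. B S g}"
    using card_mono[OF V] by auto
  then have "measure_pmf.prob M {g. \<exists>S\<subseteq>V. R (card S) \<and> B S g} \<le>
      measure_pmf.prob M {g. \<exists>k\<in>?k. \<exists>S\<in>{S. S \<subseteq> V \<and> card S = k}. B S g}"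
    by (intro measure_pmf.finite_measure_mono) auto
  also have "\<dots> \<le> (\<Sum>k\<in>?k. measure_pmf.prob M {g. \<exists>S\<in>{S. S \<subseteq> V \<and> card S = k}. B S g})"
    by (intro prob_UN_le) auto
  also have "\<dots> \<le> (\<Sum>k\<in>?k. \<beta>)"
  proof (rule sum_mono)
    fix k' assume k': "k' \<in> ?k"
    have "measure_pmf.prob M {g. \<exists>S\<in>{S. S \<subseteq> V \<and> card S = k'}. B S g} \<le>
        (\<Sum>S | S \<subseteq> V \<and> card S = k'. measure_pmf.prob M {g. B S g})"
      using V by (intro prob_UN_le) (auto intro: finite_subset[of _ "Pow V"])
    also have "\<dots> \<le> \<beta>" using k k' by auto
    finally show "measure_pmf.prob M {g. \<exists>S\<in>{S. S \<subseteq> V \<and> card S = k'}. B S g} \<le> \<beta>" .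
  qed
  also have "\<dots> = real (card ?k) * \<beta>" by simp
  also have "\<dots> \<le> (real (card V) + 1) * \<beta>"
  proof -
    have "card ?k \<le> card {..card V}" by (intro card_mono) auto
    then have "real (card ?k) \<le> real (card V) + 1" by simp
    then show ?thesis using \<beta> by (intro mult_right_mono)
  qed
  finally show ?thesis .
qed

section \<open>Expansion and sparsity estimates\<close>

text \<open>The lower bound on p n |S| makes the decay beat the polynomial factors of the union
  bound. The condition 4 p |S| \<le> 1 is the range of \<open>connected_sets_mass\<close>; beyond it
  \<open>dense_expansion\<close> takes over when p n is large.\<close>

abbreviation connected_expansion :: "real \<Rightarrow> real \<Rightarrow> real \<Rightarrow> nat \<Rightarrow> real \<Rightarrow> (nat \<times> nat \<Rightarrow> bool) \<Rightarrow> bool" where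
  "connected_expansion a C \<delta> n p g \<equiv> \<forall>S\<subseteq>{1..n}. C * ln (real n) \<le> p * real n * real (card S) \<and> real (card S) \<le> \<delta> * real n \<and>
     4 * p * real (card S) \<le> 1 \<longrightarrow> conn g S \<longrightarrow> a * (p * real n * real (card S)) < real (cut g {1..n} S)"

abbreviation dense_expansion :: "nat \<Rightarrow> real \<Rightarrow> (nat \<times> nat \<Rightarrow> bool) \<Rightarrow> bool" where
  "dense_expansion n p g \<equiv> \<forall>S\<subseteq>{1..n}. 1 \<le> 4 * p * real (card S) \<and> 2 * card S \<le> n \<longrightarrow>
     p * real n * real (card S) / 8 < real (cut g {1..n} S)"

lemma sum_pconn_le:
  assumes V: "finite V" "card V = n" and p: "0 < p" "p \<le> 1 / 4" "1 \<le> p * n" "4 * p * real k \<le> 1" "k \<ge> 1"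
  shows "(\<Sum>S | S \<subseteq> V \<and> card S = k. pconn p S) \<le> n * ((p * n * exp 1) ^ k * exp (6 * p * (real k)\<^sup>2))"
proof -
  define w where "w = (p * n * exp 1) ^ k * exp (6 * p * (real k)\<^sup>2)"
  have npos: "real n > 0" using p by (cases n) auto
  have w: "w > 0" unfolding w_def using p npos by (intro mult_pos_pos) auto
  have "(\<Sum>S | S \<subseteq> V \<and> card S = k. pconn p S) / w = (\<Sum>S | S \<subseteq> V \<and> card S = k. 1 * pconn p S / w)"
    by (simp add: sum_divide_distrib)
  also have "\<dots> \<le> (\<Sum>S | S \<subseteq> V \<and> card S = k. real (card S) * pconn p S /
       ((p * n * exp 1) ^ card S * exp (6 * p * (real (card S))\<^sup>2)))"
  proof (rule sum_mono)
    fix S assume S: "S \<in> {S. S \<subseteq> V \<and> card S = k}"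
    have "1 * pconn p S / w \<le> real k * pconn p S / w"
      using w p by (intro divide_right_mono mult_right_mono) auto
    then show "1 * pconn p S / w \<le> real (card S) * pconn p S /
       ((p * n * exp 1) ^ card S * exp (6 * p * (real (card S))\<^sup>2))" using S by (simp add: w_def)
  qed
  also have "\<dots> \<le> (\<Sum>S | S \<subseteq> V \<and> card S \<le> k. real (card S) * pconn p S /
       ((p * n * exp 1) ^ card S * exp (6 * p * (real (card S))\<^sup>2)))"
    using V p by (intro sum_mono2) (auto intro: finite_subset[of _ "Pow V"])
  also have "\<dots> \<le> 1 / p" using p by (intro connected_sets_mass V) auto
  also have "\<dots> \<le> n" using p by (simp add: field_simps)
  finally show ?thesis using w by (simp add: divide_le_eq w_def)
qed

text \<open>The expected number of components of size k decays like (x exp(1 - x))^k with x = p n.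
  The function (1 + ln x) / x decreases for x \<ge> 1, so its value at 1 + \<epsilon> can be taken
  as 1 - c; this turns the rate into exp(-c x k), uniformly in x.\<close>

lemma ex_decay_rate:
  fixes \<epsilon> :: real
  assumes "\<epsilon> > 0"
  obtains c where "0 < c" "c < 1" "\<And>x. x \<ge> 1 + \<epsilon> \<Longrightarrow> ln x + 1 - x \<le> - c * x"
proof -
  define y where "y = 1 + \<epsilon>"
  have y: "y > 1" using assms by (simp add: y_def)
  define c where "c = 1 - (1 + ln y) / y"
  have "ln y \<noteq> y - 1" using ln_eq_minus_one[of y] y by auto
  then have "ln y < y - 1" using ln_le_minus_one[of y] y by linarith
  then have "c > 0" using y by (simp add: c_def field_simps)
  moreover have "c < 1" using y by (simp add: c_def add_pos_pos)
  moreover have "ln x + 1 - x \<le> - c * x" if "x \<ge> 1 + \<epsilon>" for x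
  proof -
    have x: "x \<ge> y" using that by (simp add: y_def)
    have "ln (x / y) \<le> x / y - 1" using x y by (intro ln_le_minus_one) auto
    then have "ln x \<le> ln y + x / y - 1" using x y by (simp add: ln_div)
    moreover have "ln y * 1 \<le> ln y * (x / y)" using x y by (intro mult_left_mono) auto
    moreover have "c * x = x - x / y - ln y * (x / y)" using y by (simp add: c_def field_simps)
    ultimately show ?thesis by (simp add: algebra_simps)
  qed
  ultimately show ?thesis using that by blast
qed

text \<open>Connectedness and boundary are independent, so the level sum of \<open>pconn\<close> is
  multiplied by one lower tail. Of the gain c p n k in the exponent one half is spent: c / 8 on the
  factor exp(-t), c / 8 on the allowed boundary t a, and c / 4 on the terms 7 p k^2. The last item
  explains 28 = 4 * 7.\<close>

lemma sparse_connected_sets: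
  fixes k :: nat and p a c :: real
  assumes V: "finite V" "card V = n" and p: "0 < p" "p \<le> 1 / 4" "1 \<le> p * n" "4 * p * real k \<le> 1" "k \<ge> 1"
    and c: "0 < c" "c < 1" "ln (p * n) + 1 - p * n \<le> - c * (p * n)" "28 * real k \<le> c * n"
    and a: "a = c / (8 * ln (8 / c))"
  shows "(\<Sum>S | S \<subseteq> V \<and> card S = k. measure_pmf.prob (rbits (inner_pairs V) p)
      {g. conn g S \<and> real (cut g V S) \<le> a * (p * n * k)}) \<le> n * exp (- (c / 2) * (p * n * k))"
proof -
  let ?M = "rbits (inner_pairs V) p"
  define d where "d = p * n"
  \<comment> \<open>The tilt is chosen to give exp(-t) = c / 8, and a is defined so that t a = c / 8
    too.\<close>
  define t where "t = ln (8 / c)"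
  have t: "t > 0" using c by (simp add: t_def)
  have et: "exp (- t) = c / 8" using c by (simp add: t_def exp_minus)
  have ta: "t * a = c / 8" using t by (simp add: a t_def)
  have npos: "real n > 0" using p by (cases n) auto
  have kn: "real k \<le> n"
  proof -
    have "c * real n \<le> 1 * real n" using c by (intro mult_right_mono) auto
    then show ?thesis using c by linarith
  qed
  have lower: "measure_pmf.prob ?M {g. real (cut g V S) \<le> a * (d * k)} \<le> exp (t * (a * (d * k)) - p * (1 - exp (- t)) * (real k * (real n - real k)))"
    if "S \<subseteq> V" "card S = k" for S
  proof -
    have "measure_pmf.prob ?M {g. real (cut g V S) \<le> a * (d * k)} \<le>
      exp (t * (a * (d * k)) - p * (1 - exp (- t)) * real (card (cut_pairs S (V - S))))"
      using that V p t by (intro rbits_lower_tail cut_pairs_subset_inner) auto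
    then show ?thesis using that V kn by (simp add: card_cut_pairs_compl of_nat_diff)
  qed
  have "(\<Sum>S | S \<subseteq> V \<and> card S = k. measure_pmf.prob ?M {g. conn g S \<and> real (cut g V S) \<le> a * (d * k)}) =
      (\<Sum>S | S \<subseteq> V \<and> card S = k. pconn p S * measure_pmf.prob ?M {g. real (cut g V S) \<le> a * (d * k)})"
    using V by (intro sum.cong) (auto simp: prob_conn_cut[of V _ p "\<lambda>x. real x \<le> a * (d * k)"])
  also have "\<dots> \<le> (\<Sum>S | S \<subseteq> V \<and> card S = k. pconn p S * exp (t * (a * (d * k)) - p * (1 - exp (- t)) * (real k * (real n - real k))))"
    using lower by (intro sum_mono mult_left_mono) auto
  also have "\<dots> = (\<Sum>S | S \<subseteq> V \<and> card S = k. pconn p S) * exp (t * (a * (d * k)) - p * (1 - exp (- t)) * (real k * (real n - real k)))"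
    by (simp add: sum_distrib_right)
  also have "\<dots> \<le> (n * ((d * exp 1) ^ k * exp (6 * p * (real k)\<^sup>2))) * exp (t * (a * (d * k)) - p * (1 - exp (- t)) * (real k * (real n - real k)))"
    unfolding d_def using V p by (intro mult_right_mono sum_pconn_le) auto
  also have "(d * exp 1) ^ k = exp (k * (ln d + 1))"
    using p npos by (simp add: d_def power_mult_distrib exp_of_nat_mult exp_add)
  also have "(n * (exp (k * (ln d + 1)) * exp (6 * p * (real k)\<^sup>2))) * exp (t * (a * (d * k)) - p * (1 - exp (- t)) * (real k * (real n - real k))) =
      n * exp (k * (ln d + 1) + 6 * p * (real k)\<^sup>2 + (t * (a * (d * k)) - p * (1 - exp (- t)) * (real k * (real n - real k))))"
    by (simp add: exp_add mult_ac)
  also have "\<dots> \<le> n * exp (- (c / 2) * (d * k))"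
  proof -
    define A where "A = d * k"
    define B where "B = p * (real k)\<^sup>2"
    have "k * (ln d + 1 - d) \<le> k * (- c * d)" using c by (intro mult_left_mono) (auto simp: d_def)
    then have 1: "k * (ln d + 1) \<le> A - c * A" by (simp add: A_def algebra_simps)
    have "p * k * (28 * real k) \<le> p * k * (c * n)" using p c by (intro mult_left_mono) auto
    then have 2: "28 * B \<le> c * A" by (simp add: A_def B_def d_def power2_eq_square algebra_simps)
    have 3: "t * (a * (d * k)) = c / 8 * A" using ta by (metis mult.assoc A_def)
    have 4: "p * (1 - exp (- t)) * (real k * (real n - real k)) = A - B - c / 8 * A + c / 8 * B"
      unfolding et d_def A_def B_def by (simp add: algebra_simps power2_eq_square)
    have 5: "c / 8 * B \<ge> 0" using c p by (simp add: B_def)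
    have 6: "6 * p * (real k)\<^sup>2 = 6 * B" by (simp add: B_def)
    have "k * (ln d + 1) + 6 * p * (real k)\<^sup>2 + (t * (a * (d * k)) - p * (1 - exp (- t)) * (real k * (real n - real k))) \<le> - (c / 2) * A"
      unfolding 3 4 6 using 1 2 5 by (simp add: field_simps)
    then have "k * (ln d + 1) + 6 * p * (real k)\<^sup>2 + (t * (a * (d * k)) - p * (1 - exp (- t)) * (real k * (real n - real k))) \<le> - (c / 2) * (d * k)"
      unfolding A_def .
    then show ?thesis by (intro mult_left_mono) auto
  qed
  finally show ?thesis by (simp add: d_def)
qed

lemma whp_connected_expansion:
  fixes \<epsilon> :: real
  assumes "\<epsilon> > 0"
  obtains a \<delta> C :: real where "0 < a" "0 < \<delta>" "0 < C"
    "whp (\<lambda>n p. 1 + \<epsilon> \<le> p * n) (\<lambda>n p g. connected_expansion a C \<delta> n p g)"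
proof -
  obtain c where c: "0 < c" "c < 1" "\<And>x. x \<ge> 1 + \<epsilon> \<Longrightarrow> ln x + 1 - x \<le> - c * x"
    using ex_decay_rate[OF assms] by blast
  define a where "a = c / (8 * ln (8 / c))"
  have "a > 0" using c by (simp add: a_def)
  \<comment> \<open>With this C the bound exp(-(c / 2) p n k) is at most n^(-4), which beats the
    factor n of the first moment and the n + 1 possible sizes.\<close>
  define C where "C = 8 / c"
  define \<delta> where "\<delta> = c / 28"
  have "whp (\<lambda>n p. 1 + \<epsilon> \<le> p * n) (\<lambda>n p g. connected_expansion a C \<delta> n p g)"
  proof (rule whpI)
    show "(\<lambda>n. (real n + 1) * (n * exp (- 4 * ln (real n)))) \<longlonglongrightarrow> 0" by real_asymp
    show "\<forall>\<^sub>F n in sequentially. \<forall>p :: real. 0 \<le> p \<longrightarrow> p \<le> 1 \<longrightarrow> 1 + \<epsilon> \<le> p * n \<longrightarrow>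
      measure_pmf.prob (Gnp n p) {g. \<not> (connected_expansion a C \<delta> n p g)} \<le> (real n + 1) * (n * exp (- 4 * ln (real n)))"
    proof (intro always_eventually allI impI)
      fix n and p :: real assume p: "0 \<le> p" "p \<le> 1" "1 + \<epsilon> \<le> p * real n"
      have p0: "p > 0" "1 \<le> p * n" using p assms by (auto simp: order.order_iff_strict)
      let ?R = "\<lambda>k. C * ln n \<le> p * n * k \<and> k \<le> \<delta> * n \<and> 4 * p * k \<le> 1"
      have "measure_pmf.prob (Gnp n p) {g. \<not> (\<forall>S\<subseteq>{1..n}. ?R (card S) \<longrightarrow> conn g S \<longrightarrow> a * (p * n * card S) < cut g {1..n} S)} =
        measure_pmf.prob (Gnp n p) {g. \<exists>S\<subseteq>{1..n}. ?R (card S) \<and> (conn g S \<and> real (cut g {1..n} S) \<le> a * (p * n * card S))}"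
        by (intro prob_cong_support) (auto simp: not_less)
      also have "\<dots> \<le> (real (card {1..n}) + 1) * (n * exp (- 4 * ln (real n)))"
      proof (rule union_over_subsets)
        fix k assume k: "k \<le> card {1..n}" "?R k"
        have "(\<Sum>S | S \<subseteq> {1..n} \<and> card S = k. measure_pmf.prob (Gnp n p) {g. conn g S \<and> real (cut g {1..n} S) \<le> a * (p * n * card S)})
          = (\<Sum>S | S \<subseteq> {1..n} \<and> card S = k. measure_pmf.prob (rbits (inner_pairs {1..n}) p) {g. conn g S \<and> real (cut g {1..n} S) \<le> a * (p * n * k)})"
          by (intro sum.cong) (auto simp: Gnp_eq_rbits)
        also have "\<dots> \<le> n * exp (- 4 * ln (real n))"
        proof (cases "k = 0")
          case True
          have "{S. S \<subseteq> {1..n} \<and> card S = 0} = {{}}" using finite_subset by fastforce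
          then show ?thesis using True by (simp add: conn_def)
        next
          case False
          then have "p * 4 * 1 \<le> p * 4 * k" using p0 by (intro mult_left_mono) auto
          then have "p \<le> 1 / 4" using k by simp
          then have "(\<Sum>S | S \<subseteq> {1..n} \<and> card S = k. measure_pmf.prob (rbits (inner_pairs {1..n}) p) {g. conn g S \<and> real (cut g {1..n} S) \<le> a * (p * n * k)})
            \<le> n * exp (- (c / 2) * (p * n * k))"
            using p p0 k c False by (intro sparse_connected_sets) (auto simp: a_def \<delta>_def)
          also have "\<dots> \<le> n * exp (- 4 * ln (real n))"
          proof -
            have "c / 2 * (C * ln n) \<le> c / 2 * (p * n * k)" using k c by (intro mult_left_mono) auto
            then show ?thesis using c by (intro mult_left_mono) (auto simp: C_def)
          qed
          finally show ?thesis .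
        qed
        finally show "(\<Sum>S | S \<subseteq> {1..n} \<and> card S = k. measure_pmf.prob (Gnp n p) {g. conn g S \<and> real (cut g {1..n} S) \<le> a * (p * n * card S)}) \<le> n * exp (- 4 * ln (real n))" .
      qed auto
      finally show "measure_pmf.prob (Gnp n p) {g. \<not> (\<forall>S\<subseteq>{1..n}. ?R (card S) \<longrightarrow> conn g S \<longrightarrow> a * (p * n * card S) < cut g {1..n} S)} \<le>
         (real n + 1) * (n * exp (- 4 * ln (real n)))" by simp
    qed
  qed
  then show ?thesis using that[of a \<delta> C] \<open>a > 0\<close> c by (simp add: C_def \<delta>_def)
qed

section \<open>Expansion of all large sets when the average degree is large\<close>

lemma power_le_exp_fact: "real k ^ k \<le> exp (real k) * fact k"
proof -
  have "(\<Sum>i\<in>{k}. real k ^ i /\<^sub>R fact i) \<le> (\<Sum>i. real k ^ i /\<^sub>R fact i)"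
    by (intro sum_le_suminf summable_exp_generic) auto
  then have "real k ^ k / fact k \<le> exp (real k)" by (simp add: exp_def divide_inverse mult.commute)
  then show ?thesis by (simp add: divide_le_eq)
qed

lemma binomial_le_exp:
  assumes "k \<ge> 1" "real n \<le> x * k"
  shows "real (n choose k) \<le> (exp 1 * x) ^ k"
proof -
  have "real k ^ k * real (n choose k) \<le> (exp (real k) * fact k) * real (n choose k)"
    by (intro mult_right_mono power_le_exp_fact) auto
  also have "\<dots> = exp (real k) * real ((n choose k) * fact k)" by (simp add: mult_ac)
  also have "\<dots> \<le> exp (real k) * real (n ^ k)" 
    using binomial_fact_pow[of n k] by (intro mult_left_mono) (auto simp only: of_nat_le_iff exp_ge_zero)
  also have "\<dots> \<le> exp (real k) * (x * k) ^ k"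
    using assms by (auto intro!: mult_left_mono power_mono)
  also have "\<dots> = real k ^ k * (exp 1 * x) ^ k" by (simp add: power_mult_distrib exp_of_nat_mult[symmetric] mult_ac)
  finally show ?thesis using assms by simp
qed

text \<open>Since k is at least n / (4 p n) n, that is n \<le> 4 p n k, there are at most (4 e p
  n)^k sets of size k, while one cut is too small with probability at most exp(-p n k / 8). For
  large p n the entropy takes only half of this. The bound is stated for every D \<ge> D0 because
  later thresholds must also exceed 1 / (4 \<delta>).\<close>

lemma whp_dense_expansion:
  obtains D0 where "D0 > 0" "\<And>D. D \<ge> D0 \<Longrightarrow>
    whp (\<lambda>n p. D \<le> p * n) (\<lambda>n p g. dense_expansion n p g)"
proof -
  \<comment> \<open>The allowance x / 16 is half of the exponent 1 / 8 of the cut estimate.\<close>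
  have "\<forall>\<^sub>F x :: real in at_top. ln (exp 1 * (4 * x)) \<le> x / 16" by real_asymp
  then obtain D1 :: real where D1: "\<And>x. x \<ge> D1 \<Longrightarrow> ln (exp 1 * (4 * x)) \<le> x / 16"
    unfolding eventually_at_top_linorder by blast
  define D0 where "D0 = max D1 1"
  have "whp (\<lambda>n p. D \<le> p * n) (\<lambda>n p g. dense_expansion n p g)" if D: "D \<ge> D0" for D
  proof (rule whpI)
    show "(\<lambda>n. (real n + 1) * exp (- real n / 64)) \<longlonglongrightarrow> 0" by real_asymp
    show "\<forall>\<^sub>F n in sequentially. \<forall>p :: real. 0 \<le> p \<longrightarrow> p \<le> 1 \<longrightarrow> D \<le> p * n \<longrightarrow>
      measure_pmf.prob (Gnp n p) {g. \<not> (dense_expansion n p g)} \<le> (real n + 1) * exp (- real n / 64)"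
    proof (intro always_eventually allI impI)
      fix n and p :: real assume p: "0 \<le> p" "p \<le> 1" "D \<le> p * real n"
      have d: "p * n \<ge> 1" "p * n \<ge> D1" using D p by (auto simp: D0_def)
      have npos: "real n > 0" using d by (cases n) auto
      let ?R = "\<lambda>k. 1 \<le> 4 * p * real k \<and> 2 * k \<le> n"
      have "measure_pmf.prob (Gnp n p) {g. \<not> (\<forall>S\<subseteq>{1..n}. ?R (card S) \<longrightarrow> p * n * card S / 8 < cut g {1..n} S)} =
        measure_pmf.prob (Gnp n p) {g. \<exists>S\<subseteq>{1..n}. ?R (card S) \<and> real (cut g {1..n} S) \<le> p * n * card S / 8}"
        by (intro prob_cong_support) (auto simp: not_less)
      also have "\<dots> \<le> (real (card {1..n}) + 1) * exp (- real n / 64)"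
      proof (rule union_over_subsets)
        fix k assume k: "k \<le> card {1..n}" "?R k"
        then have k1: "k \<ge> 1" by (cases k) auto
        have ex: "(1/2::real) \<le> 1 - exp (- 1)"
          using exp_ge_add_one_self[of 1] by (simp add: exp_minus field_simps)
        have prob: "measure_pmf.prob (Gnp n p) {g. real (cut g {1..n} S) \<le> p * n * card S / 8} \<le> exp (- (p * n * k / 8))"
          if "S \<subseteq> {1..n}" "card S = k" for S
        proof -
          have "measure_pmf.prob (Gnp n p) {g. real (cut g {1..n} S) \<le> p * n * card S / 8} \<le>
             exp (1 * (p * n * card S / 8) - p * (1 - exp (- 1)) * real (card (cut_pairs S ({1..n} - S))))"
            unfolding Gnp_eq_rbits using p that by (intro rbits_lower_tail cut_pairs_subset_inner) auto
          also have "card (cut_pairs S ({1..n} - S)) = k * (n - k)" using that by (simp add: card_cut_pairs_compl)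
          also have "exp (1 * (p * n * card S / 8) - p * (1 - exp (- 1)) * real (k * (n - k))) \<le> exp (- (p * n * k / 8))"
          proof -
            have "real (n - k) \<ge> n / 2" using k by (simp add: of_nat_diff)
            then have "p * (1 / 2) * (k * (n / 2)) \<le> p * (1 - exp (- 1)) * (k * real (n - k))"
              using p ex by (intro mult_mono) auto
            then show ?thesis using that by (simp only: of_nat_mult) (simp add: algebra_simps)
          qed
          finally show ?thesis .
        qed
        have "(\<Sum>S | S \<subseteq> {1..n} \<and> card S = k. measure_pmf.prob (Gnp n p) {g. real (cut g {1..n} S) \<le> p * n * card S / 8})
          \<le> (\<Sum>S | S \<subseteq> {1..n} \<and> card S = k. exp (- (p * n * k / 8)))"
          using prob by (intro sum_mono) auto
        also have "\<dots> = real (n choose k) * exp (- (p * n * k / 8))" by (simp add: n_subsets)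
        also have "\<dots> \<le> (exp 1 * (4 * (p * n))) ^ k * exp (- (p * n * k / 8))"
        proof (intro mult_right_mono binomial_le_exp k1)
          have "real n * 1 \<le> real n * (4 * p * k)" using k by (intro mult_left_mono) auto
          then show "real n \<le> 4 * (p * n) * k" by (simp add: mult_ac)
        qed simp
        also have "(exp 1 * (4 * (p * n))) ^ k = exp (k * ln (exp 1 * (4 * (p * n))))"
          using d by (simp add: exp_of_nat_mult)
        also have "exp (k * ln (exp 1 * (4 * (p * n)))) * exp (- (p * n * k / 8)) \<le> exp (- real n / 64)"
        proof -
          have "k * ln (exp 1 * (4 * (p * n))) \<le> k * (p * n / 16)" by (intro mult_left_mono D1 d) auto
          moreover have "real n * 1 \<le> real n * (4 * p * k)" using k by (intro mult_left_mono) auto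
          ultimately have "k * ln (exp 1 * (4 * (p * n))) + - (p * n * k / 8) \<le> - real n / 64"
            by (simp add: algebra_simps)
          then show ?thesis unfolding exp_add[symmetric] by simp
        qed
        finally show "(\<Sum>S | S \<subseteq> {1..n} \<and> card S = k. measure_pmf.prob (Gnp n p) {g. real (cut g {1..n} S) \<le> p * n * card S / 8}) \<le> exp (- real n / 64)" .
      qed auto
      finally show "measure_pmf.prob (Gnp n p) {g. \<not> (\<forall>S\<subseteq>{1..n}. ?R (card S) \<longrightarrow> p * n * card S / 8 < cut g {1..n} S)} \<le> (real n + 1) * exp (- real n / 64)" by simp
    qed
  qed
  then show ?thesis using that[of D0] by (simp add: D0_def)
qed

section \<open>Maximum degree, number of edges and sparsity of small sets\<close>

lemma exp_half_bound: "exp (1 / 2) \<le> (7 / 4 :: real)"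
  using exp_bound[of "1 / 2"] by (simp add: power2_eq_square)

text \<open>The degree bound max(ln n, p n), set against boundaries of order p n |S|, produces the
  factor min(p n / ln n, 1) of the theorem; see \<open>min_max_product\<close>. The constant 4
  leaves one half of the threshold for the mean and one half for 2 ln n.\<close>

lemma whp_max_degree:
  "whp (\<lambda>n p. 1 \<le> p * n) (\<lambda>n p g. \<forall>v\<in>{1..n}. cut g {1..n} {v} < 4 * max (ln n) (p * n))"
proof (rule whpI)
  show "(\<lambda>n. real n * exp (- 2 * ln (real n))) \<longlonglongrightarrow> 0" by real_asymp
  show "\<forall>\<^sub>F n in sequentially. \<forall>p :: real. 0 \<le> p \<longrightarrow> p \<le> 1 \<longrightarrow> 1 \<le> p * n \<longrightarrow>
     measure_pmf.prob (Gnp n p) {g. \<not> (\<forall>v\<in>{1..n}. cut g {1..n} {v} < 4 * max (ln n) (p * n))} \<le> real n * exp (- 2 * ln (real n))"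
  proof (intro always_eventually allI impI)
    fix n and p :: real assume p: "0 \<le> p" "p \<le> 1" "1 \<le> p * real n"
    define m where "m = 4 * max (ln (real n)) (p * n)"
    have "{g. \<not> (\<forall>v\<in>{1..n}. cut g {1..n} {v} < m)} = {g. \<exists>v\<in>{1..n}. m \<le> cut g {1..n} {v}}" by (auto simp: not_less)
    then have "measure_pmf.prob (Gnp n p) {g. \<not> (\<forall>v\<in>{1..n}. cut g {1..n} {v} < m)} \<le>
      (\<Sum>v\<in>{1..n}. measure_pmf.prob (Gnp n p) {g. m \<le> cut g {1..n} {v}})"
      using prob_UN_le[of "{1..n}"] by simp
    also have "\<dots> \<le> (\<Sum>v\<in>{1..n}. exp (- 2 * ln (real n)))"
    proof (rule sum_mono)
      fix v assume v: "v \<in> {1..n}"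
      have "measure_pmf.prob (Gnp n p) {g. m \<le> cut g {1..n} {v}} \<le>
        exp (p * (exp 1 - 1) * real (card (cut_pairs {v} ({1..n} - {v}))) - 1 * m)"
        unfolding Gnp_eq_rbits using p v by (intro rbits_upper_tail cut_pairs_subset_inner) auto
      also have "\<dots> \<le> exp (- 2 * ln (real n))"
      proof -
        have "card (cut_pairs {v} ({1..n} - {v})) = n - 1" using v by (simp add: card_cut_pairs)
        then have "p * (exp 1 - 1) * real (card (cut_pairs {v} ({1..n} - {v}))) \<le> p * 2 * n"
          using p exp_le by (intro mult_mono) auto
        moreover have "2 * (p * n) \<le> m / 2" "2 * ln n \<le> m / 2" by (auto simp: m_def)
        ultimately show ?thesis by simp
      qed
      finally show "measure_pmf.prob (Gnp n p) {g. m \<le> cut g {1..n} {v}} \<le> exp (- 2 * ln (real n))" .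
    qed
    finally show "measure_pmf.prob (Gnp n p) {g. \<not> (\<forall>v\<in>{1..n}. cut g {1..n} {v} < 4 * max (ln n) (p * n))} \<le> real n * exp (- 2 * ln (real n))"
      by (simp add: m_def)
  qed
qed

text \<open>The mean is at most s n / 2, so s n is a deviation by a factor 2. The parameter s is
  separate from p n to allow the fixed bound D n as well as the very sparse sprinkled graph with s
  of order 1 / sqrt(ln n).\<close>

lemma edge_count_bound:
  fixes p s :: real
  assumes "0 \<le> p" "p \<le> 1" "0 \<le> s" "p * n \<le> s"
  shows "measure_pmf.prob (Gnp n p) {g. \<not> cnt (pairs n) g \<le> s * n} \<le> exp (- s * n / 8)"
proof -
  have "measure_pmf.prob (Gnp n p) {g. \<not> cnt (pairs n) g \<le> s * n} \<le> measure_pmf.prob (Gnp n p) {g. s * n \<le> real (cnt (pairs n) g)}"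
    by (intro prob_mono_support) auto
  also have "\<dots> \<le> exp (p * (exp (1 / 2) - 1) * real (card (pairs n)) - 1 / 2 * (s * n))"
    unfolding Gnp_eq_rbits pairs_eq using assms by (intro rbits_upper_tail) auto
  also have "\<dots> \<le> exp (- s * n / 8)"
  proof -
    have "p * (exp (1 / 2) - 1) * real (card (pairs n)) \<le> p * (3 / 4) * ((real n)\<^sup>2 / 2)"
      using assms exp_half_bound card_inner_pairs_le[of "{1..n}"]
      by (intro mult_mono) (auto simp: pairs_eq)
    moreover have "(p * n) * n \<le> s * n" using assms by (intro mult_right_mono) auto
    ultimately show ?thesis by (simp add: power2_eq_square)
  qed
  finally show ?thesis .
qed

lemma whp_edge_count:
  "whp (\<lambda>n p. 1 \<le> p * n) (\<lambda>n p g. cnt (pairs n) g \<le> p * n * n)"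
proof (rule whpI)
  show "(\<lambda>n. exp (- (real n) / 8)) \<longlonglongrightarrow> 0" by real_asymp
  show "\<forall>\<^sub>F n in sequentially. \<forall>p :: real. 0 \<le> p \<longrightarrow> p \<le> 1 \<longrightarrow> 1 \<le> p * n \<longrightarrow>
     measure_pmf.prob (Gnp n p) {g. \<not> cnt (pairs n) g \<le> p * n * n} \<le> exp (- (real n) / 8)"
  proof (intro always_eventually allI impI)
    fix n and p :: real assume p: "0 \<le> p" "p \<le> 1" "1 \<le> p * real n"
    have "measure_pmf.prob (Gnp n p) {g. \<not> cnt (pairs n) g \<le> p * n * n} \<le> exp (- (p * n) * n / 8)"
      using edge_count_bound[of p "p * n" n] p by simp
    also have "\<dots> \<le> exp (- (real n) / 8)"
      using mult_right_mono[OF p(3), of "real n"] by simp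
    finally show "measure_pmf.prob (Gnp n p) {g. \<not> cnt (pairs n) g \<le> p * n * n} \<le> exp (- (real n) / 8)" .
  qed
qed

lemma binomial_le_power: "real (n choose k) \<le> real n ^ k"
proof -
  have "real ((n choose k) * 1) \<le> real ((n choose k) * fact k)"
    unfolding of_nat_le_iff by (intro mult_left_mono) (auto simp: fact_ge_1)
  also have "\<dots> \<le> real (n ^ k)" unfolding of_nat_le_iff by (rule binomial_fact_pow)
  finally show ?thesis by simp
qed

text \<open>There are at most n^k sets, and 3 k inner edges cost about (p k)^(3 k), which leaves (2
  (p n k)^3 / n^2)^k. Three edges per vertex are chosen so that the square of n in the denominator
  pays for the n + 1 sizes.\<close>

lemma whp_small_sets_sparse:
  fixes C :: real
  assumes "C > 0"
  shows "whp (\<lambda>n p. 1 \<le> p * n) (\<lambda>n p g. \<forall>S\<subseteq>{1..n}. S \<noteq> {} \<and> p * n * card S \<le> C * ln n \<longrightarrow>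
      cnt (inner_pairs S) g < 3 * card S)"
proof (rule whpI)
  define q where "q = (\<lambda>n. 2 * (C * ln (real n)) ^ 3 / (real n)\<^sup>2)"
  show "(\<lambda>n. (real n + 1) * q n) \<longlonglongrightarrow> 0" unfolding q_def using assms by real_asymp
  have "\<forall>\<^sub>F n in sequentially. q n \<le> 1" unfolding q_def using assms by real_asymp
  moreover have "\<forall>\<^sub>F n in sequentially. C * ln (real n) \<le> real n" using assms by real_asymp
  moreover have "\<forall>\<^sub>F n in sequentially. n \<ge> (1::nat)" by (rule eventually_ge_at_top)
  ultimately show "\<forall>\<^sub>F n in sequentially. \<forall>p :: real. 0 \<le> p \<longrightarrow> p \<le> 1 \<longrightarrow> 1 \<le> p * n \<longrightarrow>
     measure_pmf.prob (Gnp n p) {g. \<not> (\<forall>S\<subseteq>{1..n}. S \<noteq> {} \<and> p * n * card S \<le> C * ln n \<longrightarrow>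
      cnt (inner_pairs S) g < 3 * card S)} \<le> (real n + 1) * q n"
  proof (eventually_elim, intro allI impI)
    fix n and p :: real assume n: "q n \<le> 1" "C * ln (real n) \<le> real n" "n \<ge> 1" and p: "0 \<le> p" "p \<le> 1" "1 \<le> p * real n"
    have p0: "p > 0" using p by (auto simp: order.order_iff_strict)
    let ?R = "\<lambda>k. k \<noteq> 0 \<and> p * n * real k \<le> C * ln n"
    have "measure_pmf.prob (Gnp n p) {g. \<not> (\<forall>S\<subseteq>{1..n}. S \<noteq> {} \<and> p * n * card S \<le> C * ln n \<longrightarrow>
      cnt (inner_pairs S) g < 3 * card S)} \<le>
       measure_pmf.prob (Gnp n p) {g. \<exists>S\<subseteq>{1..n}. ?R (card S) \<and> 3 * real (card S) \<le> real (cnt (inner_pairs S) g)}"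
    proof (rule prob_mono_support)
      fix g assume "\<not> (\<forall>S\<subseteq>{1..n}. S \<noteq> {} \<and> p * n * card S \<le> C * ln n \<longrightarrow> cnt (inner_pairs S) g < 3 * card S)"
      then obtain S where S: "S \<subseteq> {1..n}" "S \<noteq> {}" "p * n * card S \<le> C * ln n" "3 * card S \<le> cnt (inner_pairs S) g"
        by (auto simp: not_less)
      moreover have "card S \<noteq> 0" using S(1,2) finite_subset[of S "{1..n}"] by auto
      moreover have "3 * real (card S) \<le> real (cnt (inner_pairs S) g)" using S(4) by linarith
      ultimately show "\<exists>S\<subseteq>{1..n}. ?R (card S) \<and> 3 * real (card S) \<le> real (cnt (inner_pairs S) g)" by blast
    qed
    also have "\<dots> \<le> (real (card {1..n}) + 1) * q n"
    proof (rule union_over_subsets)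
      show "0 \<le> q n" using n assms by (auto simp: q_def)
      fix k assume k: "k \<le> card {1..n}" "?R k"
      define y where "y = p * k"
      have y0: "y > 0" using p0 k by (simp add: y_def)
      have y: "n * y \<le> C * ln n" using k by (simp add: y_def mult_ac)
      then have "real n * y \<le> real n * 1" using n by linarith
      then have y1: "y \<le> 1" using n by simp
      have prob: "measure_pmf.prob (Gnp n p) {g. 3 * real (card S) \<le> real (cnt (inner_pairs S) g)} \<le> exp (k / 2) * (y ^ 3) ^ k"
        if "S \<subseteq> {1..n}" "card S = k" for S
      proof -
        have fin: "finite S" using that finite_subset by auto
        \<comment> \<open>The tilt exp t = 1 / y with y = p k reduces the mean term to at most k /
          2.\<close>
        have "measure_pmf.prob (Gnp n p) {g. 3 * real (card S) \<le> real (cnt (inner_pairs S) g)} \<le>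
          exp (p * (exp (ln (1 / y)) - 1) * real (card (inner_pairs S)) - ln (1 / y) * (3 * real (card S)))"
          unfolding Gnp_eq_rbits using p that y0 y1 by (intro rbits_upper_tail inner_pairs_mono) auto
        also have "\<dots> \<le> exp (k / 2 + 3 * k * ln y)"
        proof -
          have "p * (exp (ln (1 / y)) - 1) * real (card (inner_pairs S)) \<le> p * (1 / y) * ((real k)\<^sup>2 / 2)"
            using p y0 y1 card_inner_pairs_le[OF fin] that by (intro mult_mono) auto
          also have "\<dots> = k / 2" using k p0 by (simp add: y_def power2_eq_square)
          finally show ?thesis using that y0 by (simp add: ln_div)
        qed
        also have "\<dots> = exp (k / 2) * (y ^ 3) ^ k"
          using y0 by (simp add: exp_add power_mult[symmetric] flip: ln_realpow)
            (simp add: exp_of_nat_mult[symmetric] mult.commute flip: powr_realpow add: powr_def)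
        finally show ?thesis .
      qed
      have "(\<Sum>S | S \<subseteq> {1..n} \<and> card S = k. measure_pmf.prob (Gnp n p) {g. 3 * real (card S) \<le> real (cnt (inner_pairs S) g)}) \<le>
        (\<Sum>S | S \<subseteq> {1..n} \<and> card S = k. exp (k / 2) * (y ^ 3) ^ k)"
        using prob by (intro sum_mono) auto
      also have "\<dots> = real (n choose k) * (exp (k / 2) * (y ^ 3) ^ k)" by (simp add: n_subsets)
      also have "\<dots> \<le> real n ^ k * (2 ^ k * (y ^ 3) ^ k)"
      proof (intro mult_mono binomial_le_power)
        have "exp (real k / 2) = exp (1 / 2) ^ k" by (simp add: exp_of_nat_mult[symmetric])
        also have "\<dots> \<le> 2 ^ k" using exp_half_bound by (intro power_mono) auto
        finally show "exp (real k / 2) \<le> 2 ^ k" .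
      qed (use y0 in auto)
      also have "\<dots> = (2 * (n * y) ^ 3 / (real n)\<^sup>2) ^ k"
      proof -
        have "2 * (n * y) ^ 3 / (real n)\<^sup>2 = real n * (2 * y ^ 3)"
          using n by (simp add: power2_eq_square power3_eq_cube)
        then show ?thesis by (simp only: power_mult_distrib)
      qed
      also have "\<dots> \<le> q n ^ k"
        unfolding q_def using y y0 n by (intro power_mono divide_right_mono mult_left_mono) auto
      also have "\<dots> \<le> q n ^ 1" using k n assms by (intro power_decreasing) (auto simp: q_def)
      finally show "(\<Sum>S | S \<subseteq> {1..n} \<and> card S = k. measure_pmf.prob (Gnp n p) {g. 3 * real (card S) \<le> real (cnt (inner_pairs S) g)}) \<le> q n" by simp
    qed simp
    finally show "measure_pmf.prob (Gnp n p) {g. \<not> (\<forall>S\<subseteq>{1..n}. S \<noteq> {} \<and> p * n * card S \<le> C * ln n \<longrightarrow>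
      cnt (inner_pairs S) g < 3 * card S)} \<le> (real n + 1) * q n" by simp
  qed
qed

section \<open>Sprinkling\<close>

text \<open>A bit is absent exactly if it is absent in both rounds, hence 1 - p = (1 - p1) (1 -
  p2).\<close>

lemma rbits_sprinkle:
  assumes A: "finite A" and p: "0 \<le> p1" "p1 \<le> 1" "0 \<le> p2" "p2 \<le> 1" "p = p1 + p2 - p1 * p2"
  shows "rbits A p = map_pmf (\<lambda>(g, h) x. x \<in> A \<and> (g x \<or> h x)) (pair_pmf (rbits A p1) (rbits A p2))"
proof -
  have p01: "0 \<le> p" "p \<le> 1"
  proof -
    have "p = p1 + p2 * (1 - p1)" "1 - p = (1 - p1) * (1 - p2)" using p(5) by (auto simp: algebra_simps)
    moreover have "0 \<le> p2 * (1 - p1)" "0 \<le> (1 - p1) * (1 - p2)" using p(1-4) by auto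
    ultimately show "0 \<le> p" "p \<le> 1" using p(1) by linarith+
  qed
  have b: "bernoulli_pmf p = bernoulli_pmf p1 \<bind> (\<lambda>a. bernoulli_pmf p2 \<bind> (\<lambda>b. return_pmf (a \<or> b)))"
    (is "_ = ?R")
  proof (rule pmf_eqI)
    fix x
    have "pmf ?R False = (1 - p1) * (1 - p2)" using p by (simp add: pmf_bind measure_pmf_single)
    moreover have "pmf ?R True = p1 + p2 - p1 * p2" using p by (simp add: pmf_bind pmf_return algebra_simps)
    ultimately show "pmf (bernoulli_pmf p) x = pmf ?R x"
      using p01 p(5) by (cases x) (auto simp: algebra_simps)
  qed
  have "rbits A p = Pi_pmf A False (\<lambda>_. bernoulli_pmf p1) \<bind>
     (\<lambda>f. Pi_pmf A False (\<lambda>x. bernoulli_pmf p2 \<bind> (\<lambda>b. return_pmf (f x \<or> b))))"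
    unfolding rbits_def b by (rule Pi_pmf_bind[OF A])
  also have "\<dots> = Pi_pmf A False (\<lambda>_. bernoulli_pmf p1) \<bind>
     (\<lambda>f. Pi_pmf A False (\<lambda>_. bernoulli_pmf p2) \<bind> (\<lambda>h. return_pmf (\<lambda>x. x \<in> A \<and> (f x \<or> h x))))"
    by (subst Pi_pmf_bind[OF A, where d' = False]) (auto simp: A intro!: bind_pmf_cong)
  finally show ?thesis
    by (simp add: rbits_def map_pmf_def pair_pmf_def bind_assoc_pmf bind_return_pmf)
qed

text \<open>Conditioning on the first round. It is needed because the objects of the second round
  (the family of candidate sets, the anchor set of the paths) are functions of the first.\<close>

lemma prob_pair_conditional:
  assumes "\<And>x. x \<in> set_pmf M \<Longrightarrow> A x \<Longrightarrow> measure_pmf.prob N {y. B x y} \<le> \<beta>" "\<beta> \<ge> 0"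
  shows "measure_pmf.prob (pair_pmf M N) {z. A (fst z) \<and> B (fst z) (snd z)} \<le> \<beta>"
proof -
  have "emeasure (measure_pmf (pair_pmf M N)) {z. A (fst z) \<and> B (fst z) (snd z)} =
     (\<integral>\<^sup>+x. emeasure (measure_pmf (map_pmf (Pair x) N)) {z. A (fst z) \<and> B (fst z) (snd z)} \<partial>measure_pmf M)"
    unfolding pair_pmf_def map_pmf_def by (rule emeasure_bind_pmf)
  also have "\<dots> \<le> (\<integral>\<^sup>+x. ennreal \<beta> \<partial>measure_pmf M)"
  proof (intro nn_integral_mono_AE AE_pmfI)
    fix x assume x: "x \<in> set_pmf M"
    have "measure_pmf.prob N {y. A x \<and> B x y} \<le> \<beta>"
      using assms x by (cases "A x") auto
    then show "emeasure (measure_pmf (map_pmf (Pair x) N)) {z. A (fst z) \<and> B (fst z) (snd z)} \<le> ennreal \<beta>"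
      by (simp add: measure_pmf.emeasure_eq_measure vimage_def ennreal_leI)
  qed
  also have "\<dots> = ennreal \<beta>" by (simp add: measure_pmf.emeasure_space_1)
  finally show ?thesis
    using assms(2) by (simp add: measure_pmf.emeasure_eq_measure ennreal_le_iff)
qed

text \<open>Every counted F has weight \<open>y ^ card F\<close> at least y^r, and all weights
  together are (1 + y)^|E|. With y = 1 / ln n the exponent is r ln ln n + |E| / ln n, of smaller
  order than n / sqrt(ln n) in the application.\<close>

lemma card_small_subsets_le:
  assumes E: "finite E" and y: "0 < y" "y \<le> 1"
  shows "real (card {F. F \<subseteq> E \<and> real (card F) \<le> r}) \<le> exp (r * ln (1 / y) + y * card E)"
proof -
  have tot: "(\<Sum>F\<in>Pow E. y ^ card F) = (1 + y) ^ card E"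
    using E
  proof (induction E rule: finite_induct)
    case (insert x E)
    have "(\<Sum>F\<in>Pow (insert x E). y ^ card F) = (\<Sum>F\<in>Pow E. y ^ card F) + (\<Sum>F\<in>insert x ` Pow E. y ^ card F)"
      unfolding Pow_insert using insert by (intro sum.union_disjoint) auto
    also have "(\<Sum>F\<in>insert x ` Pow E. y ^ card F) = (\<Sum>F\<in>Pow E. y ^ card (insert x F))"
      using insert by (intro sum.reindex_cong[where l = "insert x"]) (auto simp: inj_on_def)
    also have "\<dots> = (\<Sum>F\<in>Pow E. y * y ^ card F)"
      using insert by (intro sum.cong) (auto simp: card_insert_if finite_subset)
    finally show ?case using insert by (simp add: sum_distrib_left[symmetric] algebra_simps)
  qed simp
  let ?F = "{F. F \<subseteq> E \<and> real (card F) \<le> r}"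
  have "real (card ?F) * exp (- r * ln (1 / y)) = (\<Sum>F\<in>?F. exp (r * ln y))"
    using y by (simp add: ln_div)
  also have "\<dots> \<le> (\<Sum>F\<in>?F. y ^ card F)"
  proof (rule sum_mono)
    fix F assume "F \<in> ?F"
    then have "r * ln y \<le> real (card F) * ln y" using y by (intro mult_right_mono_neg) auto
    moreover have "exp (real (card F) * ln y) = y ^ card F" using y by (simp add: exp_of_nat_mult)
    ultimately show "exp (r * ln y) \<le> y ^ card F" by (metis exp_le_cancel_iff)
  qed
  also have "\<dots> \<le> (\<Sum>F\<in>Pow E. y ^ card F)" using E y by (intro sum_mono2) auto
  also have "\<dots> \<le> exp y ^ card E" unfolding tot using y by (intro power_mono) auto
  also have "\<dots> = exp (y * card E)" by (simp add: exp_of_nat_mult[symmetric] mult.commute)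
  finally have "real (card ?F) * exp (- r * ln (1 / y)) \<le> exp (y * card E)" .
  then have "real (card ?F) * exp (- r * ln (1 / y)) * exp (r * ln (1 / y)) \<le> exp (y * card E) * exp (r * ln (1 / y))"
    by (intro mult_right_mono) auto
  then show ?thesis by (simp add: mult.assoc exp_add[symmetric] add.commute)
qed

text \<open>Components are disjoint, so the union has at most one member. As a total function it can
  be indexed by endpoints of edges, and it is empty for w outside V.\<close>

definition comp_of :: "(nat \<times> nat \<Rightarrow> bool) \<Rightarrow> nat set \<Rightarrow> nat \<Rightarrow> nat set" where
  "comp_of g V w = \<Union>{Q. w \<in> Q \<and> iscomp g V Q}"

lemma comp_of_eq: "iscomp g V Q \<Longrightarrow> w \<in> Q \<Longrightarrow> comp_of g V w = Q"
  unfolding comp_of_def using iscomp_disjoint[of g V Q] by blast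

definition big_part :: "nat \<Rightarrow> (nat \<times> nat \<Rightarrow> bool) \<Rightarrow> nat set \<Rightarrow> nat set" where
  "big_part K g S = \<Union>{Q. iscomp g S Q \<and> K \<le> card Q}"

lemma big_part_subset: "big_part K g S \<subseteq> S"
  by (auto simp: big_part_def iscomp_def)

lemma conn_mono:
  assumes "conn g S" "\<And>e. e \<in> inner_pairs S \<Longrightarrow> g e \<Longrightarrow> h e"
  shows "conn h S"
proof -
  have "touch h T (S - T)" if "T \<subseteq> S" "touch g T (S - T)" for T
    using that assms(2) cut_pairs_subset_inner[OF that(1), of "S - T"] unfolding touch_def by blast
  then show ?thesis using assms(1) unfolding conn_def by blast
qed

lemma card_small_comps_at_edges:
  assumes "finite E" "finite S"
  shows "card (\<Union>e\<in>E. \<Union>w\<in>{fst e, snd e}. (if card (comp_of g S w) < k then comp_of g S w else {})) \<le> 2 * k * card E"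
proof -
  have fin: "finite (comp_of g S w)" for w
    by (rule finite_subset[OF _ assms(2)]) (auto simp: comp_of_def iscomp_def)
  have "card (\<Union>e\<in>E. \<Union>w\<in>{fst e, snd e}. (if card (comp_of g S w) < k then comp_of g S w else {})) \<le>
    (\<Sum>e\<in>E. card (\<Union>w\<in>{fst e, snd e}. (if card (comp_of g S w) < k then comp_of g S w else {})))"
    by (intro card_UN_le assms)
  also have "\<dots> \<le> (\<Sum>e\<in>E. 2 * k)"
  proof (rule sum_mono)
    fix e
    have "card (\<Union>w\<in>{fst e, snd e}. (if card (comp_of g S w) < k then comp_of g S w else {})) \<le>
      (\<Sum>w\<in>{fst e, snd e}. card (if card (comp_of g S w) < k then comp_of g S w else {}))"
      by (intro card_UN_le) auto
    also have "\<dots> \<le> (\<Sum>w\<in>{fst e, snd e}. k)" by (intro sum_mono) auto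
    also have "\<dots> \<le> 2 * k" using card_insert_le_m1[of 2 "{snd e}" "fst e"] by simp
    finally show "card (\<Union>w\<in>{fst e, snd e}. (if card (comp_of g S w) < k then comp_of g S w else {})) \<le> 2 * k" .
  qed
  finally show ?thesis by (simp add: mult.commute)
qed

text \<open>A lost vertex lies in a small \<open>g1\<close>-component Q of S, and some g-edge leaves
  Q. If an edge leaves S, charge K vertices to an end of this cut edge. Otherwise Q is a
  \<open>g1\<close>-component of all of V, so the leaving edge is sprinkled: charge K0 vertices to
  it if Q is that small, and else count Q in the last sum. Two thresholds are used because there are
  too many sprinkled edges to charge K to each.\<close>

lemma small_part_bound:
  assumes V: "finite V" "S \<subseteq> V" and g: "\<And>e. e \<in> inner_pairs V \<Longrightarrow> g e \<longleftrightarrow> g1 e \<or> g2 e"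
    and K: "K0 \<le> K" and nocomp: "\<And>Q. iscomp g V Q \<Longrightarrow> Q \<subseteq> S \<Longrightarrow> K \<le> card Q"
  shows "card (S - big_part K g1 S) \<le> 2 * K0 * cnt (inner_pairs V) g2 + 2 * K * cut g V S
     + (\<Sum>Q | Q \<subseteq> V \<and> iscomp g1 V Q \<and> K0 \<le> card Q \<and> card Q < K. card Q)"
proof -
  define U where "U = (\<lambda>k E. \<Union>e\<in>E. \<Union>w\<in>{fst e, snd e}. (if card (comp_of g1 S w) < k then comp_of g1 S w else {}))"
  let ?E1 = "{e\<in>cut_pairs S (V - S). g e}" and ?E2 = "{e\<in>inner_pairs V. g2 e}"
  let ?Q = "{Q. Q \<subseteq> V \<and> iscomp g1 V Q \<and> K0 \<le> card Q \<and> card Q < K}"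
  have finS: "finite S" using V finite_subset by auto
  have finE: "finite ?E1" "finite ?E2" using V finS by auto
  have finQ: "finite ?Q" using V by (auto intro: finite_subset[of _ "Pow V"])
  have "S - big_part K g1 S \<subseteq> U K0 ?E2 \<union> U K ?E1 \<union> \<Union>?Q"
  proof
    fix v assume v: "v \<in> S - big_part K g1 S"
    then obtain Q where Q: "v \<in> Q" "iscomp g1 S Q" using ex_iscomp[OF finS, of v g1] by blast
    have QS: "Q \<subseteq> S" "Q \<subseteq> V" using Q V by (auto simp: iscomp_def)
    have small: "card Q < K" using v Q unfolding big_part_def by (auto simp: not_le[symmetric])
    have inU: "v \<in> U k E" if "e \<in> E" "fst e \<in> Q \<or> snd e \<in> Q" "card Q < k" for e E k
    proof -
      have "\<exists>w\<in>{fst e, snd e}. w \<in> Q" using that by auto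
      then obtain w where w: "w \<in> {fst e, snd e}" "w \<in> Q" by blast
      then have "comp_of g1 S w = Q" using Q(2) by (intro comp_of_eq)
      then show ?thesis unfolding U_def using that Q(1) w(1) by force
    qed
    have "conn g Q"
      using Q(2) g inner_pairs_mono[OF QS(2)] by (intro conn_mono[of g1 Q g]) (auto simp: iscomp_def)
    then have "touch g Q (V - Q)"
      using nocomp[of Q] small QS unfolding iscomp_def by auto
    then obtain e where e: "e \<in> cut_pairs Q (V - Q)" "g e" by (auto simp: touch_def)
    have endQ: "fst e \<in> Q \<or> snd e \<in> Q" using e by (auto simp: cut_pairs_def)
    show "v \<in> U K0 ?E2 \<union> U K ?E1 \<union> \<Union>?Q"
    proof (cases "touch g Q (V - S)")
      case True
      then obtain f where f: "f \<in> cut_pairs Q (V - S)" "g f" by (auto simp: touch_def)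
      then have "f \<in> ?E1" using cut_pairs_mono[OF QS(1), of "V - S" "V - S"] by auto
      moreover have "fst f \<in> Q \<or> snd f \<in> Q" using f by (auto simp: cut_pairs_def)
      ultimately show ?thesis using inU[of f ?E1 K] small by blast
    next
      case False
      have VQ: "V - Q = (S - Q) \<union> (V - S)" using QS V by auto
      have iV: "cut_pairs Q (V - Q) \<subseteq> inner_pairs V" using QS by (intro cut_pairs_subset_inner) auto
      have nt: "\<not> touch g1 Q (V - S)"
      proof
        assume "touch g1 Q (V - S)"
        then have "touch g Q (V - S)"
          using g cut_pairs_subset_inner[OF QS(2), of "V - S"] unfolding touch_def by blast
        then show False using False by simp
      qed
      then have comp: "iscomp g1 V Q" using Q(2) QS unfolding iscomp_def VQ touch_Un by auto
      have "\<not> g1 e" using comp e(1) by (auto simp: iscomp_def touch_def)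
      moreover have "e \<in> inner_pairs V" using e(1) iV by blast
      ultimately have "e \<in> ?E2" using e(2) g by blast
      then show ?thesis
      proof (cases "card Q < K0")
        case True
        then show ?thesis using inU[OF \<open>e \<in> ?E2\<close> endQ] by auto
      next
        case False
        then show ?thesis using comp small QS Q(1) by auto
      qed
    qed
  qed
  moreover have "finite (U k E)" if "finite E" for k E
    unfolding U_def using that by (auto intro: finite_subset[OF _ finS] simp: comp_of_def iscomp_def)
  moreover have "finite (\<Union>?Q)" using V by (auto intro: finite_subset[of _ V])
  ultimately have "card (S - big_part K g1 S) \<le> card (U K0 ?E2 \<union> U K ?E1 \<union> \<Union>?Q)"
    using finE by (intro card_mono) auto
  also have "\<dots> \<le> card (U K0 ?E2) + card (U K ?E1) + card (\<Union>?Q)"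
    using card_Un_le[of "U K0 ?E2 \<union> U K ?E1" "\<Union>?Q"] card_Un_le[of "U K0 ?E2" "U K ?E1"] by linarith
  also have "card (U K0 ?E2) \<le> 2 * K0 * card ?E2" unfolding U_def by (intro card_small_comps_at_edges finE finS)
  also have "card (U K ?E1) \<le> 2 * K * card ?E1" unfolding U_def by (intro card_small_comps_at_edges finE finS)
  also have "card (\<Union>?Q) \<le> (\<Sum>Q\<in>?Q. card Q)"
    using card_UN_le[OF finQ, of id] by simp
  finally show ?thesis by (simp add: cnt_def)
qed

text \<open>A set all of whose components have size at least \<open>K\<close> is recovered from its boundary edges \<open>F\<close> and one
  representative per component (the set \<open>R\<close>). There are few such pairs, which makes the union bound work.\<close>

definition comps_meeting :: "(nat \<times> nat \<Rightarrow> bool) \<Rightarrow> nat set \<Rightarrow> (nat \<times> nat) set \<Rightarrow> nat set \<Rightarrow> nat set" where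
  "comps_meeting g V F R = \<Union>{Q. iscomp (\<lambda>e. g e \<and> e \<notin> F) V Q \<and> Q \<inter> R \<noteq> {}}"

lemma big_part_encoding:
  assumes V: "finite V" "S \<subseteq> V" and g: "\<And>e. e \<in> inner_pairs V \<Longrightarrow> g1 e \<Longrightarrow> g e"
  obtains F R where "F \<subseteq> {e\<in>inner_pairs V. g1 e}" "card F \<le> cut g V S" "R \<subseteq> V" "K * card R \<le> card V"
    "big_part K g1 S = comps_meeting g1 V F R"
proof -
  define B where "B = big_part K g1 S"
  define F where "F = {e\<in>cut_pairs S (V - S). g1 e}"
  define \<Q> where "\<Q> = {Q. iscomp g1 S Q \<and> K \<le> card Q}"
  define h where "h = (\<lambda>e. g1 e \<and> e \<notin> F)"
  define R where "R = Min ` \<Q>"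
  have finS: "finite S" using V finite_subset by auto
  have \<Q>S: "Q \<subseteq> S" "Q \<noteq> {}" "finite Q" if "Q \<in> \<Q>" for Q
    using that finS finite_subset[of Q S] by (auto simp: \<Q>_def iscomp_def conn_def)
  have cutV: "cut_pairs S (V - S) \<subseteq> inner_pairs V" using V by (intro cut_pairs_subset_inner) auto
  have 1: "F \<subseteq> {e\<in>inner_pairs V. g1 e}" using cutV by (auto simp: F_def)
  have 2: "card F \<le> cut g V S"
    unfolding cnt_def F_def using g cutV finS V by (intro card_mono) auto
  have RQ: "Min Q \<in> Q" if "Q \<in> \<Q>" for Q using \<Q>S[OF that] by (intro Min_in) auto
  have 3: "R \<subseteq> V" using RQ \<Q>S(1) V(2) unfolding R_def by blast
  have fin\<Q>: "finite \<Q>" using \<Q>S finS by (intro finite_subset[of \<Q> "Pow S"]) auto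
  have "K * card R \<le> K * card \<Q>" unfolding R_def using fin\<Q> by (intro mult_le_mono2 card_image_le)
  also have "\<dots> = (\<Sum>Q\<in>\<Q>. K)" by simp
  also have "\<dots> \<le> (\<Sum>Q\<in>\<Q>. card Q)" by (intro sum_mono) (auto simp: \<Q>_def)
  also have "\<dots> = card (\<Union>\<Q>)"
  proof (rule card_Union_disjoint[symmetric])
    show "pairwise disjnt \<Q>"
      using iscomp_disjoint[of g1 S] by (auto simp: pairwise_def disjnt_def \<Q>_def)
  qed (rule \<Q>S(3))
  also have "\<dots> \<le> card V" using \<Q>S(1) V by (intro card_mono) blast+
  finally have 4: "K * card R \<le> card V" .
  \<comment> \<open>Deleting F removes every \<open>g1\<close>-edge between S and the rest, so a
    component within S becomes a component of the whole graph.\<close>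
  have comp: "iscomp h V Q" if "iscomp g1 S Q" for Q
  proof -
    have QS: "Q \<subseteq> S" using that by (auto simp: iscomp_def)
    have "conn h Q"
      using that QS by (intro conn_mono[of g1 Q h]) (auto simp: iscomp_def h_def F_def cut_pairs_def inner_pairs_def)
    moreover have "\<not> touch h Q (V - S)"
      using cut_pairs_mono[OF QS, of "V - S" "V - S"] unfolding touch_def h_def F_def by blast
    moreover have "\<not> touch h Q (S - Q)"
      using that unfolding iscomp_def touch_def h_def by blast
    moreover have "V - Q = (V - S) \<union> (S - Q)" using QS V by auto
    ultimately show ?thesis using QS V by (auto simp: iscomp_def touch_Un)
  qed
  have "comps_meeting g1 V F R = \<Union>\<Q>"
  proof -
    have "{Q. iscomp h V Q \<and> Q \<inter> R \<noteq> {}} = \<Q>"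
    proof (intro equalityI subsetI)
      fix Q assume "Q \<in> {Q. iscomp h V Q \<and> Q \<inter> R \<noteq> {}}"
      then obtain Q' where Q': "iscomp h V Q" "Q' \<in> \<Q>" "Min Q' \<in> Q" by (auto simp: R_def)
      then have "iscomp h V Q'" using comp by (auto simp: \<Q>_def)
      then have "Q = Q'" using iscomp_disjoint[of h V Q Q'] Q' RQ by auto
      then show "Q \<in> \<Q>" using Q' by simp
    next
      fix Q assume Q: "Q \<in> \<Q>"
      then show "Q \<in> {Q. iscomp h V Q \<and> Q \<inter> R \<noteq> {}}" using comp RQ by (auto simp: \<Q>_def R_def)
    qed
    then show ?thesis unfolding comps_meeting_def h_def by simp
  qed
  then show ?thesis using that[OF 1 2 3 4] by (simp add: big_part_def \<Q>_def)
qed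

text \<open>The family depends on the first round \<open>g1\<close> alone, although g ranges over
  all graphs containing it. Thus it is fixed before the sprinkled edges are exposed, and a union
  bound over pairs of members is legitimate.\<close>

lemma big_part_family:
  fixes m M0 y :: real
  assumes V: "finite V" and K: "K \<ge> 1" and y: "0 < y" "y \<le> 1" and M0: "cnt (inner_pairs V) g1 \<le> M0" and m: "m \<ge> 0"
  obtains \<A> where "finite \<A>" "real (card \<A>) \<le> exp (m * ln (1 / y) + y * M0 + card V / K * ln (1 / y) + y * card V)"
    "\<And>S g. S \<subseteq> V \<Longrightarrow> (\<And>e. e \<in> inner_pairs V \<Longrightarrow> g1 e \<Longrightarrow> g e) \<Longrightarrow> cut g V S \<le> m \<Longrightarrow> big_part K g1 S \<in> \<A>"
proof -
  define E where "E = {e\<in>inner_pairs V. g1 e}"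
  define Fs where "Fs = {F. F \<subseteq> E \<and> real (card F) \<le> m}"
  define Rs where "Rs = {R. R \<subseteq> V \<and> real (card R) \<le> card V / K}"
  define \<A> where "\<A> = (\<lambda>(F, R). comps_meeting g1 V F R) ` (Fs \<times> Rs)"
  have finE: "finite E" using V by (simp add: E_def)
  have fin: "finite Fs" "finite Rs" using finE V unfolding Fs_def Rs_def
    by (auto intro: finite_subset[of _ "Pow E"] finite_subset[of _ "Pow V"])
  have lny: "ln (1 / y) \<ge> 0" using y by simp
  have "card \<A> \<le> card Fs * card Rs"
    unfolding \<A>_def using card_image_le[of "Fs \<times> Rs"] fin by (simp add: card_cartesian_product)
  then have "real (card \<A>) \<le> real (card Fs) * real (card Rs)" by (metis of_nat_le_iff of_nat_mult)
  also have "\<dots> \<le> exp (m * ln (1 / y) + y * card E) * exp (card V / K * ln (1 / y) + y * card V)"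
    unfolding Fs_def Rs_def by (intro mult_mono card_small_subsets_le finE V y) auto
  also have "\<dots> \<le> exp (m * ln (1 / y) + y * M0) * exp (card V / K * ln (1 / y) + y * card V)"
    using M0 y by (intro mult_right_mono) (auto simp: E_def cnt_def)
  also have "\<dots> = exp (m * ln (1 / y) + y * M0 + card V / K * ln (1 / y) + y * card V)"
    by (simp add: exp_add[symmetric] add.assoc)
  finally have card: "real (card \<A>) \<le> exp (m * ln (1 / y) + y * M0 + card V / K * ln (1 / y) + y * card V)" .
  have mem: "big_part K g1 S \<in> \<A>"
    if S: "S \<subseteq> V" and g: "\<And>e. e \<in> inner_pairs V \<Longrightarrow> g1 e \<Longrightarrow> g e" and cut: "cut g V S \<le> m" for S g
  proof -
    obtain F R where FR: "F \<subseteq> E" "card F \<le> cut g V S" "R \<subseteq> V" "K * card R \<le> card V" "big_part K g1 S = comps_meeting g1 V F R"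
      unfolding E_def by (rule big_part_encoding[where K = K and ?g1.0 = g1 and g = g, OF V S g])
    have "real K * real (card R) \<le> real (card V)" using FR(4) by (metis of_nat_le_iff of_nat_mult)
    then have "R \<in> Rs" using FR K by (simp add: Rs_def field_simps)
    moreover have "F \<in> Fs" using FR cut by (simp add: Fs_def)
    ultimately show ?thesis unfolding \<A>_def using FR(5) by force
  qed
  have "finite \<A>" using fin by (simp add: \<A>_def)
  then show ?thesis using card mem by (rule that)
qed

section \<open>Failure probability of the sprinkling argument\<close>

definition mid_mass :: "nat \<Rightarrow> nat \<Rightarrow> nat set \<Rightarrow> (nat \<times> nat \<Rightarrow> bool) \<Rightarrow> nat" where
  "mid_mass K0 K V g = (\<Sum>Q | Q \<subseteq> V \<and> iscomp g V Q \<and> K0 \<le> card Q \<and> card Q < K. card Q)"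

text \<open>The tilt 1 suffices since 1 - exp(-1) \<ge> 1 / 2 and there are at least s^2 potential
  edges between A and B; the union bound over ordered pairs gives the square of X.\<close>

lemma few_cross_edges_prob:
  fixes m s X :: real
  assumes V: "finite V" and p: "0 \<le> p" "p \<le> 1" and \<A>: "finite \<A>" "real (card \<A>) \<le> X" and s: "s \<ge> 0"
  shows "measure_pmf.prob (rbits (inner_pairs V) p) {g. \<exists>A\<in>\<A>. \<exists>B\<in>\<A>. A \<subseteq> V \<and> B \<subseteq> V \<and> A \<inter> B = {} \<and> s \<le> card A \<and> s \<le> card B \<and>
     cnt (cut_pairs A B) g \<le> m} \<le> X\<^sup>2 * exp (m - p / 2 * s\<^sup>2)"
proof -
  let ?M = "rbits (inner_pairs V) p"
  let ?P = "\<lambda>A B g. A \<subseteq> V \<and> B \<subseteq> V \<and> A \<inter> B = {} \<and> s \<le> card A \<and> s \<le> card B \<and> cnt (cut_pairs A B) g \<le> m"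
  have ex: "(1/2::real) \<le> 1 - exp (- 1)"
    using exp_ge_add_one_self[of 1] by (simp add: exp_minus field_simps)
  have one: "measure_pmf.prob ?M {g. ?P A B g} \<le> exp (m - p / 2 * s\<^sup>2)" for A B
  proof (cases "A \<subseteq> V \<and> B \<subseteq> V \<and> A \<inter> B = {} \<and> s \<le> card A \<and> s \<le> card B")
    case True
    have "measure_pmf.prob ?M {g. ?P A B g} \<le> measure_pmf.prob ?M {g. cnt (cut_pairs A B) g \<le> m}"
      by (intro prob_mono_support) auto
    also have "\<dots> \<le> exp (1 * m - p * (1 - exp (- 1)) * real (card (cut_pairs A B)))"
      using V p True by (intro rbits_lower_tail cut_pairs_subset_inner) auto
    also have "\<dots> \<le> exp (m - p / 2 * s\<^sup>2)"
    proof -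
      have "finite A" "finite B" using V True finite_subset by auto
      then have c: "card (cut_pairs A B) = card A * card B" using True by (intro card_cut_pairs) auto
      have "s * s \<le> real (card A) * real (card B)" using True s by (intro mult_mono) auto
      then have "p * (1 / 2) * (s * s) \<le> p * (1 - exp (- 1)) * (real (card A) * real (card B))"
        using p ex s by (intro mult_mono[OF mult_left_mono]) auto
      then show ?thesis by (simp add: c power2_eq_square)
    qed
    finally show ?thesis .
  next
    case False
    then have "{g. ?P A B g} = {}" by blast
    then show ?thesis by (simp only: measure_empty exp_ge_zero)
  qed
  have "measure_pmf.prob ?M {g. \<exists>A\<in>\<A>. \<exists>B\<in>\<A>. ?P A B g} \<le> (\<Sum>A\<in>\<A>. measure_pmf.prob ?M {g. \<exists>B\<in>\<A>. ?P A B g})"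
    by (rule prob_UN_le[OF \<A>(1)])
  also have "\<dots> \<le> (\<Sum>A\<in>\<A>. \<Sum>B\<in>\<A>. measure_pmf.prob ?M {g. ?P A B g})"
    by (intro sum_mono prob_UN_le \<A>(1))
  also have "\<dots> \<le> (\<Sum>A\<in>\<A>. \<Sum>B\<in>\<A>. exp (m - p / 2 * s\<^sup>2))" by (intro sum_mono one)
  also have "\<dots> = (real (card \<A>))\<^sup>2 * exp (m - p / 2 * s\<^sup>2)" by (simp add: power2_eq_square)
  also have "\<dots> \<le> X\<^sup>2 * exp (m - p / 2 * s\<^sup>2)"
    using \<A>(2) by (intro mult_right_mono power_mono) auto
  finally show ?thesis .
qed

lemma prob_disj4_le:
  "measure_pmf.prob M {x. ((P x \<or> Q x) \<or> R x) \<or> S x} \<le> measure_pmf.prob M {x. P x} + measure_pmf.prob M {x. Q x} +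
     measure_pmf.prob M {x. R x} + measure_pmf.prob M {x. S x}"
  using prob_disj_le[of M "\<lambda>x. (P x \<or> Q x) \<or> R x" S] prob_disj_le[of M "\<lambda>x. P x \<or> Q x" R] prob_disj_le[of M P Q]
  by linarith

text \<open>One event with two uses. With D = C and T = C - S it is a sparse cut of a component into
  two large sides; with S = C and T = D for different components the cuts are empty, and it
  expresses that the large component is not unique.\<close>

definition sparse_cut_pair :: "nat \<Rightarrow> real \<Rightarrow> real \<Rightarrow> (nat \<times> nat \<Rightarrow> bool) \<Rightarrow> bool" where
  "sparse_cut_pair n s m g \<longleftrightarrow> (\<exists>S T C D. S \<inter> T = {} \<and> s \<le> real (card S) \<and> s \<le> real (card T) \<and>
     iscomp g {1..n} C \<and> S \<subseteq> C \<and> iscomp g {1..n} D \<and> T \<subseteq> D \<and> real (cut g {1..n} S) \<le> m \<and> real (cut g {1..n} T) \<le> m)"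

text \<open>Apart from three atypical events, the large components inside S and T still cover s / 2
  vertices each. They belong to a family known after the first round, and the second round has at
  most m edges between them. The hypothesis \<open>budget\<close> bounds the vertices lost on either
  side.\<close>

lemma sparse_cut_pair_prob:
  fixes p p1 p2 s m M0 y \<eta> :: real
  assumes p: "0 \<le> p1" "p1 \<le> 1" "0 \<le> p2" "p2 \<le> 1" "p = p1 + p2 - p1 * p2"
    and K: "K0 \<le> K" "1 \<le> K" "real K \<le> s" and y: "0 < y" "y \<le> 1" and m: "m \<ge> 0" and M0: "M0 \<ge> 0"
    and budget: "2 * real K0 * (\<eta> * n) + 2 * real K * m + s / 8 \<le> s / 2"
  shows "measure_pmf.prob (Gnp n p) {g. sparse_cut_pair n s m g} \<le>
     measure_pmf.prob (Gnp n p1) {g. \<not> cnt (pairs n) g \<le> M0} + measure_pmf.prob (Gnp n p2) {g. \<not> cnt (pairs n) g \<le> \<eta> * n} +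
     measure_pmf.prob (Gnp n p1) {g. s / 8 \<le> mid_mass K0 K {1..n} g} +
     (exp (m * ln (1 / y) + y * M0 + n / K * ln (1 / y) + y * n))\<^sup>2 * exp (m - p2 / 2 * (s / 2)\<^sup>2)"
proof -
  let ?V = "{1..n}"
  let ?X = "exp (m * ln (1 / y) + y * M0 + n / K * ln (1 / y) + y * n)"
  define N where "N = pair_pmf (Gnp n p1) (Gnp n p2)"
  \<comment> \<open>The full graph g is hidden behind an existential quantifier, so that candidates
    are described by the first round alone; otherwise \<open>Cross\<close> could not be bounded for
    fixed \<open>g1\<close>.\<close>
  define BP where "BP = (\<lambda>g1 A. \<exists>g S. S \<subseteq> ?V \<and> (\<forall>e\<in>inner_pairs ?V. g1 e \<longrightarrow> g e) \<and> real (cut g ?V S) \<le> m \<and> A = big_part K g1 S)"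
  define Cross where "Cross = (\<lambda>g1 g2. \<exists>A B. A \<subseteq> ?V \<and> B \<subseteq> ?V \<and> A \<inter> B = {} \<and> s / 2 \<le> card A \<and> s / 2 \<le> card B \<and>
     cnt (cut_pairs A B) g2 \<le> m \<and> BP g1 A
     \<and> BP g1 B)"
  define gor where "gor = (\<lambda>z x. x \<in> inner_pairs ?V \<and> (fst z x \<or> snd z x))"
  have s0: "s \<ge> 0" using K by linarith
  have "measure_pmf.prob (Gnp n p) {g. sparse_cut_pair n s m g} = measure_pmf.prob N {z. sparse_cut_pair n s m (gor z)}"
    unfolding Gnp_eq_rbits N_def using rbits_sprinkle[OF _ p, of "inner_pairs ?V"]
    by (simp add: vimage_def case_prod_unfold gor_def)
  also have "\<dots> \<le> measure_pmf.prob N {z. ((\<not> cnt (pairs n) (fst z) \<le> M0 \<or> \<not> cnt (pairs n) (snd z) \<le> \<eta> * n) \<or>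
      s / 8 \<le> mid_mass K0 K ?V (fst z)) \<or> (cnt (pairs n) (fst z) \<le> M0 \<and> Cross (fst z) (snd z))}"
  proof (rule prob_mono_support)
    fix z assume bad: "sparse_cut_pair n s m (gor z)"
    obtain g1 g2 where z: "z = (g1, g2)" by (cases z)
    define g where "g = gor z"
    have g: "g e \<longleftrightarrow> g1 e \<or> g2 e" if "e \<in> inner_pairs ?V" for e using that by (simp add: g_def gor_def z)
    obtain S T C D where ST: "S \<inter> T = {}" "s \<le> card S" "s \<le> card T" "iscomp g ?V C" "S \<subseteq> C" "iscomp g ?V D" "T \<subseteq> D"
      "cut g ?V S \<le> m" "cut g ?V T \<le> m"
      using bad unfolding sparse_cut_pair_def g_def by blast
    show "((\<not> cnt (pairs n) (fst z) \<le> M0 \<or> \<not> cnt (pairs n) (snd z) \<le> \<eta> * n) \<or>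
      s / 8 \<le> mid_mass K0 K ?V (fst z)) \<or> (cnt (pairs n) (fst z) \<le> M0 \<and> Cross (fst z) (snd z))"
    proof (rule ccontr)
      assume neg: "\<not> ?thesis"
      then have e2: "cnt (pairs n) g2 \<le> \<eta> * n" and mid: "mid_mass K0 K ?V g1 < s / 8" and nc: "\<not> Cross g1 g2"
        by (auto simp: z)
      have big: "s / 2 \<le> card (big_part K g1 S)" if S: "s \<le> card S" "iscomp g ?V C" "S \<subseteq> C" "cut g ?V S \<le> m" for S C
      proof -
        have SV: "S \<subseteq> ?V" "finite S" "finite C" using S finite_subset[of S ?V] finite_subset[of C ?V] by (auto simp: iscomp_def)
        \<comment> \<open>A component of g inside S equals C, which contains S and so has at least s
          \<ge> K vertices.\<close>
        have nocomp: "K \<le> card Q" if Q: "iscomp g ?V Q" "Q \<subseteq> S" for Q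
        proof -
          have "Q \<noteq> {}" using Q by (auto simp: iscomp_def conn_def)
          then have "Q = C" using iscomp_disjoint[OF Q(1) S(2)] Q S by auto
          then have "card S \<le> card Q" using S SV by (intro card_mono) auto
          then show ?thesis using K S(1) by linarith
        qed
        have "card (S - big_part K g1 S) \<le> 2 * K0 * cnt (inner_pairs ?V) g2 + 2 * K * cut g ?V S + mid_mass K0 K ?V g1"
          unfolding mid_mass_def by (rule small_part_bound[OF _ SV(1) g K(1) nocomp]) auto
        then have "real (card (S - big_part K g1 S)) \<le> real (2 * K0 * cnt (inner_pairs ?V) g2 + 2 * K * cut g ?V S + mid_mass K0 K ?V g1)"
          by (simp only: of_nat_le_iff)
        also have "\<dots> = 2 * real K0 * cnt (inner_pairs ?V) g2 + 2 * real K * cut g ?V S + mid_mass K0 K ?V g1" by simp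
        also have "\<dots> \<le> 2 * real K0 * (\<eta> * n) + 2 * real K * m + s / 8"
          using e2 mid S by (intro add_mono mult_left_mono) (auto simp: pairs_eq)
        also have "\<dots> \<le> s / 2" by (rule budget)
        finally have "real (card (S - big_part K g1 S)) \<le> s / 2" .
        moreover have "card (S - big_part K g1 S) = card S - card (big_part K g1 S)" "card (big_part K g1 S) \<le> card S"
          using SV by (auto simp: card_Diff_subset[OF finite_subset[OF big_part_subset] big_part_subset] intro!: card_mono big_part_subset)
        ultimately show ?thesis using S(1) by (simp add: of_nat_diff)
      qed
      have sub: "S \<subseteq> ?V" "T \<subseteq> ?V" using ST by (auto simp: iscomp_def)
      let ?A = "big_part K g1 S" and ?B = "big_part K g1 T"
      have AB: "?A \<subseteq> ?V" "?B \<subseteq> ?V" "?A \<inter> ?B = {}" using sub ST big_part_subset[of K g1] by blast+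
      \<comment> \<open>S and T are disjoint, so an edge between the two large parts is a boundary
        edge of S and is counted in its cut.\<close>
      have "cut_pairs ?A ?B \<subseteq> cut_pairs S (?V - S)"
        using AB ST big_part_subset[of K g1 S] big_part_subset[of K g1 T] sub by (intro cut_pairs_mono) auto
      moreover have "cut_pairs S (?V - S) \<subseteq> inner_pairs ?V" using sub by (intro cut_pairs_subset_inner) auto
      ultimately have "{e\<in>cut_pairs ?A ?B. g2 e} \<subseteq> {e\<in>cut_pairs S (?V - S). g e}" using g by blast
      then have "cnt (cut_pairs ?A ?B) g2 \<le> cut g ?V S"
        unfolding cnt_def using sub finite_subset[OF sub(1)] by (intro card_mono) auto
      then have few: "cnt (cut_pairs ?A ?B) g2 \<le> m" using ST(8) by linarith
      have "Cross g1 g2"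
        unfolding Cross_def
      proof (rule exI[of _ ?A], rule exI[of _ ?B], intro conjI)
        show "BP g1 ?A"
          unfolding BP_def using sub(1) g ST(8) by (intro exI[of _ g] exI[of _ S]) auto
        show "BP g1 ?B"
          unfolding BP_def using sub(2) g ST(9) by (intro exI[of _ g] exI[of _ T]) auto
      qed (use few AB big[OF ST(2,4,5,8)] big[OF ST(3,6,7,9)] in auto)
      then show False using nc by simp
    qed
  qed
  also have "\<dots> \<le> measure_pmf.prob N {z. \<not> cnt (pairs n) (fst z) \<le> M0} + measure_pmf.prob N {z. \<not> cnt (pairs n) (snd z) \<le> \<eta> * n} +
      measure_pmf.prob N {z. s / 8 \<le> mid_mass K0 K ?V (fst z)} + measure_pmf.prob N {z. cnt (pairs n) (fst z) \<le> M0 \<and> Cross (fst z) (snd z)}"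
    by (rule prob_disj4_le)
  also have "measure_pmf.prob N {z. \<not> cnt (pairs n) (fst z) \<le> M0} = measure_pmf.prob (Gnp n p1) {g. \<not> cnt (pairs n) g \<le> M0}"
    unfolding N_def using prob_pair_pmf[of "Gnp n p1" "Gnp n p2" "\<lambda>g. \<not> cnt (pairs n) g \<le> M0" "\<lambda>_. True"] by simp
  also have "measure_pmf.prob N {z. \<not> cnt (pairs n) (snd z) \<le> \<eta> * n} = measure_pmf.prob (Gnp n p2) {g. \<not> cnt (pairs n) g \<le> \<eta> * n}"
    unfolding N_def using prob_pair_pmf[of "Gnp n p1" "Gnp n p2" "\<lambda>_. True" "\<lambda>g. \<not> cnt (pairs n) g \<le> \<eta> * n"] by simp
  also have "measure_pmf.prob N {z. s / 8 \<le> mid_mass K0 K ?V (fst z)} = measure_pmf.prob (Gnp n p1) {g. s / 8 \<le> mid_mass K0 K ?V g}"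
    unfolding N_def using prob_pair_pmf[of "Gnp n p1" "Gnp n p2" "\<lambda>g. s / 8 \<le> mid_mass K0 K ?V g" "\<lambda>_. True"] by simp
  also have "measure_pmf.prob N {z. cnt (pairs n) (fst z) \<le> M0 \<and> Cross (fst z) (snd z)} \<le> ?X\<^sup>2 * exp (m - p2 / 2 * (s / 2)\<^sup>2)"
    unfolding N_def
  proof (rule prob_pair_conditional)
    fix g1 assume M: "cnt (pairs n) g1 \<le> M0"
    obtain \<A> where \<A>: "finite \<A>" "real (card \<A>) \<le> ?X"
      "\<And>S g. S \<subseteq> ?V \<Longrightarrow> (\<And>e. e \<in> inner_pairs ?V \<Longrightarrow> g1 e \<Longrightarrow> g e) \<Longrightarrow> cut g ?V S \<le> m \<Longrightarrow> big_part K g1 S \<in> \<A>"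
      using big_part_family[of ?V K y g1 M0 m] K y m M by (auto simp: pairs_eq)
    have "measure_pmf.prob (Gnp n p2) {g2. Cross g1 g2} \<le> measure_pmf.prob (Gnp n p2) {g2. \<exists>A\<in>\<A>. \<exists>B\<in>\<A>. A \<subseteq> ?V \<and> B \<subseteq> ?V \<and> A \<inter> B = {} \<and>
        s / 2 \<le> card A \<and> s / 2 \<le> card B \<and> cnt (cut_pairs A B) g2 \<le> m}"
    proof (rule prob_mono_support)
      fix g2 assume "Cross g1 g2"
      then obtain A B where AB: "A \<subseteq> ?V" "B \<subseteq> ?V" "A \<inter> B = {}" "s / 2 \<le> card A" "s / 2 \<le> card B" "cnt (cut_pairs A B) g2 \<le> m"
        and A: "BP g1 A" and B: "BP g1 B"
        unfolding Cross_def by blast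
      have mem: "X \<in> \<A>" if X: "BP g1 X" for X
      proof -
        obtain g S where gS: "S \<subseteq> ?V" "\<forall>e\<in>inner_pairs ?V. g1 e \<longrightarrow> g e" "cut g ?V S \<le> m" "X = big_part K g1 S"
          using X unfolding BP_def by (elim exE conjE)
        show ?thesis unfolding gS(4) using gS(2) by (intro \<A>(3)[OF gS(1) _ gS(3)]) auto
      qed
      show "\<exists>A\<in>\<A>. \<exists>B\<in>\<A>. A \<subseteq> ?V \<and> B \<subseteq> ?V \<and> A \<inter> B = {} \<and>
        s / 2 \<le> card A \<and> s / 2 \<le> card B \<and> cnt (cut_pairs A B) g2 \<le> m"
        using mem[OF A] mem[OF B] AB by (intro bexI[of _ A] bexI[of _ B] conjI)
    qed
    also have "\<dots> \<le> ?X\<^sup>2 * exp (m - p2 / 2 * (s / 2)\<^sup>2)"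
      unfolding Gnp_eq_rbits using p \<A> s0 by (intro few_cross_edges_prob) auto
    finally show "measure_pmf.prob (Gnp n p2) {g2. Cross g1 g2} \<le> ?X\<^sup>2 * exp (m - p2 / 2 * (s / 2)\<^sup>2)" .
  qed simp
  finally show ?thesis by simp
qed

text \<open>Markov's inequality. A component is a connected set with empty cut, so
  \<open>sparse_connected_sets\<close> bounds each size class by n exp(-(c / 2) K0); at most K
  sizes, each weighted by at most K, give the square of K.\<close>

lemma mid_mass_prob:
  fixes p c s :: real
  assumes p: "0 < p" "p \<le> 1 / 4" "1 \<le> p * n" "4 * p * real K \<le> 1" and c: "0 < c" "c < 1" "ln (p * n) + 1 - p * n \<le> - c * (p * n)" "28 * real K \<le> c * n"
    and K0: "1 \<le> K0" and s: "s > 0"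
  shows "measure_pmf.prob (Gnp n p) {g. s \<le> mid_mass K0 K {1..n} g} \<le> (real K)\<^sup>2 * n * exp (- (c / 2) * K0) / s"
proof -
  let ?V = "{1..n}"
  let ?I = "{Q. Q \<subseteq> ?V \<and> K0 \<le> card Q \<and> card Q < K}"
  have finI: "finite ?I" by (auto intro: finite_subset[of _ "Pow ?V"])
  have mid: "real (mid_mass K0 K ?V g) = (\<Sum>Q\<in>?I. real (card Q) * of_bool (iscomp g ?V Q))" for g
    unfolding mid_mass_def of_nat_sum
    using finI by (intro sum.mono_neutral_cong_left) auto
  have "measure_pmf.prob (Gnp n p) {g. s \<le> mid_mass K0 K ?V g} \<le> measure_pmf.expectation (Gnp n p) (\<lambda>g. real (mid_mass K0 K ?V g)) / s"
    using s by (intro pmf_Markov) (auto simp: Gnp_eq_rbits)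
  also have "measure_pmf.expectation (Gnp n p) (\<lambda>g. real (mid_mass K0 K ?V g)) = (\<Sum>Q\<in>?I. real (card Q) * measure_pmf.prob (Gnp n p) {g. iscomp g ?V Q})"
    unfolding mid using finI by (intro expectation_weighted_count) (auto simp: Gnp_eq_rbits)
  also have "\<dots> = (\<Sum>k\<in>{K0..<K}. \<Sum>Q\<in>{Q\<in>?I. card Q = k}. real (card Q) * measure_pmf.prob (Gnp n p) {g. iscomp g ?V Q})"
    using finI by (intro sum.group[symmetric]) auto
  also have "\<dots> \<le> (\<Sum>k\<in>{K0..<K}. real K * (n * exp (- (c / 2) * K0)))"
  proof (rule sum_mono)
    fix k assume k: "k \<in> {K0..<K}"
    define a where "a = c / (8 * ln (8 / c))"
    have a: "a \<ge> 0" using c by (auto simp: a_def)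
    have "{Q\<in>?I. card Q = k} = {Q. Q \<subseteq> ?V \<and> card Q = k}" using k by auto
    then have "(\<Sum>Q\<in>{Q\<in>?I. card Q = k}. real (card Q) * measure_pmf.prob (Gnp n p) {g. iscomp g ?V Q}) =
       real k * (\<Sum>Q | Q \<subseteq> ?V \<and> card Q = k. measure_pmf.prob (Gnp n p) {g. iscomp g ?V Q})"
      by (simp add: sum_distrib_left)
    also have "\<dots> \<le> real K * (n * exp (- (c / 2) * (p * n * k)))"
    proof (rule mult_mono)
      have "(\<Sum>Q | Q \<subseteq> ?V \<and> card Q = k. measure_pmf.prob (Gnp n p) {g. iscomp g ?V Q}) \<le>
        (\<Sum>S | S \<subseteq> ?V \<and> card S = k. measure_pmf.prob (rbits (inner_pairs ?V) p) {g. conn g S \<and> real (cut g ?V S) \<le> a * (p * n * k)})"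
        unfolding Gnp_eq_rbits using a p by (intro sum_mono prob_mono_support) (auto simp: iscomp_iff_cut)
      also have "\<dots> \<le> n * exp (- (c / 2) * (p * n * k))"
      proof -
        have "4 * p * real k \<le> 4 * p * real K" using k p by (intro mult_left_mono) auto
        have "28 * real k \<le> 28 * real K" using k by simp
        then have "4 * p * real k \<le> 1" "28 * real k \<le> c * n" using \<open>4 * p * real k \<le> _\<close> p c by linarith+
        then show ?thesis using p c k K0 by (intro sparse_connected_sets) (auto simp: a_def)
      qed
      finally show "(\<Sum>Q | Q \<subseteq> ?V \<and> card Q = k. measure_pmf.prob (Gnp n p) {g. iscomp g ?V Q}) \<le> n * exp (- (c / 2) * (p * n * k))" .
    qed (use k in \<open>auto intro: sum_nonneg\<close>)
    also have "\<dots> \<le> real K * (n * exp (- (c / 2) * K0))"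
    proof -
      have "1 * real K0 \<le> p * n * k" using p k by (intro mult_mono) auto
      then have "c / 2 * real K0 \<le> c / 2 * (p * n * k)" using c by (intro mult_left_mono) auto
      then show ?thesis by (intro mult_left_mono) auto
    qed
    finally show "(\<Sum>Q\<in>{Q\<in>?I. card Q = k}. real (card Q) * measure_pmf.prob (Gnp n p) {g. iscomp g ?V Q}) \<le> real K * (n * exp (- (c / 2) * K0))" .
  qed
  also have "\<dots> = real (K - K0) * (real K * (n * exp (- (c / 2) * K0)))" by simp
  also have "\<dots> \<le> real K * (real K * (n * exp (- (c / 2) * K0)))" by (intro mult_right_mono) auto
  also have "\<dots> = (real K)\<^sup>2 * n * exp (- (c / 2) * K0)" by (simp add: power2_eq_square)
  finally show ?thesis using s by (simp add: divide_right_mono)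
qed

text \<open>With L = ln n the choices are K of order L, K0 of order sqrt L and y = 1 / L. The
  entropy is O(n ln L / L), while missing the cross edges costs \<delta>^3 n / (256 sqrt L). A
  larger K0 would need fewer sprinkled edges, and a smaller one would not make exp(-c K0 / 2) absorb
  the factor L^2; sqrt L is a convenient value between.\<close>

lemma whp_no_sparse_cut_pair:
  fixes \<epsilon> D \<delta> :: real
  assumes \<epsilon>: "\<epsilon> > 0" and D: "D \<ge> 1" and \<delta>: "0 < \<delta>" "\<delta> \<le> 1"
  shows "whp (\<lambda>n p. 1 + \<epsilon> \<le> p * n \<and> p * n \<le> D) (\<lambda>n p g. \<not> sparse_cut_pair n (\<delta> * n) (\<delta> / 32 * (n / ln n)) g)"
proof -
  \<comment> \<open>The first round loses at most \<eta> \<le> \<epsilon> / 2 of the average degree,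
    hence the decay rate is taken at 1 + \<epsilon> / 2.\<close>
  obtain c where c: "0 < c" "c < 1" "\<And>x. x \<ge> 1 + \<epsilon> / 2 \<Longrightarrow> ln x + 1 - x \<le> - c * x"
    using ex_decay_rate[of "\<epsilon> / 2"] \<epsilon> by auto
  \<comment> \<open>The constants 32 in \<eta> and in m make each of the first two terms of the
    budget at most \<delta> n / 8; with the middle-sized components this is 3 \<delta> n / 8, below
    the permitted half.\<close>
  define \<eta> where "\<eta> = (\<lambda>n. \<delta> / (32 * sqrt (ln (real n))))"
  define m where "m = (\<lambda>n. \<delta> / 32 * (real n / ln (real n)))"
  define f where "f = (\<lambda>n. exp (- real n / 8) + exp (- \<eta> n * n / 8) + 8 / \<delta> * (4 * (ln (real n))\<^sup>2 * exp (- (c / 2) * sqrt (ln (real n)))) +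
     exp (2 * (m n * ln (ln (real n)) + D * (n / ln n) + n / ln n * ln (ln (real n)) + n / ln n) + m n - \<delta> ^ 3 / 256 * (n / sqrt (ln n))))"
  show ?thesis
  proof (rule whpI)
    have 1: "(\<lambda>n. exp (- real n / 8)) \<longlonglongrightarrow> 0" by real_asymp
    have 2: "(\<lambda>n. exp (- \<eta> n * n / 8)) \<longlonglongrightarrow> 0" unfolding \<eta>_def using \<delta> by real_asymp
    have 3: "(\<lambda>n. 8 / \<delta> * (4 * (ln (real n))\<^sup>2 * exp (- (c / 2) * sqrt (ln (real n))))) \<longlonglongrightarrow> 0" using c \<delta> by real_asymp
    have 4: "(\<lambda>n. exp (2 * (m n * ln (ln (real n)) + D * (n / ln n) + n / ln n * ln (ln (real n)) + n / ln n) + m n - \<delta> ^ 3 / 256 * (n / sqrt (ln n)))) \<longlonglongrightarrow> 0"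
      unfolding m_def using \<delta> D by real_asymp
    show "f \<longlonglongrightarrow> 0" unfolding f_def using tendsto_add[OF tendsto_add[OF tendsto_add[OF 1 2] 3] 4] by simp
    have "\<forall>\<^sub>F n in sequentially. ln (real n) \<ge> 1" by real_asymp
    moreover have "\<forall>\<^sub>F n in sequentially. \<eta> n \<le> \<epsilon> / 2" unfolding \<eta>_def using \<epsilon> \<delta> by real_asymp
    moreover have "\<forall>\<^sub>F n in sequentially. 2 * ln (real n) \<le> \<delta> * n" using \<delta> by real_asymp
    moreover have "\<forall>\<^sub>F n in sequentially. 28 * (2 * ln (real n)) \<le> c * n" using c by real_asymp
    moreover have "\<forall>\<^sub>F n in sequentially. 4 * D * (2 * ln (real n)) \<le> n" using D by real_asymp
    ultimately show "\<forall>\<^sub>F n in sequentially. \<forall>p :: real. 0 \<le> p \<longrightarrow> p \<le> 1 \<longrightarrow> 1 + \<epsilon> \<le> p * n \<and> p * n \<le> D \<longrightarrow>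
       measure_pmf.prob (Gnp n p) {g. \<not> \<not> sparse_cut_pair n (\<delta> * n) (\<delta> / 32 * (n / ln n)) g} \<le> f n"
    proof (eventually_elim, intro allI impI)
      fix n and p :: real
      assume n: "ln (real n) \<ge> 1" "\<eta> n \<le> \<epsilon> / 2" "2 * ln (real n) \<le> \<delta> * n" "28 * (2 * ln (real n)) \<le> c * n" "4 * D * (2 * ln (real n)) \<le> n"
        and p: "0 \<le> p" "p \<le> 1" "1 + \<epsilon> \<le> p * real n \<and> p * real n \<le> D"
      define L where "L = ln (real n)"
      define K where "K = nat \<lceil>L\<rceil>"
      define K0 where "K0 = nat \<lceil>sqrt L\<rceil>"
      define p2 where "p2 = \<eta> n / n"
      define p1 where "p1 = (p - p2) / (1 - p2)"
      have L: "L \<ge> 1" using n by (simp add: L_def)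
      have sL: "sqrt L \<ge> 1" using L by simp
      have npos: "real n > 0" using n by (cases n) auto
      have n2: "real n \<ge> 8" using n(5) D L mult_mono[of 1 D 8 "8 * L"] by (simp add: L_def)
      have K: "L \<le> K" "real K \<le> 2 * L" "K \<ge> 1" using L by (auto simp: K_def) linarith+
      have K0: "sqrt L \<le> K0" "real K0 \<le> 2 * sqrt L" "K0 \<ge> 1" unfolding K0_def using sL by linarith+
      have K0K: "K0 \<le> K"
      proof -
        have "sqrt L \<le> sqrt (L\<^sup>2)" using L by (intro real_sqrt_le_mono) (simp add: power2_eq_square)
        then show ?thesis using L unfolding K_def K0_def by (intro nat_mono ceiling_mono) simp
      qed
      have \<eta>: "0 < \<eta> n" "\<eta> n \<le> 1 / 32"
      proof -
        show "0 < \<eta> n" using \<delta> L by (simp add: \<eta>_def L_def[symmetric])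
        have "\<delta> \<le> sqrt L" using \<delta> sL by linarith
        then show "\<eta> n \<le> 1 / 32" using sL by (simp add: \<eta>_def L_def[symmetric] field_simps)
      qed
      have p2: "0 < p2" "p2 \<le> 1 / 2" "p2 * n = \<eta> n" using \<eta> npos n2 by (auto simp: p2_def field_simps)
      have "p2 * n \<le> p * n" using p2 \<eta> p \<epsilon> by linarith
      then have p2p: "p2 \<le> p" using npos by simp
      have p1: "0 \<le> p1" "p1 \<le> p" "p = p1 + p2 - p1 * p2"
      proof -
        show "0 \<le> p1" using p2 p2p by (simp add: p1_def)
        have "p * p2 \<le> 1 * p2" using p p2 by (intro mult_right_mono) auto
        then show "p1 \<le> p" using p2 by (simp add: p1_def divide_le_eq algebra_simps)
        have "p1 * (1 - p2) = p - p2" using p2 by (simp add: p1_def)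
        then show "p = p1 + p2 - p1 * p2" by (simp add: algebra_simps)
      qed
      have p1n: "1 + \<epsilon> / 2 \<le> p1 * n" "p1 * n \<le> D"
      proof -
        have "p - p2 \<le> p1"
        proof -
          have "p1 * p2 \<ge> 0" using p1 p2 by simp
          then show ?thesis using p1 by linarith
        qed
        then have "(p - p2) * n \<le> p1 * n" by (intro mult_right_mono) auto
        then show "1 + \<epsilon> / 2 \<le> p1 * n" using p p2 n(2) by (simp add: algebra_simps)
        have "p1 * n \<le> p * n" using p1 by (intro mult_right_mono) auto
        then show "p1 * n \<le> D" using p by linarith
      qed
      have p1K: "4 * p1 * K \<le> 1"
      proof -
        have "4 * p1 * K * n = 4 * (p1 * n) * K" by simp
        also have "\<dots> \<le> 4 * D * (2 * L)" using p1n K D p1 by (intro mult_mono) auto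
        also have "\<dots> \<le> 1 * n" using n by (simp add: L_def)
        finally show ?thesis using npos by simp
      qed
      have p14: "p1 \<le> 1 / 4"
      proof -
        have "4 * p1 * 1 \<le> 4 * p1 * K" using p1 K by (intro mult_left_mono) auto
        then show ?thesis using p1K by simp
      qed
      have p1pos: "p1 > 0" using p1n \<epsilon> p1(1) by (cases "p1 = 0") auto
      have m0: "m n \<ge> 0" using \<delta> L by (simp add: m_def L_def[symmetric])
      have "measure_pmf.prob (Gnp n p) {g. sparse_cut_pair n (\<delta> * n) (m n) g} \<le>
         measure_pmf.prob (Gnp n p1) {g. \<not> cnt (pairs n) g \<le> D * n} + measure_pmf.prob (Gnp n p2) {g. \<not> cnt (pairs n) g \<le> \<eta> n * n} +
         measure_pmf.prob (Gnp n p1) {g. \<delta> * n / 8 \<le> mid_mass K0 K {1..n} g} +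
         (exp (m n * ln (1 / (1 / L)) + 1 / L * (D * n) + n / K * ln (1 / (1 / L)) + 1 / L * n))\<^sup>2 * exp (m n - p2 / 2 * (\<delta> * n / 2)\<^sup>2)"
      proof (rule sparse_cut_pair_prob)
        show "2 * real K0 * (\<eta> n * n) + 2 * real K * m n + \<delta> * n / 8 \<le> \<delta> * n / 2"
        proof -
          have "2 * real K0 * (\<eta> n * n) \<le> 2 * (2 * sqrt L) * (\<eta> n * n)" using K0 \<eta> by (intro mult_right_mono mult_left_mono) auto
          also have "\<dots> = \<delta> * n / 8" using sL by (simp add: \<eta>_def L_def[symmetric] field_simps)
          finally have 1: "2 * real K0 * (\<eta> n * n) \<le> \<delta> * n / 8" .
          have "2 * real K * m n \<le> 2 * (2 * L) * m n" using K m0 by (intro mult_right_mono mult_left_mono) auto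
          also have "\<dots> = \<delta> * n / 8" using L by (simp add: m_def L_def[symmetric] field_simps)
          finally have "2 * real K * m n \<le> \<delta> * n / 8" .
          moreover have "0 \<le> \<delta> * n" using \<delta> by simp
          ultimately show ?thesis using 1 by linarith
        qed
        show "real K \<le> \<delta> * n" using K n by (simp add: L_def)
      qed (use p1 p p2 K K0K L m0 D in auto)
      also have "measure_pmf.prob (Gnp n p1) {g. \<not> cnt (pairs n) g \<le> D * n} \<le> exp (- D * n / 8)"
        using p1 p p1n D by (intro edge_count_bound) auto
      also have "exp (- D * n / 8) \<le> exp (- real n / 8)" using mult_right_mono[OF D, of "real n"] by simp
      also have "measure_pmf.prob (Gnp n p2) {g. \<not> cnt (pairs n) g \<le> \<eta> n * n} \<le> exp (- \<eta> n * n / 8)"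
        using p2 \<eta> by (intro edge_count_bound) auto
      also have "measure_pmf.prob (Gnp n p1) {g. \<delta> * n / 8 \<le> mid_mass K0 K {1..n} g} \<le> 8 / \<delta> * (4 * L\<^sup>2 * exp (- (c / 2) * sqrt L))"
      proof -
        have "measure_pmf.prob (Gnp n p1) {g. \<delta> * n / 8 \<le> mid_mass K0 K {1..n} g} \<le> (real K)\<^sup>2 * n * exp (- (c / 2) * K0) / (\<delta> * n / 8)"
        proof (rule mid_mass_prob[OF p1pos p14 _ p1K c(1,2)])
          show "ln (p1 * n) + 1 - p1 * n \<le> - c * (p1 * n)" by (rule c(3)[OF p1n(1)])
          show "28 * real K \<le> c * n" using K n by (simp add: L_def)
        qed (use p1n \<epsilon> K0 \<delta> npos in auto)
        also have "\<dots> \<le> (2 * L)\<^sup>2 * n * exp (- (c / 2) * sqrt L) / (\<delta> * n / 8)"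
          using K K0 c \<delta> L by (intro divide_right_mono mult_mono power_mono) auto
        also have "\<dots> = 8 / \<delta> * (4 * L\<^sup>2 * exp (- (c / 2) * sqrt L))"
          using npos \<delta> by (simp add: power2_eq_square field_simps)
        finally show ?thesis .
      qed
      also have "(exp (m n * ln (1 / (1 / L)) + 1 / L * (D * n) + n / K * ln (1 / (1 / L)) + 1 / L * n))\<^sup>2 * exp (m n - p2 / 2 * (\<delta> * n / 2)\<^sup>2)
         \<le> exp (2 * (m n * ln L + D * (n / L) + n / L * ln L + n / L) + m n - \<delta> ^ 3 / 256 * (n / sqrt L))"
      proof -
        have le: "n / K * ln L \<le> n / L * ln L" using K L by (intro mult_right_mono divide_left_mono) auto
        have aux: "2 * (x + y + a + z) + (w - v) \<le> 2 * (x + y + b + z) + w - v" if "a \<le> b" for a b v w x y z :: real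
          using that by simp
        have "p2 / 2 * (\<delta> * n / 2)\<^sup>2 = \<delta> ^ 3 / 256 * (n / sqrt L)"
          using npos sL by (simp add: p2_def \<eta>_def L_def[symmetric] power2_eq_square power3_eq_cube field_simps)
        moreover have "(exp u)\<^sup>2 * exp v = exp (2 * u + v)" for u v :: real
          by (simp add: exp_add[symmetric] power2_eq_square)
        moreover have "1 / L * (D * n) = D * (n / L)" "1 / L * n = n / L" by auto
        ultimately show ?thesis using L by (simp only: exp_le_cancel_iff div_by_1 divide_divide_eq_right mult_1) (rule aux[OF le])
      qed
      finally show "measure_pmf.prob (Gnp n p) {g. \<not> \<not> sparse_cut_pair n (\<delta> * n) (\<delta> / 32 * (n / ln n)) g} \<le> f n"
        unfolding f_def L_def m_def by simp
    qed
  qed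
qed

section \<open>The giant component\<close>

abbreviation has_component :: "real \<Rightarrow> nat \<Rightarrow> (nat \<times> nat \<Rightarrow> bool) \<Rightarrow> bool" where
  "has_component s n g \<equiv> \<exists>Q. iscomp g {1..n} Q \<and> s \<le> real (card Q)"

abbreviation unique_component :: "real \<Rightarrow> nat \<Rightarrow> (nat \<times> nat \<Rightarrow> bool) \<Rightarrow> bool" where
  "unique_component s n g \<equiv> \<forall>C C'. iscomp g {1..n} C \<longrightarrow> iscomp g {1..n} C' \<longrightarrow> s \<le> real (card C) \<longrightarrow> s \<le> real (card C') \<longrightarrow> C = C'"

text \<open>Distinct components are disjoint. For disjoint S and T the two boundaries share exactly
  the |S| |T| pairs between the sets, whose absence is paid for once instead of twice; this gains (1
  - p)^(-|S| |T|), at most exp(2 p K^2).\<close>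

lemma prob_two_iscomp:
  assumes V: "finite V" and p: "0 \<le> p" "p \<le> 1 / 2" and S: "S \<subseteq> V" "card S \<le> K" and T: "T \<subseteq> V" "card T \<le> K" and ST: "S \<noteq> T"
  shows "measure_pmf.prob (rbits (inner_pairs V) p) {g. iscomp g V S \<and> iscomp g V T} \<le>
    exp (2 * p * (real K)\<^sup>2) * (measure_pmf.prob (rbits (inner_pairs V) p) {g. iscomp g V S} * measure_pmf.prob (rbits (inner_pairs V) p) {g. iscomp g V T})"
proof (cases "S \<inter> T = {}")
  case False
  then have "{g. iscomp g V S \<and> iscomp g V T} = {}" using iscomp_disjoint ST by blast
  then show ?thesis by (simp only: measure_empty) (intro mult_nonneg_nonneg; simp)
next
  case True
  let ?M = "rbits (inner_pairs V) p"
  let ?a = "card S * (card V - card S)" and ?b = "card T * (card V - card T)"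
  define E where "E = cut_pairs S (V - S) \<union> cut_pairs T (V - T)"
  have fin: "finite S" "finite T" using V S T finite_subset by auto
  have finE: "finite E" using V fin by (simp add: E_def)
  have subE: "E \<subseteq> inner_pairs V" unfolding E_def using S T by (intro Un_least cut_pairs_subset_inner) auto
  have cST: "cut_pairs S (V - S) \<inter> cut_pairs T (V - T) = cut_pairs S T"
    using S T True by (auto simp: cut_pairs_def)
  have cardE: "card E + card S * card T = ?a + ?b"
    using card_Un_Int[of "cut_pairs S (V - S)" "cut_pairs T (V - T)"] V fin S T True
    by (simp only: E_def cST card_cut_pairs card_cut_pairs_compl finite_cut_pairs finite_Diff simp_thms)
  have "measure_pmf.prob ?M {g. iscomp g V S \<and> iscomp g V T} \<le> measure_pmf.prob ?M {g. conn g S \<and> conn g T \<and> cnt E g = 0}"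
  proof (rule prob_mono_support)
    fix g assume "iscomp g V S \<and> iscomp g V T"
    then have "conn g S" "conn g T" "cut g V S = 0" "cut g V T = 0" using iscomp_iff_cut[OF V] S T by auto
    moreover have "cnt E g = 0"
    proof -
      have "\<not> g e" if "e \<in> E" for e
        using that calculation(3,4) V fin by (cases e) (auto simp: E_def cnt_def)
      then have "{x \<in> E. g x} = {}" by blast
      then show ?thesis by (simp only: cnt_def card.empty)
    qed
    ultimately show "conn g S \<and> conn g T \<and> cnt E g = 0" by simp
  qed
  also have "\<dots> = measure_pmf.prob ?M {g. conn g S} * measure_pmf.prob ?M {g. conn g T \<and> cnt E g = 0}"
  proof (rule rbits_indep)
    show "inner_pairs S \<inter> (inner_pairs T \<union> E) = {}"
      using True by (auto simp: E_def inner_pairs_def cut_pairs_def)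
    show "inner_pairs T \<union> E \<subseteq> inner_pairs V" using subE inner_pairs_mono[OF T(1)] by blast
  qed (use V in \<open>auto intro: conn_depends depends_only_on_conj depends_only_on_cnt inner_pairs_mono[OF S(1), THEN subsetD]\<close>)
  also have "measure_pmf.prob ?M {g. conn g T \<and> cnt E g = 0} = measure_pmf.prob ?M {g. conn g T} * measure_pmf.prob ?M {g. cnt E g = 0}"
  proof (rule rbits_indep)
    show "inner_pairs T \<inter> E = {}" using True by (auto simp: E_def inner_pairs_def cut_pairs_def)
  qed (use V subE in \<open>auto intro: conn_depends depends_only_on_cnt inner_pairs_mono[OF T(1), THEN subsetD]\<close>)
  also have "measure_pmf.prob ?M {g. conn g S} = pconn p S"
    unfolding pconn_def using V S by (intro rbits_restrict conn_depends inner_pairs_mono) auto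
  also have "measure_pmf.prob ?M {g. conn g T} = pconn p T"
    unfolding pconn_def using V T by (intro rbits_restrict conn_depends inner_pairs_mono) auto
  also have "measure_pmf.prob ?M {g. cnt E g = 0} = (1 - p) ^ card E"
    using V p subE by (intro rbits_no_bits) auto
  also have "(1 - p) ^ card E \<le> exp (2 * p * (real K)\<^sup>2) * ((1 - p) ^ ?a * (1 - p) ^ ?b)"
  proof -
    have "exp (- 2 * p) ^ (card S * card T) \<le> (1 - p) ^ (card S * card T)"
      using p by (intro power_mono exp_le_one_minus) auto
    moreover have "exp (- (2 * p * (real K)\<^sup>2)) \<le> exp (- 2 * p) ^ (card S * card T)"
    proof -
      have "p * (real (card S) * real (card T)) \<le> p * (real K * real K)"
        using S T p by (intro mult_left_mono mult_mono) auto
      then show ?thesis by (simp add: exp_of_nat_mult[symmetric] power2_eq_square algebra_simps)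
    qed
    ultimately have "(1 - p) ^ card E * exp (- (2 * p * (real K)\<^sup>2)) \<le> (1 - p) ^ card E * (1 - p) ^ (card S * card T)"
      using p by (intro mult_left_mono) auto
    also have "\<dots> = (1 - p) ^ ?a * (1 - p) ^ ?b" by (simp only: power_add[symmetric] cardE)
    finally have "(1 - p) ^ card E * exp (- (2 * p * (real K)\<^sup>2)) * exp (2 * p * (real K)\<^sup>2) \<le>
       ((1 - p) ^ ?a * (1 - p) ^ ?b) * exp (2 * p * (real K)\<^sup>2)" by (intro mult_right_mono) auto
    then show ?thesis by (simp add: mult.assoc exp_add[symmetric] mult_ac)
  qed
  finally have "measure_pmf.prob ?M {g. iscomp g V S \<and> iscomp g V T} \<le>
      pconn p S * (pconn p T * (exp (2 * p * (real K)\<^sup>2) * ((1 - p) ^ ?a * (1 - p) ^ ?b)))"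
    by (simp add: mult_left_mono)
  then show ?thesis using prob_iscomp[OF V S(1), of p] prob_iscomp[OF V T(1), of p] p by (simp add: mult_ac)
qed

text \<open>The mass formula for connected sets totals at most 1 / p, and the empty boundary
  contributes (d exp(1 - d))^k relative to its weights. This base is at most 1, so its value at k =
  1 serves for all k \<ge> 1, and d / p = n. The constant 7 is 6 from the weights plus 1 from k (n -
  k).\<close>

lemma small_component_mass:
  fixes p :: real
  assumes V: "finite V" "card V = n" and p: "0 < p" "p \<le> 1 / 4" "1 \<le> p * n" "4 * p * real K \<le> 1" "K \<le> n"
  shows "(\<Sum>S | S \<subseteq> V \<and> card S \<le> K. real (card S) * measure_pmf.prob (rbits (inner_pairs V) p) {g. iscomp g V S}) \<le>
    n * exp (1 - p * n) * exp (7 * p * (real K)\<^sup>2)"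
proof -
  let ?S = "{S. S \<subseteq> V \<and> card S \<le> K}"
  define d where "d = p * n"
  define w where "w = (\<lambda>k. (d * exp 1) ^ k * exp (6 * p * (real k)\<^sup>2))"
  define B where "B = d * exp (1 - d) * exp (7 * p * (real K)\<^sup>2)"
  have d: "d \<ge> 1" using p by (simp add: d_def)
  have wpos: "w k > 0" for k using d by (simp add: w_def)
  have "(\<Sum>S\<in>?S. real (card S) * measure_pmf.prob (rbits (inner_pairs V) p) {g. iscomp g V S}) \<le>
     (\<Sum>S\<in>?S. (real (card S) * pconn p S / w (card S)) * B)"
  proof (rule sum_mono)
    fix S assume S: "S \<in> ?S"
    define k where "k = card S"
    show "real (card S) * measure_pmf.prob (rbits (inner_pairs V) p) {g. iscomp g V S} \<le> (real (card S) * pconn p S / w (card S)) * B"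
    proof (cases "k = 0")
      case False
      have kK: "k \<le> K" using S by (simp add: k_def)
      have "(1 - p) ^ (k * (n - k)) \<le> exp (- p) ^ (k * (n - k))"
        using p exp_ge_add_one_self[of "- p"] by (intro power_mono) auto
      also have "\<dots> = exp (- (p * (real k * (real n - real k))))"
        using kK p by (simp add: exp_of_nat_mult[symmetric] of_nat_diff mult_ac)
      also have "\<dots> = exp (- d * k + p * (real k)\<^sup>2)" by (simp add: d_def power2_eq_square algebra_simps)
      finally have "w k * (1 - p) ^ (k * (n - k)) \<le> w k * exp (- d * k + p * (real k)\<^sup>2)"
        using wpos[of k] by (intro mult_left_mono) auto
      also have "\<dots> = (d * exp (1 - d)) ^ k * exp (7 * p * (real k)\<^sup>2)"
        by (simp add: w_def power_mult_distrib exp_of_nat_mult[symmetric] exp_add[symmetric] mult.assoc)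
          (simp add: exp_add[symmetric] algebra_simps)
      also have "\<dots> \<le> (d * exp (1 - d)) ^ 1 * exp (7 * p * (real K)\<^sup>2)"
      proof (intro mult_mono power_decreasing)
        have "d * exp (1 - d) \<le> exp (d - 1) * exp (1 - d)"
          using exp_ge_add_one_self[of "d - 1"] by (intro mult_right_mono) auto
        then show "d * exp (1 - d) \<le> 1" by (simp add: exp_add[symmetric])
        show "exp (7 * p * (real k)\<^sup>2) \<le> exp (7 * p * (real K)\<^sup>2)" using kK p by (simp add: power_mono)
      qed (use False d in auto)
      finally have "w k * (1 - p) ^ (k * (n - k)) \<le> B" by (simp add: B_def)
      then have "(1 - p) ^ (k * (n - k)) \<le> B / w k" using wpos[of k] by (simp add: le_divide_eq mult.commute)
      then have "real k * pconn p S * (1 - p) ^ (k * (n - k)) \<le> real k * pconn p S * (B / w k)"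
        by (intro mult_left_mono) auto
      then show ?thesis using prob_iscomp[OF V(1), of S p] S p V(2) by (simp add: k_def[symmetric] mult_ac)
    qed (simp add: k_def)
  qed
  also have "\<dots> = (\<Sum>S\<in>?S. real (card S) * pconn p S / w (card S)) * B" by (simp add: sum_distrib_right)
  also have "\<dots> \<le> (1 / p) * B"
    unfolding w_def d_def using d p by (intro mult_right_mono connected_sets_mass V) (auto simp: B_def d_def)
  also have "\<dots> = n * exp (1 - p * n) * exp (7 * p * (real K)\<^sup>2)" using p by (simp add: B_def d_def)
  finally show ?thesis .
qed

text \<open>If all components have at most K vertices, their total mass is n, although its mean is
  at most (1 - \<gamma>) n. Chebyshev's inequality makes this deviation unlikely.\<close>

lemma all_components_small_prob:
  fixes p \<gamma> :: real
  assumes p: "0 < p" "p \<le> 1 / 4" "1 \<le> p * n" "4 * p * real K \<le> 1" "K \<le> n"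
    and \<gamma>: "\<gamma> > 0" "exp (1 - p * n) * exp (7 * p * (real K)\<^sup>2) \<le> 1 - \<gamma>"
  shows "measure_pmf.prob (Gnp n p) {g. \<forall>C. iscomp g {1..n} C \<longrightarrow> card C \<le> K} \<le>
    (K / n + (exp (2 * p * (real K)\<^sup>2) - 1)) / \<gamma>\<^sup>2"
proof -
  let ?V = "{1..n}" and ?M = "rbits (inner_pairs {1..n}) p"
  let ?I = "{S. S \<subseteq> ?V \<and> card S \<le> K}"
  define \<mu> where "\<mu> = (\<Sum>S\<in>?I. real (card S) * measure_pmf.prob ?M {g. iscomp g ?V S})"
  have finI: "finite ?I" by (auto intro: finite_subset[of _ "Pow ?V"])
  have npos: "real n > 0" using p by (cases n) auto
  have \<mu>0: "\<mu> \<ge> 0" by (auto simp: \<mu>_def intro: sum_nonneg)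
  have "\<mu> \<le> n * (exp (1 - p * n) * exp (7 * p * (real K)\<^sup>2))"
    unfolding \<mu>_def using small_component_mass[of ?V n p K] p by (simp add: mult.assoc)
  also have "\<dots> \<le> n * (1 - \<gamma>)" using \<gamma> by (intro mult_left_mono) auto
  finally have \<mu>: "\<mu> \<le> n - \<gamma> * n" by (simp add: algebra_simps)
  have \<mu>n: "\<mu> \<le> n" using \<mu> \<gamma> npos mult_pos_pos[of \<gamma> "real n"] by linarith
  have tot: "(\<Sum>S\<in>?I. real (card S) * of_bool (iscomp g ?V S)) = n" if "\<forall>C. iscomp g ?V C \<longrightarrow> card C \<le> K" for g
  proof -
    have "(\<Sum>S\<in>?I. real (card S) * of_bool (iscomp g ?V S)) = (\<Sum>S | S \<subseteq> ?V \<and> iscomp g ?V S. real (card S))"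
      using that finI by (intro sum.mono_neutral_cong_right) auto
    also have "\<dots> = real (\<Sum>S | S \<subseteq> ?V \<and> iscomp g ?V S. card S)" by simp
    also have "\<dots> = n" using sum_card_iscomp_eq[of ?V g] by simp
    finally show ?thesis .
  qed
  have "measure_pmf.prob (Gnp n p) {g. \<forall>C. iscomp g ?V C \<longrightarrow> card C \<le> K} \<le>
    measure_pmf.prob ?M {g. \<bar>(\<Sum>S\<in>?I. real (card S) * of_bool (iscomp g ?V S)) - \<mu>\<bar> \<ge> \<gamma> * n}"
    unfolding Gnp_eq_rbits
  proof (rule prob_mono_support)
    fix g assume "\<forall>C. iscomp g ?V C \<longrightarrow> card C \<le> K"
    then show "\<gamma> * n \<le> \<bar>(\<Sum>S\<in>?I. real (card S) * of_bool (iscomp g ?V S)) - \<mu>\<bar>" using \<mu> by (subst tot) auto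
  qed
  also have "\<dots> \<le> (K * \<mu> + (exp (2 * p * (real K)\<^sup>2) - 1) * \<mu>\<^sup>2) / (\<gamma> * n)\<^sup>2"
  proof (rule second_moment)
    fix S T assume "S \<in> ?I" "T \<in> ?I" "S \<noteq> T"
    then show "measure_pmf.prob ?M {g. iscomp g ?V S \<and> iscomp g ?V T} \<le> exp (2 * p * (real K)\<^sup>2) *
        (measure_pmf.prob ?M {g. iscomp g ?V S} * measure_pmf.prob ?M {g. iscomp g ?V T})"
      using p by (intro prob_two_iscomp) auto
  qed (use finI \<mu>_def \<gamma> npos in auto)
  also have "\<dots> \<le> (real K * n + (exp (2 * p * (real K)\<^sup>2) - 1) * (real n)\<^sup>2) / (\<gamma> * n)\<^sup>2"
    using \<mu>n \<mu>0 p by (intro divide_right_mono add_mono mult_left_mono[OF \<mu>n] mult_left_mono[OF power_mono]) auto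
  also have "\<dots> = (K / n + (exp (2 * p * (real K)\<^sup>2) - 1)) / \<gamma>\<^sup>2"
    using npos \<gamma> by (simp add: power2_eq_square field_simps)
  finally show ?thesis .
qed

lemma whp_large_component:
  fixes \<epsilon> D C :: real
  assumes \<epsilon>: "\<epsilon> > 0" and D: "D \<ge> 1" and C: "C > 0"
  shows "whp (\<lambda>n p. 1 + \<epsilon> \<le> p * n \<and> p * n \<le> D) (\<lambda>n p g. \<exists>Q. iscomp g {1..n} Q \<and> C * ln n < card Q)"
proof -
  \<comment> \<open>Half of the gap 1 - exp(-\<epsilon>); the other half leaves room for the factor
    exp(7 p K^2), which tends to 1.\<close>
  define \<gamma> where "\<gamma> = (1 - exp (- \<epsilon>)) / 2"
  have \<gamma>: "\<gamma> > 0" using \<epsilon> by (simp add: \<gamma>_def)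
  define f where "f = (\<lambda>n. (2 * C * ln (real n) / n + (exp (2 * D * (2 * C * ln (real n))\<^sup>2 / n) - 1)) / \<gamma>\<^sup>2)"
  show ?thesis
  proof (rule whpI)
    show "f \<longlonglongrightarrow> 0" unfolding f_def using C D \<gamma> by real_asymp
    have "\<forall>\<^sub>F n in sequentially. C * ln (real n) \<ge> 1" using C by real_asymp
    moreover have "\<forall>\<^sub>F n in sequentially. 2 * C * ln (real n) \<le> n" using C by real_asymp
    moreover have "\<forall>\<^sub>F n in sequentially. 4 * D * (2 * C * ln (real n)) \<le> n" using C D by real_asymp
    moreover have "\<forall>\<^sub>F n in sequentially. exp (- \<epsilon>) * exp (7 * D * (2 * C * ln (real n))\<^sup>2 / n) \<le> 1 - \<gamma>"
    proof -
      have "(\<lambda>n. exp (- \<epsilon>) * exp (7 * D * (2 * C * ln (real n))\<^sup>2 / n)) \<longlonglongrightarrow> exp (- \<epsilon>)"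
        using C D by real_asymp
      moreover have "exp (- \<epsilon>) < 1 - \<gamma>" using \<epsilon> by (simp add: \<gamma>_def field_simps)
      ultimately have "\<forall>\<^sub>F n in sequentially. exp (- \<epsilon>) * exp (7 * D * (2 * C * ln (real n))\<^sup>2 / n) < 1 - \<gamma>"
        by (rule order_tendstoD(2))
      then show ?thesis by (rule eventually_mono) simp
    qed
    ultimately show "\<forall>\<^sub>F n in sequentially. \<forall>p :: real. 0 \<le> p \<longrightarrow> p \<le> 1 \<longrightarrow> 1 + \<epsilon> \<le> p * n \<and> p * n \<le> D \<longrightarrow>
      measure_pmf.prob (Gnp n p) {g. \<not> (\<exists>Q. iscomp g {1..n} Q \<and> C * ln n < card Q)} \<le> f n"
    proof (eventually_elim, intro allI impI)
      fix n and p :: real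
      assume n: "1 \<le> C * ln (real n)" "2 * C * ln (real n) \<le> n" "4 * D * (2 * C * ln (real n)) \<le> n"
          "exp (- \<epsilon>) * exp (7 * D * (2 * C * ln (real n))\<^sup>2 / n) \<le> 1 - \<gamma>"
        and p: "0 \<le> p" "p \<le> 1" "1 + \<epsilon> \<le> p * n \<and> p * n \<le> D"
      define K where "K = nat \<lceil>C * ln (real n)\<rceil>"
      have K: "C * ln (real n) \<le> K" "real K \<le> 2 * C * ln (real n)" "1 \<le> K" unfolding K_def using n(1) by linarith+
      have npos: "real n > 0" using n by (cases n) auto
      have pos: "p > 0" using p \<epsilon> by (cases "p = 0") auto
      have pD: "p \<le> D / n" using p npos by (simp add: field_simps)
      have pK: "4 * p * K \<le> 1"
      proof -
        have "4 * p * K * n = 4 * (p * n) * K" by simp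
        also have "\<dots> \<le> 4 * D * (2 * C * ln (real n))" using p K D by (intro mult_mono) auto
        also have "\<dots> \<le> 1 * n" using n by simp
        finally show ?thesis using npos by simp
      qed
      have p4: "p \<le> 1 / 4"
      proof -
        have "4 * p * 1 \<le> 4 * p * K" using p K by (intro mult_left_mono) auto
        then show ?thesis using pK by simp
      qed
      have pK2: "p * (real K)\<^sup>2 \<le> D * (2 * C * ln (real n))\<^sup>2 / n"
      proof -
        have "p * (real K)\<^sup>2 \<le> D / n * (2 * C * ln (real n))\<^sup>2"
          using pD K p npos D by (intro mult_mono power_mono) auto
        then show ?thesis by simp
      qed
      have "measure_pmf.prob (Gnp n p) {g. \<not> (\<exists>Q. iscomp g {1..n} Q \<and> C * ln n < card Q)} \<le>
        measure_pmf.prob (Gnp n p) {g. \<forall>Q. iscomp g {1..n} Q \<longrightarrow> card Q \<le> K}"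
        using K(1) by (intro prob_mono_support) (force simp: not_less)
      also have "\<dots> \<le> (K / n + (exp (2 * p * (real K)\<^sup>2) - 1)) / \<gamma>\<^sup>2"
      proof (rule all_components_small_prob[OF pos p4 _ pK _ \<gamma>])
        have "exp (1 - p * n) * exp (7 * p * (real K)\<^sup>2) \<le> exp (- \<epsilon>) * exp (7 * D * (2 * C * ln (real n))\<^sup>2 / n)"
          using p pK2 by (intro mult_mono) auto
        then show "exp (1 - p * n) * exp (7 * p * (real K)\<^sup>2) \<le> 1 - \<gamma>" using n by linarith
        show "K \<le> n" using K(2) n(2) by linarith
      qed (use p \<epsilon> in auto)
      also have "\<dots> \<le> f n"
        unfolding f_def using K(2) pK2 npos by (intro divide_right_mono add_mono diff_mono) auto
      finally show "measure_pmf.prob (Gnp n p) {g. \<not> (\<exists>Q. iscomp g {1..n} Q \<and> C * ln n < card Q)} \<le> f n" .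
    qed
  qed
qed

text \<open>A component has an empty boundary, so connected expansion forbids all sizes from C ln n
  / (p n) up to the smaller of \<delta> n and 1 / (4 p). A component above C ln n must therefore lie
  beyond this gap, and 1 / (4 p) \<ge> n / (4 D).\<close>

lemma whp_giant_bounded_degree:
  fixes \<epsilon> D :: real
  assumes \<epsilon>: "\<epsilon> > 0" and D: "D \<ge> 1"
  obtains \<delta> :: real where "\<delta> > 0" "whp (\<lambda>n p. 1 + \<epsilon> \<le> p * n \<and> p * n \<le> D) (\<lambda>n p g. has_component (\<delta> * n) n g)"
proof -
  obtain a \<delta> C :: real where c: "0 < a" "0 < \<delta>" "0 < C" and
    exp: "whp (\<lambda>n p. 1 + \<epsilon> \<le> p * n) (\<lambda>n p g. connected_expansion a C \<delta> n p g)"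
    using whp_connected_expansion[OF \<epsilon>] by blast
  define \<delta>' where "\<delta>' = min \<delta> (1 / (4 * D))"
  have "whp (\<lambda>n p. 1 + \<epsilon> \<le> p * n \<and> p * n \<le> D) (\<lambda>n p g. (connected_expansion a C \<delta> n p g) \<and> (\<exists>Q. iscomp g {1..n} Q \<and> C * ln n < card Q))"
    by (rule whp_conj[OF whp_mono[OF exp] whp_large_component[OF \<epsilon> D c(3)]]) auto
  then have "whp (\<lambda>n p. 1 + \<epsilon> \<le> p * n \<and> p * n \<le> D) (\<lambda>n p g. has_component (\<delta>' * n) n g)"
  proof (rule whp_mono)
    show "\<forall>\<^sub>F n in sequentially. \<forall>(p :: real) g. 0 \<le> p \<longrightarrow> p \<le> 1 \<longrightarrow> 1 + \<epsilon> \<le> p * n \<and> p * n \<le> D \<longrightarrow> graph_on n g \<longrightarrow>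
      (connected_expansion a C \<delta> n p g) \<and> (\<exists>Q. iscomp g {1..n} Q \<and> C * ln n < card Q) \<longrightarrow>
      (has_component (\<delta>' * n) n g)"
    proof (intro always_eventually allI impI)
      fix n g and p :: real
      assume p: "0 \<le> p" "p \<le> 1" "1 + \<epsilon> \<le> p * n \<and> p * n \<le> D"
        and E: "(connected_expansion a C \<delta> n p g) \<and> (\<exists>Q. iscomp g {1..n} Q \<and> C * ln n < card Q)"
      obtain Q where Q: "iscomp g {1..n} Q" "C * ln n < card Q" using E by blast
      have QV: "Q \<subseteq> {1..n}" "conn g Q" "cut g {1..n} Q = 0" using Q iscomp_iff_cut[of "{1..n}" Q g] by (auto simp: iscomp_def)
      have d: "p * n \<ge> 1" using p \<epsilon> by linarith
      then have "1 * real (card Q) \<le> p * n * card Q" by (intro mult_right_mono) auto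
      then have 1: "C * ln n \<le> p * n * card Q" using Q by linarith
      have 2: "a * (p * n * card Q) \<ge> 0" using c p by simp
      have "\<not> (card Q \<le> \<delta> * n \<and> 4 * p * card Q \<le> 1)"
      proof
        assume "card Q \<le> \<delta> * n \<and> 4 * p * card Q \<le> 1"
        then have "a * (p * n * card Q) < cut g {1..n} Q" using conjunct1[OF E] QV(1,2) 1 by blast
        then show False using 2 QV(3) by simp
      qed
      then consider "\<delta> * n \<le> card Q" | "1 \<le> 4 * p * card Q" by linarith
      then have "\<delta>' * n \<le> card Q"
      proof cases
        case 1
        have "\<delta>' * n \<le> \<delta> * n" by (intro mult_right_mono) (auto simp: \<delta>'_def)
        then show ?thesis using 1 by linarith
      next
        case 2
        then have "real n * 1 \<le> n * (4 * p * card Q)" by (intro mult_left_mono) auto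
        also have "\<dots> = 4 * (p * n) * card Q" by simp
        also have "\<dots> \<le> 4 * D * card Q" using p by (intro mult_right_mono) auto
        finally have "1 / (4 * D) * n \<le> card Q" using D by (simp add: field_simps)
        moreover have "\<delta>' * n \<le> 1 / (4 * D) * n" by (intro mult_right_mono) (auto simp: \<delta>'_def)
        ultimately show ?thesis by linarith
      qed
      then show "has_component (\<delta>' * n) n g" using Q by blast
    qed
  qed auto
  then show ?thesis using that[of \<delta>'] c D by (simp add: \<delta>'_def)
qed

text \<open>A union of components has an empty boundary, so its size cannot lie between n / 4 and n
  / 2. Without a component above n / 2, all components and the largest closed set U of at most n / 2
  vertices stay below n / 4; adding one more component keeps U below n / 2 and contradicts its
  maximality.\<close>

lemma ex_half_component:
  assumes n: "n \<ge> 1" and p: "p * real n \<ge> 1"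
    and E: "\<forall>S\<subseteq>{1..n}. 1 \<le> 4 * p * card S \<and> 2 * card S \<le> n \<longrightarrow> 0 < cut g {1..n} S"
  shows "\<exists>Q. iscomp g {1..n} Q \<and> n < 2 * card Q"
proof (rule ccontr)
  assume no: "\<not> ?thesis"
  let ?V = "{1..n}"
  have small: "4 * card Q < n" if Q: "iscomp g ?V Q" for Q
  proof (rule ccontr)
    assume "\<not> 4 * card Q < n"
    then have "real n \<le> 4 * card Q" by simp
    moreover have "p \<ge> 0" using p by (smt (verit) mult_nonpos_nonneg of_nat_0_le_iff)
    ultimately have "p * n \<le> p * (4 * card Q)" by (intro mult_left_mono) auto
    then have "1 \<le> 4 * p * card Q" using p by (simp add: mult_ac)
    then have "0 < cut g ?V Q" using E Q no by (auto simp: iscomp_def)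
    then show False using Q iscomp_iff_cut[of ?V Q g] by (auto simp: iscomp_def)
  qed
  define P where "P = (\<lambda>U. U \<subseteq> ?V \<and> \<not> touch g U (?V - U) \<and> 2 * card U \<le> n)"
  have "P {}" by (simp add: P_def touch_def)
  moreover have "\<And>U. P U \<Longrightarrow> card U < Suc n" using card_mono[of ?V] by (fastforce simp: P_def)
  ultimately obtain U where U: "P U" and max: "\<And>W. P W \<Longrightarrow> card W \<le> card U"
    using ex_has_greatest_nat[of P "{}" card "Suc n"] by metis
  have finU: "finite U" using U finite_subset[of U ?V] by (auto simp: P_def)
  have "4 * card U < n"
  proof (rule ccontr)
    assume "\<not> 4 * card U < n"
    then have "real n \<le> 4 * card U" by simp
    moreover have "p \<ge> 0" using p by (smt (verit) mult_nonpos_nonneg of_nat_0_le_iff)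
    ultimately have "p * n \<le> p * (4 * card U)" by (intro mult_left_mono) auto
    then have "1 \<le> 4 * p * card U" using p by (simp add: mult_ac)
    then have "0 < cut g ?V U" using E U by (auto simp: P_def)
    then show False using U finU touch_iff_cnt[of U "?V - U" g] by (auto simp: P_def)
  qed
  then have "card U < card ?V" by simp
  then have "\<not> ?V \<subseteq> U" using card_mono[OF finU, of ?V] by auto
  then obtain v where v: "v \<in> ?V" "v \<notin> U" by blast
  obtain Q where Q: "v \<in> Q" "iscomp g ?V Q" using ex_iscomp[of ?V v g] v by auto
  have QV: "Q \<subseteq> ?V" "\<not> touch g Q (?V - Q)" "finite Q" using Q finite_subset[of Q ?V] by (auto simp: iscomp_def)
  have "\<not> touch g (U \<union> Q) (?V - (U \<union> Q))"
  proof
    assume "touch g (U \<union> Q) (?V - (U \<union> Q))"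
    then have "touch g (?V - (U \<union> Q)) U \<or> touch g (?V - (U \<union> Q)) Q"
      using touch_commute[of g "U \<union> Q"] touch_Un[of g _ U Q] by blast
    moreover have "\<not> touch g (?V - U) U" "\<not> touch g (?V - Q) Q"
      using U QV(2) touch_commute[of g U] touch_commute[of g Q] unfolding P_def by blast+
    then have "\<not> touch g (?V - (U \<union> Q)) U" "\<not> touch g (?V - (U \<union> Q)) Q"
      using touch_mono[of g "?V - (U \<union> Q)" U "?V - U" U] touch_mono[of g "?V - (U \<union> Q)" Q "?V - Q" Q] by blast+
    ultimately show False by blast
  qed
  moreover have "2 * card (U \<union> Q) \<le> n"
    using card_Un_le[of U Q] small[OF Q(2)] \<open>4 * card U < n\<close> by linarith
  ultimately have "P (U \<union> Q)" using U QV by (auto simp: P_def)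
  then have "card (U \<union> Q) \<le> card U" by (rule max)
  moreover have "card U < card (U \<union> Q)" using v Q finU QV by (intro psubset_card_mono) auto
  ultimately show False by simp
qed

lemma whp_giant:
  fixes \<epsilon> :: real
  assumes \<epsilon>: "\<epsilon> > 0"
  obtains \<delta> :: real where "\<delta> > 0" "whp (\<lambda>n p. 1 + \<epsilon> \<le> p * n) (\<lambda>n p g. has_component (\<delta> * n) n g)"
proof -
  obtain D0 where D0: "\<And>D. D \<ge> D0 \<Longrightarrow>
    whp (\<lambda>n p. D \<le> p * n) (\<lambda>n p g. dense_expansion n p g)" using whp_dense_expansion by blast
  define D where "D = max D0 1"
  have dense: "whp (\<lambda>n p. D \<le> p * n) (\<lambda>n p g. dense_expansion n p g)" by (rule D0) (simp add: D_def)
  obtain \<delta> :: real where \<delta>: "\<delta> > 0" and sparse: "whp (\<lambda>n p. 1 + \<epsilon> \<le> p * n \<and> p * n \<le> D) (\<lambda>n p g. has_component (\<delta> * n) n g)"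
    using whp_giant_bounded_degree[OF \<epsilon>, of D] by (auto simp: D_def)
  define \<delta>' where "\<delta>' = min \<delta> (1 / 2)"
  have "whp (\<lambda>n p. 1 + \<epsilon> \<le> p * n) (\<lambda>n p g. has_component (\<delta>' * n) n g)"
  proof (rule whp_cases[where Q = "\<lambda>n p. p * n \<le> D"])
    show "whp (\<lambda>n p. 1 + \<epsilon> \<le> p * n \<and> p * n \<le> D) (\<lambda>n p g. has_component (\<delta>' * n) n g)"
    proof (rule whp_mono[OF sparse])
      have "\<delta>' * real n \<le> \<delta> * real n" for n by (intro mult_right_mono) (auto simp: \<delta>'_def)
      then show "\<forall>\<^sub>F n in sequentially. \<forall>(p :: real) g. 0 \<le> p \<longrightarrow> p \<le> 1 \<longrightarrow> 1 + \<epsilon> \<le> p * n \<and> p * n \<le> D \<longrightarrow> graph_on n g \<longrightarrow>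
       (has_component (\<delta> * n) n g) \<longrightarrow> (has_component (\<delta>' * n) n g)"
        by (intro always_eventually) (meson order_trans)
    qed auto
    show "whp (\<lambda>n p. 1 + \<epsilon> \<le> p * n \<and> \<not> p * n \<le> D) (\<lambda>n p g. has_component (\<delta>' * n) n g)"
    proof (rule whp_mono[OF dense])
      show "\<forall>\<^sub>F n in sequentially. \<forall>(p :: real) g. 0 \<le> p \<longrightarrow> p \<le> 1 \<longrightarrow> 1 + \<epsilon> \<le> p * n \<and> \<not> p * n \<le> D \<longrightarrow> graph_on n g \<longrightarrow>
       (dense_expansion n p g) \<longrightarrow> (has_component (\<delta>' * n) n g)"
      proof (intro always_eventually allI impI)
        fix n g and p :: real assume p: "0 \<le> p" "p \<le> 1" "1 + \<epsilon> \<le> p * n \<and> \<not> p * n \<le> D"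
          and E: "dense_expansion n p g"
        have d: "p * n \<ge> 1" using p \<epsilon> by linarith
        then have n1: "n \<ge> 1" by (cases n) auto
        have "0 < cut g {1..n} S" if "S \<subseteq> {1..n}" "1 \<le> 4 * p * card S \<and> 2 * card S \<le> n" for S
        proof -
          have "p * n * card S / 8 < cut g {1..n} S" using E that by blast
          moreover have "p * n * card S / 8 \<ge> 0" using p by simp
          ultimately have "0 < real (cut g {1..n} S)" by linarith
          then show ?thesis by simp
        qed
        then obtain Q where Q: "iscomp g {1..n} Q" "n < 2 * card Q" using ex_half_component[OF n1 d, of g] by blast
        have "\<delta>' * n \<le> 1 / 2 * n" by (intro mult_right_mono) (auto simp: \<delta>'_def)
        moreover have "real n \<le> 2 * real (card Q)" using Q(2) by linarith
        ultimately have "\<delta>' * n \<le> card Q" by linarith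
        then show "has_component (\<delta>' * n) n g" using Q by blast
      qed
    qed auto
  qed
  then show ?thesis using that[of \<delta>'] \<delta> by (simp add: \<delta>'_def)
qed

text \<open>For bounded p n two such components would form a sparse cut pair with empty cuts. For p
  n \<ge> D \<ge> 1 / (4 \<delta>) a component of \<delta> n vertices falls in the range of dense
  expansion, hence exceeds n / 2, and two disjoint ones do not fit.\<close>

lemma whp_giant_unique:
  fixes \<epsilon> \<delta> :: real
  assumes \<epsilon>: "\<epsilon> > 0" and \<delta>: "0 < \<delta>" "\<delta> \<le> 1"
  shows "whp (\<lambda>n p. 1 + \<epsilon> \<le> p * n) (\<lambda>n p g. unique_component (\<delta> * n) n g)"
proof -
  obtain D0 where D0: "\<And>D. D \<ge> D0 \<Longrightarrow>
    whp (\<lambda>n p. D \<le> p * n) (\<lambda>n p g. dense_expansion n p g)" using whp_dense_expansion by blast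
  define D where "D = max D0 (max 1 (1 / (4 * \<delta>)))"
  have D: "D \<ge> 1" "1 / (4 * \<delta>) \<le> D" by (auto simp: D_def)
  have dense: "whp (\<lambda>n p. D \<le> p * n) (\<lambda>n p g. dense_expansion n p g)" by (rule D0) (simp add: D_def)
  show ?thesis
  proof (rule whp_cases[where Q = "\<lambda>n p. p * n \<le> D"])
    show "whp (\<lambda>n p. 1 + \<epsilon> \<le> p * n \<and> p * n \<le> D) (\<lambda>n p g. unique_component (\<delta> * n) n g)"
    proof (rule whp_mono[OF whp_no_sparse_cut_pair[OF \<epsilon> D(1) \<delta>]])
      have "\<forall>\<^sub>F n in sequentially. 0 \<le> \<delta> / 32 * (real n / ln n)" using \<delta> by real_asymp
      then show "\<forall>\<^sub>F n in sequentially. \<forall>(p :: real) g. 0 \<le> p \<longrightarrow> p \<le> 1 \<longrightarrow> 1 + \<epsilon> \<le> p * n \<and> p * n \<le> D \<longrightarrow> graph_on n g \<longrightarrow>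
         \<not> sparse_cut_pair n (\<delta> * n) (\<delta> / 32 * (n / ln n)) g \<longrightarrow>
         (unique_component (\<delta> * n) n g)"
      proof (rule eventually_mono, intro allI impI)
        fix n g C C' and p :: real
        assume m: "0 \<le> \<delta> / 32 * (real n / ln n)" and no: "\<not> sparse_cut_pair n (\<delta> * n) (\<delta> / 32 * (n / ln n)) g"
          and C: "iscomp g {1..n} C" "iscomp g {1..n} C'" "\<delta> * n \<le> card C" "\<delta> * n \<le> card C'"
        have "cut g {1..n} C = 0" "cut g {1..n} C' = 0"
          using C iscomp_iff_cut[of "{1..n}" _ g] by (auto simp: iscomp_def)
        then show "C = C'"
          using no C m iscomp_disjoint[OF C(1,2)] unfolding sparse_cut_pair_def by (metis of_nat_0 order_refl)
      qed
    qed auto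
    show "whp (\<lambda>n p. 1 + \<epsilon> \<le> p * n \<and> \<not> p * n \<le> D) (\<lambda>n p g. unique_component (\<delta> * n) n g)"
    proof (rule whp_mono[OF dense])
      show "\<forall>\<^sub>F n in sequentially. \<forall>(p :: real) g. 0 \<le> p \<longrightarrow> p \<le> 1 \<longrightarrow> 1 + \<epsilon> \<le> p * n \<and> \<not> p * n \<le> D \<longrightarrow> graph_on n g \<longrightarrow>
       (dense_expansion n p g) \<longrightarrow>
         (unique_component (\<delta> * n) n g)"
      proof (intro always_eventually allI impI)
        fix n g C C' and p :: real assume p: "0 \<le> p" "p \<le> 1" "1 + \<epsilon> \<le> p * n \<and> \<not> p * n \<le> D"
          and E: "dense_expansion n p g"
          and C: "iscomp g {1..n} C" "iscomp g {1..n} C'" "\<delta> * n \<le> card C" "\<delta> * n \<le> card C'"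
        have half: "n < 2 * card Q" if Q: "iscomp g {1..n} Q" "\<delta> * n \<le> card Q" for Q
        proof (rule ccontr)
          assume small: "\<not> n < 2 * card Q"
          have "1 \<le> 4 * \<delta> * D" using D(2) \<delta> by (simp add: field_simps)
          also have "\<dots> \<le> 4 * \<delta> * (p * n)" using p \<delta> by (intro mult_left_mono) auto
          also have "\<dots> = 4 * p * (\<delta> * n)" by simp
          also have "\<dots> \<le> 4 * p * card Q" using Q p by (intro mult_left_mono) auto
          finally have "p * n * card Q / 8 < cut g {1..n} Q" using E Q small by (auto simp: iscomp_def)
          moreover have "cut g {1..n} Q = 0" using Q iscomp_iff_cut[of "{1..n}" Q g] by (auto simp: iscomp_def)
          ultimately show False using p by (simp add: mult_less_0_iff)
        qed
        show "C = C'"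
        proof (rule ccontr)
          assume "C \<noteq> C'"
          then have "C \<inter> C' = {}" using iscomp_disjoint C by blast
          moreover have sub: "C \<subseteq> {1..n}" "C' \<subseteq> {1..n}" using C by (auto simp: iscomp_def)
          ultimately have "card C + card C' = card (C \<union> C')" using finite_subset[OF sub(1)] finite_subset[OF sub(2)] by (subst card_Un_disjoint) auto
          also have "\<dots> \<le> card {1..n}" using sub by (intro card_mono) auto
          finally show False using half[OF C(1,3)] half[OF C(2,4)] by simp
        qed
      qed
    qed auto
  qed
qed

section \<open>Pendant paths\<close>

definition pair_of :: "nat \<Rightarrow> nat \<Rightarrow> nat \<times> nat" where
  "pair_of u v = (min u v, max u v)"

definition path_edges :: "nat list \<Rightarrow> (nat \<times> nat) set" where
  "path_edges zs = (\<lambda>i. pair_of (zs ! i) (zs ! Suc i)) ` {..<length (tl zs)}"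

definition meeting :: "nat set \<Rightarrow> nat set \<Rightarrow> (nat \<times> nat) set" where
  "meeting V U = {e\<in>inner_pairs V. fst e \<in> U \<or> snd e \<in> U}"

text \<open>The vertices of \<open>tl zs\<close> span a bare path whose only link to the rest of the graph is the edge
  from its first vertex to \<open>hd zs\<close>.\<close>

definition pendant_path :: "nat set \<Rightarrow> nat list \<Rightarrow> (nat \<times> nat \<Rightarrow> bool) \<Rightarrow> bool" where
  "pendant_path V zs g \<longleftrightarrow> (\<forall>e\<in>meeting V (set (tl zs)). g e = (e \<in> path_edges zs))"

text \<open>The head is the anchor in Q, the tail is the path in W. Keeping Q and W disjoint fixes
  the orientation of the path, so that different lists stand for different pendant paths.\<close>

definition path_lists :: "nat set \<Rightarrow> nat set \<Rightarrow> nat \<Rightarrow> nat list set" where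
  "path_lists Q W k = (\<lambda>(a, xs). a # xs) ` (Q \<times> {xs. length xs = k \<and> distinct xs \<and> set xs \<subseteq> W})"

lemma pair_of_eq_iff: "pair_of u v = pair_of x y \<longleftrightarrow> (u = x \<and> v = y) \<or> (u = y \<and> v = x)"
  by (auto simp: pair_of_def min_def max_def)

lemma path_lists_nth:
  assumes "zs \<in> path_lists Q W k"
  shows "length zs = Suc k" "zs ! 0 \<in> Q" "\<And>i. 0 < i \<Longrightarrow> i \<le> k \<Longrightarrow> zs ! i \<in> W"
    "set (tl zs) = (\<lambda>i. zs ! i) ` {1..k}" "set (tl zs) \<subseteq> W" "card (set (tl zs)) = k" "length (tl zs) = k"
    "Q \<inter> W = {} \<Longrightarrow> distinct zs"
proof -
  obtain a xs where zs: "zs = a # xs" "a \<in> Q" "length xs = k" "distinct xs" "set xs \<subseteq> W"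
    using assms unfolding path_lists_def by auto
  show "length zs = Suc k" "zs ! 0 \<in> Q" "set (tl zs) \<subseteq> W" "length (tl zs) = k" using zs by auto
  show "zs ! i \<in> W" if "0 < i" "i \<le> k" for i using that zs nth_mem[of "i - 1" xs] by (cases i) auto
  show "card (set (tl zs)) = k" using zs by (simp add: distinct_card)
  show "distinct zs" if "Q \<inter> W = {}" using zs that by auto
  show "set (tl zs) = (\<lambda>i. zs ! i) ` {1..k}"
  proof -
    have "set xs = (\<lambda>i. xs ! i) ` {0..<k}" using zs by (auto simp: set_conv_nth)
    also have "\<dots> = (\<lambda>i. zs ! i) ` (Suc ` {0..<k})" unfolding image_image zs by simp
    also have "Suc ` {0..<k} = {1..k}" by (simp add: image_Suc_atLeastLessThan atLeastLessThanSuc_atLeastAtMost)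
    finally show ?thesis using zs by simp
  qed
qed

lemma path_edges_meeting:
  assumes zs: "zs \<in> path_lists Q W k" and QW: "Q \<inter> W = {}" "Q \<subseteq> V" "W \<subseteq> V"
  shows "path_edges zs \<subseteq> meeting V (set (tl zs))" "card (path_edges zs) \<le> k"
    "finite (path_edges zs)"
proof -
  note z = path_lists_nth[OF zs]
  show "path_edges zs \<subseteq> meeting V (set (tl zs))"
  proof
    fix e assume "e \<in> path_edges zs"
    then obtain i where i: "i < k" "e = pair_of (zs ! i) (zs ! Suc i)" using z(7) by (auto simp: path_edges_def)
    have "zs ! i \<noteq> zs ! Suc i" using z(8)[OF QW(1)] z(1) i by (simp add: nth_eq_iff_index_eq)
    moreover have "zs ! i \<in> V" "zs ! Suc i \<in> V" using z(2,3) QW i by (cases "i = 0"; force)+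
    moreover have "zs ! Suc i \<in> set (tl zs)" using i unfolding z(4) by auto
    ultimately show "e \<in> meeting V (set (tl zs))" using i by (auto simp: meeting_def pair_of_def inner_pairs_def min_def max_def)
  qed
  show "card (path_edges zs) \<le> k" unfolding path_edges_def using card_image_le[of "{..<length (tl zs)}"] z(7) by simp
  show "finite (path_edges zs)" by (simp add: path_edges_def)
qed

lemma path_edges_D:
  assumes "zs \<in> path_lists Q W k" "e \<in> path_edges zs"
  obtains j where "j < k" "e = pair_of (zs ! j) (zs ! Suc j)"
  using assms path_lists_nth(7)[OF assms(1)] by (auto simp: path_edges_def)

text \<open>A shared vertex has all its edges on both paths. Follow \<open>zs\<close> to its first
  vertex on \<open>ws\<close>: the edge entering it must be the anchor edge of \<open>ws\<close>, so
  both paths start there with the same anchor, and then they agree step by step. In the second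
  moment, overlapping pairs thus contribute nothing.\<close>

lemma pendant_paths_overlap:
  assumes zs: "zs \<in> path_lists Q W k" and ws: "ws \<in> path_lists Q W k"
    and QW: "Q \<inter> W = {}" "Q \<subseteq> V" "W \<subseteq> V"
    and H: "pendant_path V zs g" "pendant_path V ws g" and ne: "set (tl zs) \<inter> set (tl ws) \<noteq> {}"
  shows "zs = ws"
proof -
  note z = path_lists_nth[OF zs] and w = path_lists_nth[OF ws]
  have dz: "distinct zs" and dw: "distinct ws" using z(8) w(8) QW by auto
  have edge: "\<exists>j<k. pair_of (zs ! i) (zs ! Suc i) = pair_of (ws ! j) (ws ! Suc j)"
    if i: "i < k" and mem: "zs ! i \<in> set (tl ws) \<or> zs ! Suc i \<in> set (tl ws)" for i
  proof -
    define e where "e = pair_of (zs ! i) (zs ! Suc i)"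
    have "e \<in> path_edges zs" using i z(7) by (auto simp: path_edges_def e_def)
    then have e: "e \<in> meeting V (set (tl zs))" "g e"
      using path_edges_meeting(1)[OF zs QW] H(1) by (auto simp: pendant_path_def)
    then have "e \<in> meeting V (set (tl ws))" using mem by (auto simp: meeting_def e_def pair_of_def min_def max_def)
    then have "e \<in> path_edges ws" using H(2) e by (auto simp: pendant_path_def)
    then show ?thesis using path_edges_D[OF ws] unfolding e_def by metis
  qed
  have "\<exists>i. 1 \<le> i \<and> i \<le> k \<and> zs ! i \<in> set (tl ws)" using ne z(4) by auto
  then obtain i where i: "1 \<le> i" "i \<le> k" "zs ! i \<in> set (tl ws)"
    and min: "\<And>i'. i' < i \<Longrightarrow> \<not> (1 \<le> i' \<and> i' \<le> k \<and> zs ! i' \<in> set (tl ws))"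
    using exists_least_iff[of "\<lambda>i. 1 \<le> i \<and> i \<le> k \<and> zs ! i \<in> set (tl ws)"] by blast
  have wW: "ws ! j \<in> set (tl ws)" if "1 \<le> j" "j \<le> k" for j using that unfolding w(4) by auto
  obtain j where j: "j < k" "pair_of (zs ! (i - 1)) (zs ! i) = pair_of (ws ! j) (ws ! Suc j)"
  proof -
    have "i - 1 < k" "Suc (i - 1) = i" using i by auto
    then show ?thesis using that edge[of "i - 1"] i(3) by auto
  qed
  \<comment> \<open>Either the predecessor is the anchor in Q, which avoids W, or i was not the
    first meeting point.\<close>
  have zi: "zs ! (i - 1) \<notin> set (tl ws)"
  proof (cases "i = 1")
    case True
    then show ?thesis using z(2) w(5) QW by auto
  next
    case False
    then show ?thesis using min[of "i - 1"] i by auto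
  qed
  have "ws ! Suc j \<in> set (tl ws)" using wW[of "Suc j"] j by simp
  then have eq: "zs ! (i - 1) = ws ! j" "zs ! i = ws ! Suc j" using j(2) zi by (auto simp: pair_of_eq_iff)
  have j0: "j = 0" using zi wW[of j] j(1) eq by (cases j) auto
  have "zs ! (i - 1) \<in> Q" using eq j0 w(2) by simp
  then have i1: "i = 1" using z(3)[of "i - 1"] i QW by (cases "i = 1") auto
  have base: "zs ! 0 = ws ! 0" "zs ! 1 = ws ! 1" using eq i1 j0 by auto
  have "\<forall>m'\<le>m. zs ! m' = ws ! m'" if "m \<le> k" for m
    using that
  proof (induction m)
    case (Suc m)
    then have IH: "\<And>m'. m' \<le> m \<Longrightarrow> zs ! m' = ws ! m'" by auto
    have "zs ! Suc m = ws ! Suc m"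
    proof (cases "m = 0")
      case False
      have "zs ! m \<in> set (tl ws)" using IH[of m] wW[of m] False Suc.prems by auto
      then obtain j where j: "j < k" "pair_of (zs ! m) (zs ! Suc m) = pair_of (ws ! j) (ws ! Suc j)"
        using edge[of m] Suc.prems by auto
      then consider "ws ! m = ws ! j" "zs ! Suc m = ws ! Suc j" | "ws ! m = ws ! Suc j" "zs ! Suc m = ws ! j"
        using IH[of m] by (auto simp: pair_of_eq_iff)
      then show ?thesis
      proof cases
        case 1
        then have "m = j" using dw w(1) j Suc.prems by (simp add: nth_eq_iff_index_eq)
        then show ?thesis using 1 by simp
      next
        case 2
        \<comment> \<open>Here the edge of \<open>zs\<close> would run backwards along
          \<open>ws\<close>; by the induction hypothesis \<open>zs\<close> would then repeat an
          earlier vertex.\<close>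
        then have "m = Suc j" using dw w(1) j Suc.prems by (simp add: nth_eq_iff_index_eq)
        then have "zs ! Suc m = zs ! j" using 2 IH[of j] by simp
        then have "Suc m = j" using dz z(1) j Suc.prems by (simp add: nth_eq_iff_index_eq)
        then show ?thesis using \<open>m = Suc j\<close> by simp
      qed
    qed (use base in auto)
    then show ?case using IH by (auto simp: le_Suc_eq)
  qed (use base in auto)
  then have "zs ! m = ws ! m" if "m \<le> k" for m using that by blast
  then show "zs = ws" using z(1) w(1) by (intro nth_equalityI) auto
qed

section \<open>Probability of pendant paths and their second moment\<close>

lemma prob_pendant_path:
  assumes A: "finite A" "meeting V (set (tl zs)) \<subseteq> A" and p: "0 \<le> p" "p \<le> 1"
  shows "measure_pmf.prob (rbits A p) {g. pendant_path V zs g} =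
    p ^ card {e\<in>meeting V (set (tl zs)). e \<in> path_edges zs} * (1 - p) ^ card {e\<in>meeting V (set (tl zs)). e \<notin> path_edges zs}"
  unfolding pendant_path_def using rbits_pattern[OF A p] by simp

text \<open>For disjoint paths the two prescribed patterns overlap in exactly k^2 pairs, all of them
  absent in both. As for components, they are paid for once instead of twice, which gains at most
  exp(2 p k^2).\<close>

lemma prob_two_pendant_paths:
  assumes A: "finite A" and VA: "\<And>U. U \<subseteq> W \<Longrightarrow> meeting V U \<subseteq> A" and p: "0 \<le> p" "p \<le> 1 / 2" and V: "finite V"
    and zs: "zs \<in> path_lists Q W k" and ws: "ws \<in> path_lists Q W k" and ne: "zs \<noteq> ws"
    and QW: "Q \<inter> W = {}" "Q \<subseteq> V" "W \<subseteq> V"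
  shows "measure_pmf.prob (rbits A p) {g. pendant_path V zs g \<and> pendant_path V ws g} \<le>
    exp (2 * p * (real k)\<^sup>2) * (measure_pmf.prob (rbits A p) {g. pendant_path V zs g} * measure_pmf.prob (rbits A p) {g. pendant_path V ws g})"
proof (cases "set (tl zs) \<inter> set (tl ws) = {}")
  case False
  then have "{g. pendant_path V zs g \<and> pendant_path V ws g} = {}" using pendant_paths_overlap[OF zs ws QW] ne by blast
  then show ?thesis by (simp only: measure_empty) (intro mult_nonneg_nonneg; simp)
next
  case True
  note z = path_lists_nth[OF zs] and w = path_lists_nth[OF ws]
  let ?U = "set (tl zs)" and ?T = "set (tl ws)"
  define D where "D = meeting V ?T - meeting V ?U"
  have sub: "meeting V ?U \<subseteq> A" "meeting V ?T \<subseteq> A" "D \<subseteq> A" using VA z(5) w(5) by (auto simp: D_def)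
  have fm: "finite (meeting V ?T)" using sub(2) A by (rule finite_subset)
  have inter: "meeting V ?T \<inter> meeting V ?U = cut_pairs ?U ?T"
    using z(5) w(5) QW True by (force simp: meeting_def cut_pairs_def inner_pairs_def)
  have card: "card (meeting V ?T \<inter> meeting V ?U) = k\<^sup>2"
    unfolding inter using card_cut_pairs[OF _ _ True] z(6) w(6) by (simp add: power2_eq_square)
  \<comment> \<open>An edge of \<open>ws\<close> joins its own path vertices or its anchor, and the
    anchor lies in Q, not in W; so the shared pairs carry no path edge.\<close>
  have noP: "e \<notin> path_edges ws" if "e \<in> meeting V ?U" for e
  proof
    assume "e \<in> path_edges ws"
    then obtain j where j: "j < k" "e = pair_of (ws ! j) (ws ! Suc j)" using path_edges_D[OF ws] by blast
    have "ws ! j \<notin> ?U"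
    proof (cases j)
      case 0
      then show ?thesis using w(2) z(5) QW by auto
    next
      case (Suc i)
      then have "ws ! j \<in> ?T" using j unfolding w(4) by auto
      then show ?thesis using True by auto
    qed
    moreover have "ws ! Suc j \<in> ?T" using j unfolding w(4) by auto
    then have "ws ! Suc j \<notin> ?U" using True by auto
    ultimately show False using that j by (auto simp: meeting_def pair_of_def min_def max_def split: if_splits)
  qed
  have 1: "{e\<in>meeting V ?T. e \<in> path_edges ws} = {e\<in>D. e \<in> path_edges ws}" using noP by (auto simp: D_def)
  have "{e\<in>meeting V ?T. e \<notin> path_edges ws} = {e\<in>D. e \<notin> path_edges ws} \<union> (meeting V ?T \<inter> meeting V ?U)"
    using noP by (auto simp: D_def)
  then have 2: "card {e\<in>meeting V ?T. e \<notin> path_edges ws} = card {e\<in>D. e \<notin> path_edges ws} + k\<^sup>2"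
    using fm card card_Un_disjoint[of "{e\<in>D. e \<notin> path_edges ws}" "meeting V ?T \<inter> meeting V ?U"]
    by (auto simp: D_def)
  let ?M = "rbits A p"
  have "measure_pmf.prob ?M {g. pendant_path V zs g \<and> pendant_path V ws g} \<le>
     measure_pmf.prob ?M {g. pendant_path V zs g \<and> (\<forall>e\<in>D. g e = (e \<in> path_edges ws))}"
    by (intro prob_mono_support) (auto simp: pendant_path_def D_def)
  also have "\<dots> = measure_pmf.prob ?M {g. pendant_path V zs g} * measure_pmf.prob ?M {g. \<forall>e\<in>D. g e = (e \<in> path_edges ws)}"
    by (rule rbits_indep[OF A sub(1,3)]) (auto simp: D_def depends_only_on_def pendant_path_def)
  also have "measure_pmf.prob ?M {g. \<forall>e\<in>D. g e = (e \<in> path_edges ws)} \<le> exp (2 * p * (real k)\<^sup>2) * measure_pmf.prob ?M {g. pendant_path V ws g}"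
  proof -
    have "exp (- (2 * p * (real k)\<^sup>2)) \<le> (1 - p) ^ (k\<^sup>2)"
    proof -
      have "exp (- 2 * p) ^ (k\<^sup>2) \<le> (1 - p) ^ (k\<^sup>2)" using p by (intro power_mono exp_le_one_minus) auto
      then show ?thesis by (simp add: exp_of_nat_mult[symmetric] mult_ac)
    qed
    then have "1 \<le> exp (2 * p * (real k)\<^sup>2) * (1 - p) ^ (k\<^sup>2)"
      using mult_left_mono[of "exp (- (2 * p * (real k)\<^sup>2))" "(1 - p) ^ (k\<^sup>2)" "exp (2 * p * (real k)\<^sup>2)"]
      by (simp add: exp_add[symmetric])
    then have le: "x * 1 \<le> x * (exp (2 * p * (real k)\<^sup>2) * (1 - p) ^ (k\<^sup>2))" if "x \<ge> 0" for x using that by (intro mult_left_mono)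
    have "measure_pmf.prob ?M {g. pendant_path V ws g} = measure_pmf.prob ?M {g. \<forall>e\<in>D. g e = (e \<in> path_edges ws)} * (1 - p) ^ (k\<^sup>2)"
      using prob_pendant_path[OF A sub(2), of p] rbits_pattern[OF A sub(3), of p "\<lambda>e. e \<in> path_edges ws"] p
      by (simp add: 1 2 power_add)
    then show ?thesis using le[of "measure_pmf.prob ?M {g. \<forall>e\<in>D. g e = (e \<in> path_edges ws)}"]
      by (simp add: mult_ac)
  qed
  finally have "measure_pmf.prob ?M {g. pendant_path V zs g \<and> pendant_path V ws g} \<le>
      measure_pmf.prob ?M {g. pendant_path V zs g} * (exp (2 * p * (real k)\<^sup>2) * measure_pmf.prob ?M {g. pendant_path V ws g})"
    by (simp add: mult_left_mono)
  then show ?thesis by (simp add: mult_ac)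
qed

lemma card_meeting_le:
  assumes "finite V" "U \<subseteq> V"
  shows "card (meeting V U) \<le> card U * card V"
proof -
  have fU: "finite U" using assms finite_subset by auto
  have "meeting V U \<subseteq> (\<Union>u\<in>U. cut_pairs {u} (V - {u}))"
    by (auto simp: meeting_def inner_pairs_def cut_pairs_def)
  then have "card (meeting V U) \<le> card (\<Union>u\<in>U. cut_pairs {u} (V - {u}))"
    using fU assms by (intro card_mono) auto
  also have "\<dots> \<le> (\<Sum>u\<in>U. card (cut_pairs {u} (V - {u})))" by (intro card_UN_le fU)
  also have "\<dots> \<le> (\<Sum>u\<in>U. card V)"
    using assms by (intro sum_mono) (auto simp: card_cut_pairs)
  finally show ?thesis by simp
qed

lemma card_path_lists:
  assumes "finite Q" "finite W" "k \<le> card W"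
  shows "finite (path_lists Q W k)" "real (card Q) * (real (card W) - k) ^ k \<le> real (card (path_lists Q W k))"
proof -
  let ?X = "{xs. length xs = k \<and> distinct xs \<and> set xs \<subseteq> W}"
  have fin: "finite ?X" by (rule finite_subset[OF _ finite_lists_length_eq[OF assms(2), of k]]) auto
  then show "finite (path_lists Q W k)" using assms by (simp add: path_lists_def)
  have "inj_on (\<lambda>(a, xs). a # xs) (Q \<times> ?X)" by (auto simp: inj_on_def)
  then have c: "card (path_lists Q W k) = card Q * card ?X"
    unfolding path_lists_def by (simp add: card_image card_cartesian_product)
  have "(card W - k) ^ k = (\<Prod>i\<in>{card W - k + 1..card W}. card W - k)" using assms by simp
  also have "\<dots> \<le> \<Prod>{card W - k + 1..card W}" by (intro prod_mono) auto
  also have "\<dots> = card ?X" using card_lists_distinct_length_eq[OF assms(2,3)] by simp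
  finally have "card Q * (card W - k) ^ k \<le> card (path_lists Q W k)" unfolding c by (intro mult_left_mono) auto
  then have "real (card Q * (card W - k) ^ k) \<le> real (card (path_lists Q W k))" by (simp only: of_nat_le_iff)
  then show "real (card Q) * (real (card W) - k) ^ k \<le> real (card (path_lists Q W k))"
    using assms by (simp add: of_nat_diff)
qed

text \<open>A given list works with probability at least p^k exp(-2 p n k): at most k edges must be
  present and at most k n pairs absent. So m bounds the expected number from below, and absence of
  all paths is a deviation by the full mean.\<close>

lemma no_pendant_path_prob:
  assumes A: "finite A" and VA: "\<And>U. U \<subseteq> W \<Longrightarrow> meeting V U \<subseteq> A" and p: "0 < p" "p \<le> 1 / 2" and V: "finite V" "card V = n"
    and QW: "Q \<inter> W = {}" "Q \<subseteq> V" "W \<subseteq> V" and k: "k \<le> card W"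
    and m: "0 < m" "m \<le> card Q * (real (card W) - k) ^ k * (p ^ k * exp (- (2 * p * n * k)))"
  shows "measure_pmf.prob (rbits A p) {g. \<not> (\<exists>zs\<in>path_lists Q W k. pendant_path V zs g)} \<le> 1 / m + (exp (2 * p * (real k)\<^sup>2) - 1)"
proof -
  let ?M = "rbits A p" and ?I = "path_lists Q W k"
  have finQW: "finite Q" "finite W" using QW V finite_subset by auto
  note I = card_path_lists[OF finQW k]
  define \<mu> where "\<mu> = (\<Sum>zs\<in>?I. 1 * measure_pmf.prob ?M {g. pendant_path V zs g})"
  have one: "p ^ k * exp (- (2 * p * n * k)) \<le> measure_pmf.prob ?M {g. pendant_path V zs g}" if zs: "zs \<in> ?I" for zs
  proof -
    note z = path_lists_nth[OF zs]
    let ?U = "set (tl zs)"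
    have "measure_pmf.prob ?M {g. pendant_path V zs g} =
       p ^ card {e\<in>meeting V ?U. e \<in> path_edges zs} * (1 - p) ^ card {e\<in>meeting V ?U. e \<notin> path_edges zs}"
      using p VA[OF z(5)] by (intro prob_pendant_path A) auto
    moreover have "p ^ k \<le> p ^ card {e\<in>meeting V ?U. e \<in> path_edges zs}"
    proof -
      have "card {e\<in>meeting V ?U. e \<in> path_edges zs} \<le> card (path_edges zs)"
        using path_edges_meeting(3)[OF zs QW] by (intro card_mono) auto
      then show ?thesis using path_edges_meeting(2)[OF zs QW] p by (intro power_decreasing) auto
    qed
    moreover have "exp (- (2 * p * n * k)) \<le> (1 - p) ^ card {e\<in>meeting V ?U. e \<notin> path_edges zs}"
    proof -
      have UV: "?U \<subseteq> V" using z(5) QW by auto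
      have fin: "finite (meeting V ?U)" using VA[OF z(5)] A finite_subset by auto
      have "card {e\<in>meeting V ?U. e \<notin> path_edges zs} \<le> card (meeting V ?U)" using fin by (intro card_mono) auto
      also have "\<dots> \<le> k * n" using card_meeting_le[OF V(1) UV] z(6) V by simp
      finally have "(1 - p) ^ (k * n) \<le> (1 - p) ^ card {e\<in>meeting V ?U. e \<notin> path_edges zs}"
        using p by (intro power_decreasing) auto
      moreover have "exp (- 2 * p) ^ (k * n) \<le> (1 - p) ^ (k * n)" using p by (intro power_mono exp_le_one_minus) auto
      ultimately show ?thesis by (simp add: exp_of_nat_mult[symmetric] mult_ac)
    qed
    ultimately show ?thesis using p by (simp add: mult_mono)
  qed
  have "m \<le> real (card ?I) * (p ^ k * exp (- (2 * p * n * k)))"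
    using m(2) mult_right_mono[OF I(2), of "p ^ k * exp (- (2 * p * n * k))"] p by (auto intro: order_trans)
  also have "\<dots> = (\<Sum>zs\<in>?I. p ^ k * exp (- (2 * p * n * k)))" by simp
  also have "\<dots> \<le> \<mu>" unfolding \<mu>_def using one by (intro sum_mono) auto
  finally have m\<mu>: "m \<le> \<mu>" .
  have "measure_pmf.prob ?M {g. \<not> (\<exists>zs\<in>?I. pendant_path V zs g)} \<le>
    measure_pmf.prob ?M {g. \<bar>(\<Sum>zs\<in>?I. 1 * of_bool (pendant_path V zs g)) - \<mu>\<bar> \<ge> \<mu>}"
    using m\<mu> m by (intro prob_mono_support) auto
  also have "\<dots> \<le> (1 * \<mu> + (exp (2 * p * (real k)\<^sup>2) - 1) * \<mu>\<^sup>2) / \<mu>\<^sup>2"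
  proof (rule second_moment)
    fix zs ws assume "zs \<in> ?I" "ws \<in> ?I" "zs \<noteq> ws"
    then show "measure_pmf.prob ?M {g. pendant_path V zs g \<and> pendant_path V ws g} \<le>
    exp (2 * p * (real k)\<^sup>2) * (measure_pmf.prob ?M {g. pendant_path V zs g} * measure_pmf.prob ?M {g. pendant_path V ws g})"
      using p by (intro prob_two_pendant_paths[OF A VA _ _ V(1) _ _ _ QW]) auto
  qed (use A I m\<mu> m \<mu>_def in auto)
  also have "\<dots> = 1 / \<mu> + (exp (2 * p * (real k)\<^sup>2) - 1)"
    using m\<mu> m by (simp add: field_simps power2_eq_square)
  also have "\<dots> \<le> 1 / m + (exp (2 * p * (real k)\<^sup>2) - 1)" using m\<mu> m by (simp add: frac_le)
  finally show ?thesis .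
qed

text \<open>At most k edges meet the path, each counted at most twice in the volume, and only the
  anchor edge can leave it. The edges also lead from the anchor through the whole path, so it lies
  in the component of Q.\<close>

lemma pendant_path_cut:
  assumes zs: "zs \<in> path_lists Q W k" and QW: "Q \<inter> W = {}" "Q \<subseteq> V" "W \<subseteq> V" and V: "finite V"
    and H: "pendant_path V zs g"
  shows "cut g V (set (tl zs)) \<le> 1" "vol g V (set (tl zs)) \<le> 2 * k"
    "\<And>C. iscomp g V C \<Longrightarrow> Q \<subseteq> C \<Longrightarrow> set (tl zs) \<subseteq> C"
proof -
  note z = path_lists_nth[OF zs]
  let ?U = "set (tl zs)"
  have UV: "?U \<subseteq> V" using z(5) QW by auto
  have fin: "finite (path_edges zs)" by (simp add: path_edges_def)
  have meet: "inner_pairs ?U \<union> cut_pairs ?U (V - ?U) \<subseteq> meeting V ?U"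
    using UV by (auto simp: meeting_def inner_pairs_def cut_pairs_def)
  have "{e\<in>cut_pairs ?U (V - ?U). g e} \<subseteq> {pair_of (zs ! 0) (zs ! 1)}"
  proof
    fix e assume e: "e \<in> {e\<in>cut_pairs ?U (V - ?U). g e}"
    then have "e \<in> path_edges zs" using meet H by (auto simp: pendant_path_def)
    then obtain j where j: "j < k" "e = pair_of (zs ! j) (zs ! Suc j)" using path_edges_D[OF zs] by blast
    have "j = 0"
    proof (rule ccontr)
      assume "j \<noteq> 0"
      then have "zs ! j \<in> ?U" "zs ! Suc j \<in> ?U" using j unfolding z(4) by auto
      then show False using e j by (auto simp: cut_pairs_def pair_of_def min_def max_def split: if_splits)
    qed
    then show "e \<in> {pair_of (zs ! 0) (zs ! 1)}" using j by simp
  qed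
  then have "card {e\<in>cut_pairs ?U (V - ?U). g e} \<le> card {pair_of (zs ! 0) (zs ! 1)}" by (intro card_mono) auto
  then show "cut g V ?U \<le> 1" by (simp add: cnt_def)
  have "cnt (inner_pairs ?U) g + cut g V ?U = cnt (inner_pairs ?U \<union> cut_pairs ?U (V - ?U)) g"
    using V by (intro cnt_Un[symmetric] inner_cut_disjoint) auto
  also have "\<dots> \<le> card (path_edges zs)"
    unfolding cnt_def using meet H fin by (intro card_mono) (auto simp: pendant_path_def)
  also have "\<dots> \<le> k" by (rule path_edges_meeting(2)[OF zs QW])
  finally show "vol g V ?U \<le> 2 * k" by (simp add: vol_def)
  show "?U \<subseteq> C" if C: "iscomp g V C" "Q \<subseteq> C" for C
  proof -
    have "zs ! i \<in> C" if "i \<le> k" for i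
      using that
    proof (induction i)
      case 0
      then show ?case using z(2) C by auto
    next
      case (Suc i)
      have zi: "zs ! Suc i \<in> V" using z(3)[of "Suc i"] Suc.prems QW by auto
      define e where "e = pair_of (zs ! i) (zs ! Suc i)"
      have "e \<in> path_edges zs" using Suc.prems z(7) by (auto simp: path_edges_def e_def)
      then have e: "e \<in> meeting V ?U" "g e" using path_edges_meeting(1)[OF zs QW] H by (auto simp: pendant_path_def)
      show ?case
      proof (rule ccontr)
        assume "zs ! Suc i \<notin> C"
        moreover have "zs ! i \<in> C" using Suc by simp
        ultimately have "e \<in> cut_pairs C (V - C)"
          using e zi by (auto simp: e_def cut_pairs_def meeting_def inner_pairs_def pair_of_def min_def max_def split: if_splits)
        then show False using C e by (auto simp: iscomp_def touch_def)
      qed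
    qed
    then show ?thesis unfolding z(4) by auto
  qed
qed

text \<open>Q is only required to be connected and large in the final graph. Uniqueness of the large
  component later identifies its component with the largest one.\<close>

abbreviation has_pendant_path :: "real \<Rightarrow> nat \<Rightarrow> nat \<Rightarrow> (nat \<times> nat \<Rightarrow> bool) \<Rightarrow> bool" where
  "has_pendant_path s k n g \<equiv> \<exists>Q W zs. Q \<inter> W = {} \<and> Q \<subseteq> {1..n} \<and> W \<subseteq> {1..n} \<and>
     conn g Q \<and> s \<le> real (card Q) \<and> zs \<in> path_lists Q W k \<and> pendant_path {1..n} zs g"

text \<open>The vertices are exposed in two rounds. The first r n of them already carry a large
  component Q, found from their own edges alone. Pendant paths at Q through the remaining vertices
  depend only on pairs not inspected so far, so Q may be treated as fixed in the second
  moment.\<close>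

lemma whp_pendant_path:
  fixes \<epsilon> :: real
  assumes \<epsilon>: "\<epsilon> > 0"
  obtains c \<delta> :: real where "c > 0" "\<delta> > 0"
    "whp (\<lambda>n p. 1 + \<epsilon> \<le> p * n \<and> p * n \<le> c * ln n) (\<lambda>n p g. has_pendant_path (\<delta> * n) (nat \<lfloor>c * ln n / (p * n)\<rfloor>) n g)"
proof -
  \<comment> \<open>The smallest fraction of vertices that keeps the average degree at least 1 +
    \<epsilon> / 2.\<close>
  define r where "r = (1 + \<epsilon> / 2) / (1 + \<epsilon>)"
  define \<theta> where "\<theta> = (1 - r) / 2"
  have r: "0 < r" "r < 1" "r * (1 + \<epsilon>) = 1 + \<epsilon> / 2" using \<epsilon> by (auto simp: r_def field_simps)
  have \<theta>: "0 < \<theta>" "\<theta> < 1" using r by (auto simp: \<theta>_def)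
  define n1 where "n1 = (\<lambda>n :: nat. nat \<lceil>r * n\<rceil>)"
  have n1: "r * n \<le> n1 n" "n1 n \<le> r * n + 1" for n
  proof -
    have "0 \<le> r * n" using r by simp
    then show "r * n \<le> n1 n" "n1 n \<le> r * n + 1" unfolding n1_def by linarith+
  qed
  have lim: "filterlim n1 at_top sequentially"
    unfolding filterlim_at_top
  proof
    fix Z :: nat
    have "\<forall>\<^sub>F n in sequentially. real Z \<le> r * n" using r by real_asymp
    then show "\<forall>\<^sub>F n in sequentially. Z \<le> n1 n"
    proof (rule eventually_mono)
      fix n :: nat assume "real Z \<le> r * n"
      then have "real Z \<le> real (n1 n)" using n1(1)[of n] by linarith
      then show "Z \<le> n1 n" by simp
    qed
  qed
  obtain \<delta> :: real where \<delta>: "\<delta> > 0" and giant: "whp (\<lambda>n p. 1 + \<epsilon> / 2 \<le> p * n) (\<lambda>n p g. has_component (\<delta> * n) n g)"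
    using whp_giant[of "\<epsilon> / 2"] \<epsilon> by auto
  then obtain f where f: "f \<longlonglongrightarrow> 0" and fev: "\<forall>\<^sub>F n in sequentially. \<forall>p. 0 \<le> p \<and> p \<le> 1 \<and> 1 + \<epsilon> / 2 \<le> p * real n \<longrightarrow>
     measure_pmf.prob (Gnp n p) {g. \<not> (has_component (\<delta> * n) n g)} \<le> f n"
    unfolding whp_def by blast
  \<comment> \<open>A path of length k with p n k \<le> c ln n costs at most a factor exp(-p n k (2
    + ln (2 / \<theta>))): 2 for the absent pairs and ln (2 / \<theta>) for choosing vertices among
    the rest. This c keeps the cost above n^(-1/2).\<close>
  define c where "c = 1 / (2 * (2 + ln (2 / \<theta>)))"
  have ln\<theta>: "ln (2 / \<theta>) > 0" using \<theta> by simp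
  have c: "c > 0" "c * (2 + ln (2 / \<theta>)) = 1 / 2" using ln\<theta> by (auto simp: c_def)
  \<comment> \<open>The lower bound on the expected number of paths: \<delta> r n anchors times the
    cost n^(-1/2), so it grows like sqrt n.\<close>
  define m where "m = (\<lambda>n. \<delta> * r * real n * exp (- ln (real n) / 2))"
  define h where "h = (\<lambda>n. f (n1 n) + (1 / m n + (exp (2 * (c * ln (real n))\<^sup>2 / n) - 1)))"
  have "whp (\<lambda>n p. 1 + \<epsilon> \<le> p * n \<and> p * n \<le> c * ln n) (\<lambda>n p g. has_pendant_path (\<delta> * r * n) (nat \<lfloor>c * ln n / (p * n)\<rfloor>) n g)"
  proof (rule whpI)
    have "(\<lambda>n. 1 / m n + (exp (2 * (c * ln (real n))\<^sup>2 / n) - 1)) \<longlonglongrightarrow> 0"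
      unfolding m_def using \<delta> r c by real_asymp
    from tendsto_add[OF filterlim_compose[OF f lim] this] show "h \<longlonglongrightarrow> 0" by (simp add: h_def)
    have "\<forall>\<^sub>F n in sequentially. \<forall>p. 0 \<le> p \<and> p \<le> 1 \<and> 1 + \<epsilon> / 2 \<le> p * real (n1 n) \<longrightarrow>
     measure_pmf.prob (Gnp (n1 n) p) {g. \<not> (\<exists>Q. iscomp g {1..n1 n} Q \<and> \<delta> * n1 n \<le> card Q)} \<le> f (n1 n)"
      using eventually_compose_filterlim[OF fev lim] .
    moreover have "\<forall>\<^sub>F n in sequentially. 1 \<le> \<theta> * real n" using \<theta> by real_asymp
    moreover have "\<forall>\<^sub>F n in sequentially. c * ln (real n) \<le> \<theta> * real n / 2" using c \<theta> by real_asymp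
    moreover have "\<forall>\<^sub>F n in sequentially. c * ln (real n) \<le> real n / 2" using c by real_asymp
    ultimately show "\<forall>\<^sub>F n in sequentially. \<forall>p :: real. 0 \<le> p \<longrightarrow> p \<le> 1 \<longrightarrow> 1 + \<epsilon> \<le> p * n \<and> p * n \<le> c * ln n \<longrightarrow>
      measure_pmf.prob (Gnp n p) {g. \<not> (has_pendant_path (\<delta> * r * n) (nat \<lfloor>c * ln n / (p * n)\<rfloor>) n g)} \<le> h n"
    proof (eventually_elim, intro allI impI)
      fix n and p :: real
      assume g1: "\<forall>p. 0 \<le> p \<and> p \<le> 1 \<and> 1 + \<epsilon> / 2 \<le> p * real (n1 n) \<longrightarrow>
          measure_pmf.prob (Gnp (n1 n) p) {g. \<not> (\<exists>Q. iscomp g {1..n1 n} Q \<and> \<delta> * n1 n \<le> card Q)} \<le> f (n1 n)"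
        and n: "1 \<le> \<theta> * real n" "c * ln (real n) \<le> \<theta> * real n / 2" "c * ln (real n) \<le> real n / 2"
        and p: "0 \<le> p" "p \<le> 1" "1 + \<epsilon> \<le> p * n \<and> p * n \<le> c * ln n"
      define k where "k = nat \<lfloor>c * ln n / (p * n)\<rfloor>"
      let ?V = "{1..n}" and ?V1 = "{1..n1 n}" and ?W = "{Suc (n1 n)..n}"
      let ?A = "inner_pairs ?V1"
      \<comment> \<open>The pairs with at least one endpoint outside the first round;
        \<open>meeting ?V U\<close> lies in R for every U among the remaining vertices.\<close>
      define R where "R = inner_pairs ?V - ?A"
      define E where "E = (\<lambda>g. has_pendant_path (\<delta> * r * n) k n g)"
      define comb where "comb = (\<lambda>(f :: nat \<times> nat \<Rightarrow> bool, g) x. if x \<in> ?A then f x else g x)"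
      have npos: "real n > 0" using n by (cases n) auto
      have d: "p * n \<ge> 1" using p \<epsilon> by linarith
      have ppos: "p > 0" using d p by (cases "p = 0") auto
      have p2: "p \<le> 1 / 2"
      proof -
        have "p * n \<le> 1 / 2 * n" using p n by linarith
        then show ?thesis using npos by (simp only: mult_le_cancel_right_pos)
      qed
      have "n - n1 n \<ge> \<theta> * n" "n1 n \<le> n"
      proof -
        have "\<theta> * n = (n - r * n) / 2" by (simp add: \<theta>_def algebra_simps)
        then have "r * real n = n - 2 * (\<theta> * n)" by simp
        then have "real (n1 n) \<le> n - 2 * (\<theta> * n) + 1" using n1(2)[of n] by simp
        then have "real (n1 n) \<le> n - \<theta> * n" using n(1) by simp
        moreover have "\<theta> * n \<ge> 0" using \<theta> by simp
        ultimately show "n1 n \<le> n" by linarith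
        then show "n - n1 n \<ge> \<theta> * n" using \<open>real (n1 n) \<le> n - \<theta> * n\<close> by (simp add: of_nat_diff)
      qed
      then have cW: "\<theta> * n \<le> card ?W" and V1: "?V1 \<subseteq> ?V" by auto
      have kd: "p * n * k \<le> c * ln n"
      proof -
        have "0 \<le> c * ln n / (p * n)" using p d by (intro divide_nonneg_nonneg) linarith+
        then have "real k \<le> c * ln n / (p * n)" unfolding k_def by linarith
        then have "p * n * k \<le> p * n * (c * ln n / (p * n))" using d by (intro mult_left_mono) auto
        also have "\<dots> = c * ln n" using d npos by (intro nonzero_mult_div_cancel_left[THEN trans[OF times_divide_eq_right]]) auto
        finally show ?thesis .
      qed
      have kc: "real k \<le> c * ln n"
      proof -
        have "1 * real k \<le> p * n * k" using d by (intro mult_right_mono) auto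
        then show ?thesis using kd by linarith
      qed
      have p1: "1 + \<epsilon> / 2 \<le> p * n1 n"
      proof -
        have "1 + \<epsilon> / 2 = r * (1 + \<epsilon>)" using r by simp
        also have "\<dots> \<le> r * (p * n)" using r p by (intro mult_left_mono) auto
        also have "\<dots> = p * (r * n)" by simp
        also have "\<dots> \<le> p * n1 n" using n1 p by (intro mult_left_mono) auto
        finally show ?thesis .
      qed
      have "inner_pairs ?V = ?A \<union> R" using inner_pairs_mono[OF V1] by (auto simp: R_def)
      then have "Gnp n p = map_pmf comb (pair_pmf (Gnp (n1 n) p) (rbits R p))"
        unfolding Gnp_eq_rbits comb_def using rbits_union[of ?A R p] by (simp add: R_def)
      then have "measure_pmf.prob (Gnp n p) {g. \<not> E g} = measure_pmf.prob (pair_pmf (Gnp (n1 n) p) (rbits R p)) {z. \<not> E (comb z)}"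
        by (simp add: vimage_def)
      also have "\<dots> \<le> measure_pmf.prob (pair_pmf (Gnp (n1 n) p) (rbits R p)) {z. \<not> (\<exists>Q. iscomp (fst z) ?V1 Q \<and> \<delta> * n1 n \<le> card Q)
         \<or> ((\<exists>Q. iscomp (fst z) ?V1 Q \<and> \<delta> * n1 n \<le> card Q) \<and> \<not> E (comb (fst z, snd z)))}"
        by (intro prob_mono_support) auto
      also have "\<dots> \<le> measure_pmf.prob (pair_pmf (Gnp (n1 n) p) (rbits R p)) {z. \<not> (\<exists>Q. iscomp (fst z) ?V1 Q \<and> \<delta> * n1 n \<le> card Q)} +
         measure_pmf.prob (pair_pmf (Gnp (n1 n) p) (rbits R p)) {z. (\<exists>Q. iscomp (fst z) ?V1 Q \<and> \<delta> * n1 n \<le> card Q) \<and> \<not> E (comb (fst z, snd z))}"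
        by (rule prob_disj_le)
      also have "measure_pmf.prob (pair_pmf (Gnp (n1 n) p) (rbits R p)) {z. \<not> (\<exists>Q. iscomp (fst z) ?V1 Q \<and> \<delta> * n1 n \<le> card Q)} =
          measure_pmf.prob (Gnp (n1 n) p) {g. \<not> (\<exists>Q. iscomp g ?V1 Q \<and> \<delta> * n1 n \<le> card Q)}"
        using prob_pair_pmf[of "Gnp (n1 n) p" "rbits R p" "\<lambda>g. \<not> (\<exists>Q. iscomp g ?V1 Q \<and> \<delta> * n1 n \<le> card Q)" "\<lambda>_. True"] by simp
      also have "\<dots> \<le> f (n1 n)" using g1 p p1 by blast
      also have "measure_pmf.prob (pair_pmf (Gnp (n1 n) p) (rbits R p)) {z. (\<exists>Q. iscomp (fst z) ?V1 Q \<and> \<delta> * n1 n \<le> card Q) \<and> \<not> E (comb (fst z, snd z))}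
         \<le> 1 / m n + (exp (2 * (c * ln (real n))\<^sup>2 / n) - 1)"
      proof (rule prob_pair_conditional)
        have mpos: "m n > 0" using \<delta> r npos by (simp add: m_def)
        then show "0 \<le> 1 / m n + (exp (2 * (c * ln (real n))\<^sup>2 / n) - 1)" by simp
        fix f1 assume "\<exists>Q. iscomp f1 ?V1 Q \<and> \<delta> * n1 n \<le> card Q"
        then obtain Q where Q: "iscomp f1 ?V1 Q" "\<delta> * n1 n \<le> card Q" by blast
        have QV: "Q \<subseteq> ?V1" "Q \<inter> ?W = {}" "Q \<subseteq> ?V" using Q V1 by (auto simp: iscomp_def)
        have meetR: "meeting ?V U \<subseteq> R" if "U \<subseteq> ?W" for U
          using that by (auto simp: R_def meeting_def inner_pairs_def)
        have Qcard: "(\<delta> * r) * n \<le> card Q"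
        proof -
          have "\<delta> * (r * n) \<le> \<delta> * n1 n" using n1(1)[of n] \<delta> by (intro mult_left_mono) auto
          then show ?thesis using Q(2) by (simp add: mult.assoc)
        qed
        have "measure_pmf.prob (rbits R p) {g2. \<not> E (comb (f1, g2))} \<le>
          measure_pmf.prob (rbits R p) {g2. \<not> (\<exists>zs\<in>path_lists Q ?W k. pendant_path ?V zs g2)}"
        proof (intro prob_mono_support notI)
          fix g2 assume nE: "\<not> E (comb (f1, g2))" and "\<exists>zs\<in>path_lists Q ?W k. pendant_path ?V zs g2"
          then obtain zs where zs: "zs \<in> path_lists Q ?W k" "pendant_path ?V zs g2" by blast
          have "comb (f1, g2) e = g2 e" if "e \<in> meeting ?V (set (tl zs))" for e
            using that meetR[OF path_lists_nth(5)[OF zs(1)]] by (auto simp: comb_def R_def)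
          then have "pendant_path ?V zs (comb (f1, g2))" using zs(2) by (auto simp: pendant_path_def)
          moreover have "conn (comb (f1, g2)) Q"
          proof (rule conn_mono[of f1 Q])
            show "conn f1 Q" using Q(1) by (simp add: iscomp_def)
            fix e assume "e \<in> inner_pairs Q" "f1 e"
            moreover have "e \<in> ?A" using inner_pairs_mono[OF QV(1)] \<open>e \<in> inner_pairs Q\<close> by blast
            ultimately show "comb (f1, g2) e" unfolding comb_def by (simp only: case_prod_conv if_True)
          qed
          moreover have "?W \<subseteq> ?V" by auto
          ultimately have "E (comb (f1, g2))" unfolding E_def using QV Qcard zs(1)
            by (intro exI[of _ Q] exI[of _ ?W]) (rule exI[of _ zs], simp)
          then show False using nE by simp
        qed
        also have "\<dots> \<le> 1 / m n + (exp (2 * p * (real k)\<^sup>2) - 1)"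
        proof (rule no_pendant_path_prob[OF _ meetR ppos p2 _ _ QV(2,3)])
          show "k \<le> card ?W" using kc n cW by linarith
          have half: "\<theta> * n / 2 \<le> real (card ?W) - k" using kc n cW by linarith
          have "exp (- (p * n * k) * ln (2 / \<theta>)) \<le> (\<theta> / 2) ^ k"
          proof -
            have "k * ln (2 / \<theta>) \<le> (p * n * k) * ln (2 / \<theta>)"
              using ln\<theta> mult_right_mono[OF d, of "real k"] by (intro mult_right_mono) auto
            then have "exp (- (p * n * k) * ln (2 / \<theta>)) \<le> exp (k * ln (\<theta> / 2))" using \<theta> by (simp add: ln_div algebra_simps)
            then show ?thesis using \<theta> by (simp add: exp_of_nat_mult)
          qed
          also have "(\<theta> / 2) ^ k \<le> (\<theta> * n / 2 * p) ^ k"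
          proof (rule power_mono)
            have "\<theta> / 2 * 1 \<le> \<theta> / 2 * (p * n)" using d \<theta> by (intro mult_left_mono) auto
            then show "\<theta> / 2 \<le> \<theta> * n / 2 * p" by (simp add: mult_ac)
          qed (use \<theta> in auto)
          also have "\<dots> = (\<theta> * n / 2) ^ k * p ^ k" by (rule power_mult_distrib)
          also have "\<dots> \<le> (real (card ?W) - k) ^ k * p ^ k"
            using half \<theta> p by (intro mult_right_mono power_mono) auto
          finally have 1: "exp (- (p * n * k) * ln (2 / \<theta>)) \<le> (real (card ?W) - k) ^ k * p ^ k" .
          have "(p * n * k) * (2 + ln (2 / \<theta>)) \<le> c * ln n * (2 + ln (2 / \<theta>))" using kd ln\<theta> by (intro mult_right_mono) auto
          also have "\<dots> = ln n / 2" 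
          proof -
            have "c * ln n * (2 + ln (2 / \<theta>)) = ln n * (c * (2 + ln (2 / \<theta>)))" by (simp only: mult_ac)
            then show ?thesis by (simp only: c(2))
          qed
          finally have "- ln n / 2 \<le> - (p * n * k) * ln (2 / \<theta>) + - (2 * p * n * k)" by (simp add: algebra_simps)
          then have "exp (- ln n / 2) \<le> exp (- (p * n * k) * ln (2 / \<theta>)) * exp (- (2 * p * n * k))"
            unfolding exp_add[symmetric] by simp
          also have "\<dots> \<le> (real (card ?W) - k) ^ k * p ^ k * exp (- (2 * p * n * k))"
            using 1 by (intro mult_right_mono) auto
          finally have "(\<delta> * r * n) * exp (- ln n / 2) \<le> card Q * ((real (card ?W) - k) ^ k * p ^ k * exp (- (2 * p * n * k)))"
            using Qcard by (intro mult_mono) auto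
          then show "m n \<le> card Q * (real (card ?W) - k) ^ k * (p ^ k * exp (- (2 * p * n * k)))"
            by (simp add: m_def mult_ac)
        qed (use mpos in \<open>auto simp: R_def\<close>)
        also have "\<dots> \<le> 1 / m n + (exp (2 * (c * ln (real n))\<^sup>2 / n) - 1)"
        proof -
          have "n * (p * (real k)\<^sup>2) = (p * n * k) * k" by (simp add: power2_eq_square)
          also have "\<dots> \<le> (c * ln n) * (c * ln n)" 
          proof (rule mult_mono[OF kd kc])
            show "0 \<le> c * ln (real n)" using kc by linarith
          qed simp
          finally have "p * (real k)\<^sup>2 \<le> (c * ln (real n))\<^sup>2 / n" using npos by (simp add: field_simps power2_eq_square)
          then show ?thesis by simp
        qed
        finally show "measure_pmf.prob (rbits R p) {g2. \<not> E (comb (f1, g2))} \<le> 1 / m n + (exp (2 * (c * ln (real n))\<^sup>2 / n) - 1)" .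
      qed
      finally show "measure_pmf.prob (Gnp n p) {g. \<not> (has_pendant_path (\<delta> * r * n) (nat \<lfloor>c * ln n / (p * n)\<rfloor>) n g)} \<le> h n"
        by (simp add: E_def k_def h_def)
    qed
  qed
  then show ?thesis using that[of c "\<delta> * r"] c \<delta> r by simp
qed

lemma whp_imp:
  assumes "whp (\<lambda>n p. R n p \<and> Q n p) E"
  shows "whp R (\<lambda>n p g. Q n p \<longrightarrow> E n p g)"
proof (rule whp_cases)
  show "whp (\<lambda>n p. R n p \<and> Q n p) (\<lambda>n p g. Q n p \<longrightarrow> E n p g)"
    by (rule whp_mono[OF assms]) auto
  show "whp (\<lambda>n p. R n p \<and> \<not> Q n p) (\<lambda>n p g. Q n p \<longrightarrow> E n p g)"
    by (rule whpI[of "\<lambda>_. 0"]) auto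
qed

section \<open>The two bounds\<close>

text \<open>The boundary is of order d |S| and the volume at most of order max(L, d) |S|; this
  identity turns their quotient into min(d / L, 1).\<close>

lemma min_max_product:
  fixes d L :: real
  assumes "L > 0" "d > 0"
  shows "min (d / L) 1 * max L d = d"
  using assms by (auto simp: min_def max_def)

lemma vol_le_max_degree:
  fixes \<Delta> :: real
  assumes C: "iscomp g V C" "finite V" and S: "S \<subseteq> C" and \<Delta>: "\<And>v. v \<in> V \<Longrightarrow> real (cut g V {v}) \<le> \<Delta>"
  shows "vol g C S \<le> card S * \<Delta>"
proof -
  have CV: "C \<subseteq> V" "finite C" using C finite_subset[of C V] by (auto simp: iscomp_def)
  have "real (vol g C S) = (\<Sum>v\<in>S. real (cut g C {v}))" using vol_eq_sum[OF CV(2) S] by simp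
  also have "\<dots> = (\<Sum>v\<in>S. real (cut g V {v}))" using S by (intro sum.cong) (auto simp: cut_comp_eq[OF C])
  also have "\<dots> \<le> (\<Sum>v\<in>S. \<Delta>)" using \<Delta> S CV by (intro sum_mono) auto
  finally show ?thesis by simp
qed

text \<open>The deterministic core of the lower bound: the random events enter as hypotheses for
  this one S. The two middle ranges compare a boundary of order d |S| with the degree bound, while
  the extreme ranges estimate the volume by edge counts.\<close>

lemma connected_set_expansion:
  fixes a a1 \<delta> C0 D m d L p :: real
  assumes comp: "iscomp g {1..n} C" and S: "S \<subseteq> C" "conn g S" "2 * card S \<le> card C"
    and n: "n > 0" and d: "d = p * n" "d \<ge> 1" and L: "L > 0"
    and expand: "C0 * L \<le> d * card S \<Longrightarrow> card S \<le> \<delta> * n \<Longrightarrow> 4 * p * card S \<le> 1 \<Longrightarrow> a1 * (d * card S) < cut g {1..n} S"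
    and dense: "D \<le> d \<Longrightarrow> 1 \<le> 4 * p * card S \<Longrightarrow> d * card S / 8 < cut g {1..n} S"
    and degree: "\<And>v. v \<in> {1..n} \<Longrightarrow> cut g {1..n} {v} < 4 * max L d"
    and sparse: "d * card S \<le> C0 * L \<Longrightarrow> cnt (inner_pairs S) g < 3 * card S"
    and edges: "cnt (pairs n) g \<le> d * n"
    and nocut: "d \<le> D \<Longrightarrow> \<not> sparse_cut_pair n (1 / (4 * D) * n) (m * (n / L)) g"
    and D: "D \<ge> 1" "1 / (4 * D) \<le> \<delta>" and C0: "C0 > 0"
    and a: "0 < a" "a \<le> 1 / (7 * C0)" "4 * a \<le> a1" "4 * a \<le> 1 / 8" "2 * a * D\<^sup>2 \<le> m"
  shows "a * min (d / L) 1 * vol g C S \<le> cut g C S"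
proof -
  let ?V = "{1..n}"
  have CV: "C \<subseteq> ?V" "finite C" "conn g C" using comp finite_subset[of C ?V] by (auto simp: iscomp_def)
  have finS: "finite S" using S CV finite_subset by auto
  have Sne: "S \<noteq> {}" using S by (auto simp: conn_def)
  have k: "card S \<ge> 1" using Sne finS by (simp add: Suc_le_eq card_gt_0_iff)
  have SC: "S \<noteq> C" using S k by auto
  have cutV: "cut g ?V S = cut g C S" using cut_comp_eq[OF comp _ S(1)] by simp
  have cut1: "cut g C S \<ge> 1" using conn_cut_pos[OF CV(3,2) S(1) Sne SC] by simp
  define M where "M = min (d / L) 1"
  have M: "0 < M" "M \<le> d / L" "M \<le> 1" using d L by (auto simp: M_def)
  have degbound: "a * M * vol g C S \<le> x * (d * card S)" if "4 * a \<le> x" for x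
  proof -
    have "vol g C S \<le> card S * (4 * max L d)" using degree by (intro vol_le_max_degree[OF comp _ S(1)]) (auto intro: less_imp_le)
    then have "a * M * vol g C S \<le> a * M * (card S * (4 * max L d))" using a M by (intro mult_left_mono) auto
    also have "\<dots> = 4 * a * (card S * (M * max L d))" by simp
    also have "M * max L d = d" unfolding M_def using L d by (intro min_max_product) auto
    also have "4 * a * (card S * d) \<le> x * (card S * d)" using that d by (intro mult_right_mono) auto
    finally show ?thesis by (simp add: mult_ac)
  qed
  \<comment> \<open>For d \<ge> D, 4 p |S| \<le> 1 already implies |S| \<le> n / (4 D) \<le>
    \<delta> n. For d \<le> D, a failure of either size condition implies |S| \<ge> n / (4
    D).\<close>
  consider "d * card S \<le> C0 * L" | "C0 * L \<le> d * card S" "card S \<le> \<delta> * n" "4 * p * card S \<le> 1" |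
     "D \<le> d" "1 \<le> 4 * p * card S" | "d \<le> D" "1 / (4 * D) * n \<le> card S"
  proof -
    have "1 / (4 * D) * n \<le> card S" if "d \<le> D" "1 < 4 * p * card S \<or> \<delta> * n < card S"
    proof -
      have "1 / (4 * D) * n \<le> \<delta> * n" using D by (intro mult_right_mono) auto
      moreover have "1 / (4 * D) * n \<le> card S" if "1 < 4 * p * card S"
      proof -
        have "real n * 1 \<le> n * (4 * p * card S)" using that by (intro mult_left_mono) auto
        also have "\<dots> = 4 * d * card S" by (simp add: d)
        also have "\<dots> \<le> 4 * D * card S" using \<open>d \<le> D\<close> by (intro mult_right_mono) auto
        finally show ?thesis using D by (simp add: field_simps)
      qed
      ultimately show ?thesis using that by linarith
    qed
    moreover have "4 * p * card S \<le> 1 \<longrightarrow> card S \<le> \<delta> * n" if "D \<le> d"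
    proof
      assume "4 * p * card S \<le> 1"
      then have "real n * (4 * p * card S) \<le> real n * 1" by (intro mult_left_mono) auto
      then have "4 * d * card S \<le> n" by (simp add: d mult_ac)
      moreover have "4 * D * card S \<le> 4 * d * card S" using that by (intro mult_right_mono) auto
      ultimately have "card S \<le> 1 / (4 * D) * n" using D by (simp add: field_simps)
      also have "\<dots> \<le> \<delta> * n" using D by (intro mult_right_mono) auto
      finally show "card S \<le> \<delta> * n" .
    qed
    ultimately show ?thesis using that by (meson less_imp_le linear not_le)
  qed
  then have "a * M * vol g C S \<le> cut g C S"
  proof cases
    case 1
    \<comment> \<open>A single boundary edge is enough here: the volume is at most 7 |S| times the
      cut, and 1 / (7 |S|) is at least d / (7 C0 L).\<close>
    have "vol g C S \<le> 6 * card S + cut g C S" using sparse[OF 1] by (simp add: vol_def)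
    also have "\<dots> \<le> 7 * card S * cut g C S"
    proof -
      have "6 * card S * 1 \<le> 6 * card S * cut g C S" using cut1 by (intro mult_left_mono) auto
      moreover have "1 * cut g C S \<le> card S * cut g C S" using k by (intro mult_right_mono) auto
      ultimately show ?thesis by linarith
    qed
    finally have v: "real (vol g C S) \<le> 7 * real (card S) * cut g C S" by (metis of_nat_le_iff of_nat_mult of_nat_numeral)
    have "a * M * vol g C S \<le> (1 / (7 * C0)) * (d / L) * (7 * real (card S) * cut g C S)"
      using a M v d L C0 by (intro mult_mono mult_nonneg_nonneg) auto
    also have "\<dots> = (d * card S) / (C0 * L) * cut g C S" using C0 L by (simp add: field_simps)
    also have "\<dots> \<le> 1 * real (cut g C S)" using 1 C0 L by (intro mult_right_mono) auto
    finally show ?thesis by simp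
  next
    case 2
    then show ?thesis using expand[OF 2] degbound[OF a(3)] cutV by simp
  next
    case 3
    then show ?thesis using dense[OF 3] degbound[OF a(4)] cutV by simp
  next
    case 4
    let ?T = "C - S"
    have "card ?T \<ge> card S" using S finS by (simp add: card_Diff_subset)
    then have cT: "1 / (4 * D) * n \<le> card ?T" using 4 by linarith
    have cutT: "cut g ?V ?T = cut g C S"
      using cut_comp_eq[OF comp, of ?T] cut_compl[OF S(1), of g] by simp
    have "\<not> cut g C S \<le> m * (n / L)"
    proof
      assume "cut g C S \<le> m * (n / L)"
      then have "S \<inter> ?T = {} \<and> 1 / (4 * D) * n \<le> real (card S) \<and> 1 / (4 * D) * n \<le> real (card ?T) \<and>
          iscomp g ?V C \<and> S \<subseteq> C \<and> iscomp g ?V C \<and> ?T \<subseteq> C \<and> real (cut g ?V S) \<le> m * (n / L) \<and> real (cut g ?V ?T) \<le> m * (n / L)"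
        using 4 cT comp S cutV cutT by auto
      then have "sparse_cut_pair n (1 / (4 * D) * n) (m * (n / L)) g" unfolding sparse_cut_pair_def by blast
      then show False using nocut 4 by simp
    qed
    \<comment> \<open>All edges together give volume at most 2 D n, and M is at most D / L, so n / L
      boundary edges up to a constant are sufficient.\<close>
    moreover have "a * M * vol g C S \<le> m * (n / L)"
    proof -
      have "vol g C S \<le> 2 * cnt (pairs n) g"
      proof -
        have "vol g C S \<le> vol g C C" using vol_compl[OF CV(2) S(1), of g] by simp
        also have "\<dots> \<le> 2 * cnt (pairs n) g"
          unfolding vol_whole pairs_eq using inner_pairs_mono[OF CV(1)] by (simp add: cnt_mono)
        finally show ?thesis .
      qed
      then have "real (vol g C S) \<le> 2 * (d * n)" using edges by linarith
      also have "\<dots> \<le> 2 * (D * n)" using 4 by (simp add: mult_right_mono)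
      finally have "real (vol g C S) \<le> 2 * (D * n)" .
      moreover have "M \<le> D / L" using M 4 L divide_right_mono[of d D L] by linarith
      ultimately have "a * M * vol g C S \<le> a * (D / L) * (2 * (D * n))" using a M D L by (intro mult_mono) auto
      also have "\<dots> = 2 * a * D\<^sup>2 * (n / L)" by (simp add: power2_eq_square)
      also have "\<dots> \<le> m * (n / L)" using a L by (intro mult_right_mono) auto
      finally show ?thesis .
    qed
    ultimately show ?thesis by linarith
  qed
  then show ?thesis by (simp add: M_def)
qed

lemma whp_conductance_lower:
  fixes \<epsilon> :: real
  assumes \<epsilon>: "\<epsilon> > 0"
  obtains a :: real where "a > 0" "whp (\<lambda>n p. 1 + \<epsilon> \<le> p * n) (\<lambda>n p g. \<forall>C. iscomp g {1..n} C \<longrightarrow> 2 \<le> card C \<longrightarrow>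
     a * min (p * n / ln n) 1 \<le> conductance (adj g) C)"
proof -
  obtain a1 \<delta> C0 :: real where c: "0 < a1" "0 < \<delta>" "0 < C0" and
    T1: "whp (\<lambda>n p. 1 + \<epsilon> \<le> p * n) (\<lambda>n p g. connected_expansion a1 C0 \<delta> n p g)"
    using whp_connected_expansion[OF \<epsilon>] by blast
  obtain D0 where D0: "\<And>D. D \<ge> D0 \<Longrightarrow>
    whp (\<lambda>n p. D \<le> p * n) (\<lambda>n p g. dense_expansion n p g)" using whp_dense_expansion by blast
  define D where "D = max D0 (max 1 (1 / (4 * \<delta>)))"
  have D: "D \<ge> 1" "1 / (4 * \<delta>) \<le> D" "D \<ge> D0" by (auto simp: D_def)
  have D\<delta>: "1 / (4 * D) \<le> \<delta>" using D c by (simp add: field_simps)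
  define \<delta>' where "\<delta>' = 1 / (4 * D)"
  have \<delta>': "0 < \<delta>'" "\<delta>' \<le> 1" using D by (auto simp: \<delta>'_def)
  \<comment> \<open>One bound for each range of sizes: small sets, sparse connected sets, dense
    sets, and linear sets with bounded d.\<close>
  define a where "a = min (min (1 / (7 * C0)) (a1 / 4)) (min (1 / 32) (\<delta>' / 32 / (2 * D\<^sup>2)))"
  have a: "0 < a" "a \<le> 1 / (7 * C0)" "4 * a \<le> a1" "4 * a \<le> 1 / 8" "2 * a * D\<^sup>2 \<le> \<delta>' / 32"
  proof -
    show "0 < a" using c \<delta>' D by (auto simp: a_def)
    have "a \<le> a1 / 4" "a \<le> 1 / 32" "a \<le> \<delta>' / 32 / (2 * D\<^sup>2)" by (auto simp: a_def)
    then show "4 * a \<le> a1" "4 * a \<le> 1 / 8" "2 * a * D\<^sup>2 \<le> \<delta>' / 32" using D by (auto simp: field_simps)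
    show "a \<le> 1 / (7 * C0)" by (simp add: a_def)
  qed
  have T2: "whp (\<lambda>n p. 1 + \<epsilon> \<le> p * n) (\<lambda>n p g. D \<le> p * n \<longrightarrow> (dense_expansion n p g))"
    by (rule whp_imp, rule whp_mono[OF D0[OF D(3)]]) auto
  have T3: "whp (\<lambda>n p. 1 + \<epsilon> \<le> p * n) (\<lambda>n p g. \<forall>v\<in>{1..n}. cut g {1..n} {v} < 4 * max (ln n) (p * n))"
    using \<epsilon> by (intro whp_mono[OF whp_max_degree]) auto
  have T4: "whp (\<lambda>n p. 1 + \<epsilon> \<le> p * n) (\<lambda>n p g. \<forall>S\<subseteq>{1..n}. S \<noteq> {} \<and> p * n * card S \<le> C0 * ln n \<longrightarrow>
      cnt (inner_pairs S) g < 3 * card S)"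
    using \<epsilon> by (intro whp_mono[OF whp_small_sets_sparse[OF c(3)]]) auto
  have T5: "whp (\<lambda>n p. 1 + \<epsilon> \<le> p * n) (\<lambda>n p g. cnt (pairs n) g \<le> p * n * n)"
    using \<epsilon> by (intro whp_mono[OF whp_edge_count]) auto
  have T6: "whp (\<lambda>n p. 1 + \<epsilon> \<le> p * n) (\<lambda>n p g. p * n \<le> D \<longrightarrow> \<not> sparse_cut_pair n (\<delta>' * n) (\<delta>' / 32 * (n / ln n)) g)"
    by (rule whp_imp, rule whp_no_sparse_cut_pair[OF \<epsilon> D(1) \<delta>'])
  have "whp (\<lambda>n p. 1 + \<epsilon> \<le> p * n) (\<lambda>n p g. \<forall>C. iscomp g {1..n} C \<longrightarrow> 2 \<le> card C \<longrightarrow>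
     a * min (p * n / ln n) 1 \<le> conductance (adj g) C)"
  proof (rule whp_mono[OF whp_conj[OF T1 whp_conj[OF T2 whp_conj[OF T3 whp_conj[OF T4 whp_conj[OF T5 T6]]]]]])
    have "\<forall>\<^sub>F n in sequentially. ln (real n) > 0" by real_asymp
    then show "\<forall>\<^sub>F n in sequentially. \<forall>(p :: real) g. 0 \<le> p \<longrightarrow> p \<le> 1 \<longrightarrow> 1 + \<epsilon> \<le> p * n \<longrightarrow> graph_on n g \<longrightarrow>
      (connected_expansion a1 C0 \<delta> n p g) \<and>
      (D \<le> p * n \<longrightarrow> (dense_expansion n p g)) \<and>
      (\<forall>v\<in>{1..n}. cut g {1..n} {v} < 4 * max (ln n) (p * n)) \<and>
      (\<forall>S\<subseteq>{1..n}. S \<noteq> {} \<and> p * n * card S \<le> C0 * ln n \<longrightarrow> cnt (inner_pairs S) g < 3 * card S) \<and>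
      cnt (pairs n) g \<le> p * n * n \<and> (p * n \<le> D \<longrightarrow> \<not> sparse_cut_pair n (\<delta>' * n) (\<delta>' / 32 * (n / ln n)) g) \<longrightarrow>
      (\<forall>C. iscomp g {1..n} C \<longrightarrow> 2 \<le> card C \<longrightarrow> a * min (p * n / ln n) 1 \<le> conductance (adj g) C)"
    proof (rule eventually_mono, intro allI impI, elim conjE)
      fix n g C and p :: real
      assume L: "0 < ln (real n)" and p: "0 \<le> p" "p \<le> 1" "1 + \<epsilon> \<le> p * n" and gr: "graph_on n g"
        and E1: "connected_expansion a1 C0 \<delta> n p g"
        and E2: "D \<le> p * n \<longrightarrow> (dense_expansion n p g)"
        and E3: "\<forall>v\<in>{1..n}. cut g {1..n} {v} < 4 * max (ln n) (p * n)"
        and E4: "\<forall>S\<subseteq>{1..n}. S \<noteq> {} \<and> p * n * card S \<le> C0 * ln n \<longrightarrow> cnt (inner_pairs S) g < 3 * card S"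
        and E5: "cnt (pairs n) g \<le> p * n * n"
        and E6: "p * n \<le> D \<longrightarrow> \<not> sparse_cut_pair n (\<delta>' * n) (\<delta>' / 32 * (n / ln n)) g"
        and C: "iscomp g {1..n} C" "2 \<le> card C"
      have CV: "C \<subseteq> {1..n}" "conn g C" "finite C" using C finite_subset[of C "{1..n}"] by (auto simp: iscomp_def)
      have d1: "p * n \<ge> 1" using p \<epsilon> by linarith
      have cardC: "card C \<le> n" using card_mono[OF _ CV(1)] by simp
      show "a * min (p * n / ln n) 1 \<le> conductance (adj g) C"
      proof (rule conductance_ge[OF gr CV(3,2) C(2)])
        show "0 \<le> a * min (p * n / ln n) 1" using a d1 L by (intro mult_nonneg_nonneg) auto
        fix S assume S: "S \<subseteq> C" "conn g S" "2 * card S \<le> card C"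
        have SV: "S \<subseteq> {1..n}" "S \<noteq> {}" "2 * card S \<le> n" using S CV cardC by (auto simp: conn_def)
        show "a * min (p * n / ln n) 1 * vol g C S \<le> cut g C S"
        proof (rule connected_set_expansion[OF C(1) S _ refl d1 L _ _ _ _ _ _ D(1) D\<delta> c(3) a])
          show "n > 0" using L by (cases n) auto
          show "a1 * (p * n * card S) < cut g {1..n} S"
            if "C0 * ln n \<le> p * n * card S" "card S \<le> \<delta> * n" "4 * p * card S \<le> 1"
            using E1 SV S that by blast
          show "p * n * card S / 8 < cut g {1..n} S" if "D \<le> p * n" "1 \<le> 4 * p * card S"
            using E2 SV that by blast
          show "cut g {1..n} {v} < 4 * max (ln n) (p * n)" if "v \<in> {1..n}" for v using E3 that by blast
          show "cnt (inner_pairs S) g < 3 * card S" if "p * n * card S \<le> C0 * ln n" using E4 SV that by blast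
          show "cnt (pairs n) g \<le> p * n * n" by (rule E5)
          show "\<not> sparse_cut_pair n (1 / (4 * D) * n) (\<delta>' / 32 * (n / ln n)) g" if "p * n \<le> D"
            using E6 that unfolding \<delta>'_def by blast
        qed
      qed
    qed
  qed auto
  then show ?thesis using that[of a] a by blast
qed

text \<open>A single vertex admits no S with stationary mass strictly between 0 and 1; a component
  of linear size excludes this degenerate case.\<close>

lemma whp_largest_component_ge_2:
  fixes \<epsilon> :: real
  assumes \<epsilon>: "\<epsilon> > 0"
  shows "whp (\<lambda>n p. 1 + \<epsilon> \<le> p * n) (\<lambda>n p g. \<forall>C. largest_component n g C \<longrightarrow> iscomp g {1..n} C \<and> 2 \<le> card C)"
proof -
  obtain \<delta> :: real where \<delta>: "\<delta> > 0" and giant: "whp (\<lambda>n p. 1 + \<epsilon> \<le> p * n) (\<lambda>n p g. has_component (\<delta> * n) n g)"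
    using whp_giant[OF \<epsilon>] by blast
  show ?thesis
  proof (rule whp_mono[OF giant])
    have "\<forall>\<^sub>F n in sequentially. 2 \<le> \<delta> * real n" using \<delta> by real_asymp
    then show "\<forall>\<^sub>F n in sequentially. \<forall>(p :: real) g. 0 \<le> p \<longrightarrow> p \<le> 1 \<longrightarrow> 1 + \<epsilon> \<le> p * n \<longrightarrow> graph_on n g \<longrightarrow>
      (has_component (\<delta> * n) n g) \<longrightarrow> (\<forall>C. largest_component n g C \<longrightarrow> iscomp g {1..n} C \<and> 2 \<le> card C)"
    proof (rule eventually_mono, intro allI impI)
      fix n g C and p :: real
      assume n: "2 \<le> \<delta> * real n" and gr: "graph_on n g" and Q: "has_component (\<delta> * n) n g"
        and C: "largest_component n g C"
      obtain Q where Q: "iscomp g {1..n} Q" "\<delta> * n \<le> card Q" using Q by blast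
      then have "card Q \<le> card C" using C by (auto simp: largest_component_def component_iff_iscomp[OF gr])
      then have "2 \<le> card C" using Q n by linarith
      then show "iscomp g {1..n} C \<and> 2 \<le> card C" using C by (auto simp: largest_component_def component_iff_iscomp[OF gr])
    qed
  qed auto
qed

text \<open>A pendant path U has at most one boundary edge and volume at least k, which gives
  conductance at most 2 / k. If p n > c ln n the target is bounded below by a constant, and the
  trivial bound 2 is enough.\<close>

lemma whp_conductance_upper:
  fixes \<epsilon> :: real
  assumes \<epsilon>: "\<epsilon> > 0"
  obtains b :: real where "b > 0" "whp (\<lambda>n p. 1 + \<epsilon> \<le> p * n) (\<lambda>n p g. \<forall>C. largest_component n g C \<longrightarrow>
     conductance (adj g) C \<le> b * min (p * n / ln n) 1)"
proof -
  obtain c \<delta> :: real where c: "c > 0" and \<delta>: "\<delta> > 0" and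
    path: "whp (\<lambda>n p. 1 + \<epsilon> \<le> p * n \<and> p * n \<le> c * ln n) (\<lambda>n p g. has_pendant_path (\<delta> * n) (nat \<lfloor>c * ln n / (p * n)\<rfloor>) n g)"
    using whp_pendant_path[OF \<epsilon>] by blast
  have T1: "whp (\<lambda>n p. 1 + \<epsilon> \<le> p * n) (\<lambda>n p g. p * n \<le> c * ln n \<longrightarrow> (has_pendant_path (\<delta> * n) (nat \<lfloor>c * ln n / (p * n)\<rfloor>) n g))"
    by (rule whp_imp[OF path])
  define \<delta>' where "\<delta>' = min \<delta> 1"
  have \<delta>': "0 < \<delta>'" "\<delta>' \<le> 1" "\<delta>' \<le> \<delta>" using \<delta> by (auto simp: \<delta>'_def)
  note T2 = whp_giant_unique[OF \<epsilon> \<delta>'(1,2)]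
  \<comment> \<open>Rounding x = c ln n / (p n) \<ge> 1 down to k loses at most a factor 2, so 2 / k
    \<le> 4 / x. The same 4 / c covers the case p n > c ln n, and the 2 covers the minimum being
    1.\<close>
  define b where "b = max (4 / c) 2"
  have b: "b \<ge> 2" "b \<ge> 4 / c" by (auto simp: b_def)
  have "whp (\<lambda>n p. 1 + \<epsilon> \<le> p * n) (\<lambda>n p g. \<forall>C. largest_component n g C \<longrightarrow>
     conductance (adj g) C \<le> b * min (p * n / ln n) 1)"
  proof (rule whp_mono[OF whp_conj[OF T1 whp_conj[OF T2 whp_largest_component_ge_2[OF \<epsilon>]]]])
    have "\<forall>\<^sub>F n in sequentially. ln (real n) > 0" by real_asymp
    \<comment> \<open>It ensures 4 k \<le> |C|. As vol U \<le> 2 k and |C| \<le> vol C, the path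
      then has at most half of the volume.\<close>
    moreover have "\<forall>\<^sub>F n in sequentially. 4 * (c * ln (real n)) \<le> \<delta> * n" using c \<delta> by real_asymp
    ultimately show "\<forall>\<^sub>F n in sequentially. \<forall>(p :: real) g. 0 \<le> p \<longrightarrow> p \<le> 1 \<longrightarrow> 1 + \<epsilon> \<le> p * n \<longrightarrow> graph_on n g \<longrightarrow>
      (p * n \<le> c * ln n \<longrightarrow> (has_pendant_path (\<delta> * n) (nat \<lfloor>c * ln n / (p * n)\<rfloor>) n g)) \<and>
      (unique_component (\<delta>' * n) n g) \<and>
      (\<forall>C. largest_component n g C \<longrightarrow> iscomp g {1..n} C \<and> 2 \<le> card C) \<longrightarrow>
      (\<forall>C. largest_component n g C \<longrightarrow> conductance (adj g) C \<le> b * min (p * n / ln n) 1)"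
    proof (eventually_elim, intro allI impI, elim conjE)
      fix n g C and p :: real
      assume L: "0 < ln (real n)" and n: "4 * (c * ln (real n)) \<le> \<delta> * n" and p: "0 \<le> p" "p \<le> 1" "1 + \<epsilon> \<le> p * n" and gr: "graph_on n g"
        and E1: "p * n \<le> c * ln n \<longrightarrow> (has_pendant_path (\<delta> * n) (nat \<lfloor>c * ln n / (p * n)\<rfloor>) n g)"
        and E2: "unique_component (\<delta>' * n) n g"
        and E3: "\<forall>C. largest_component n g C \<longrightarrow> iscomp g {1..n} C \<and> 2 \<le> card C"
        and C: "largest_component n g C"
      let ?V = "{1..n}" and ?\<Phi> = "conductance (adj g) C"
      define k where "k = nat \<lfloor>c * ln n / (p * n)\<rfloor>"
      have comp: "iscomp g ?V C" "2 \<le> card C" using E3 C by auto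
      have CV: "C \<subseteq> ?V" "conn g C" "finite C" using comp finite_subset[of C ?V] by (auto simp: iscomp_def)
      have d1: "p * n \<ge> 1" using p \<epsilon> by linarith
      have \<Phi>2: "?\<Phi> \<le> 2" by (rule conductance_le_2[OF gr CV(3,2) comp(2)])
      have "?\<Phi> \<le> b * (p * n / ln n)"
      proof (cases "p * n \<le> c * ln n")
        case False
        then have "c \<le> p * n / ln n" using L by (simp add: field_simps)
        then have "4 / c * c \<le> b * (p * n / ln n)" using b c d1 L by (intro mult_mono) auto
        then show ?thesis using \<Phi>2 c by simp
      next
        case True
        then obtain Q W zs where Q: "Q \<inter> W = {}" "Q \<subseteq> ?V" "W \<subseteq> ?V" "conn g Q" "\<delta> * n \<le> card Q"
          and zs: "zs \<in> path_lists Q W k" "pendant_path ?V zs g"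
          using E1 unfolding k_def by blast
        have x1: "1 \<le> c * ln n / (p * n)" using True d1 by (simp add: le_divide_eq)
        have k: "1 \<le> k" "c * ln n / (p * n) \<le> 2 * real k" "real k \<le> c * ln n / (p * n)"
        proof -
          have "real k = of_int \<lfloor>c * ln n / (p * n)\<rfloor>" using x1 by (simp add: k_def)
          moreover have "1 \<le> \<lfloor>c * ln n / (p * n)\<rfloor>" using x1 by simp
          ultimately show "1 \<le> k" "c * ln n / (p * n) \<le> 2 * real k" "real k \<le> c * ln n / (p * n)" by linarith+
        qed
        obtain v where v: "v \<in> Q" using Q(4) by (auto simp: conn_def)
        have "v \<in> ?V" using v Q(2) by blast
        then obtain C1 where C1: "v \<in> C1" "iscomp g ?V C1" using ex_iscomp[of ?V v g] by blast
        have QC1: "Q \<subseteq> C1" using conn_subset_iscomp[OF Q(4,2) C1(2)] v C1 by auto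
        have "finite C1" using C1 finite_subset[of C1 ?V] by (auto simp: iscomp_def)
        then have "card Q \<le> card C1" using QC1 by (intro card_mono) auto
        then have big1: "\<delta> * n \<le> card C1" using Q(5) by linarith
        have "card C1 \<le> card C" using C C1 by (auto simp: largest_component_def component_iff_iscomp[OF gr])
        then have big: "\<delta> * n \<le> card C" using big1 by linarith
        have "\<delta>' * n \<le> \<delta> * n" using \<delta>' by (intro mult_right_mono) auto
        \<comment> \<open>The component of Q has at least \<delta> n vertices, hence so does the
          largest one; uniqueness makes them equal.\<close>
        then have "C = C1" using E2 comp(1) C1(2) big big1 by (meson order_trans)
        then have QC: "Q \<subseteq> C" using QC1 by simp
        let ?U = "set (tl zs)"
        note U = pendant_path_cut[OF zs(1) Q(1-3) _ zs(2)]
        have UC: "?U \<subseteq> C" using U(3)[OF _ comp(1) QC] by simp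
        have cutU: "cut g C ?U = cut g ?V ?U" using cut_comp_eq[OF comp(1) _ UC] by simp
        have volU: "vol g C ?U \<le> 2 * k" using U(2) cutU by (simp add: vol_def)
        have "(\<Sum>v\<in>?U. 1) \<le> (\<Sum>v\<in>?U. cut g C {v})"
          using conn_singleton_cut[OF CV(3,2) _ comp(2)] UC by (intro sum_mono) (auto simp: Suc_le_eq)
        then have volk: "k \<le> vol g C ?U" using path_lists_nth(6)[OF zs(1)] vol_eq_sum[OF CV(3) UC, of g] by simp
        have "4 * k \<le> card C"
        proof -
          have "c * ln n / (p * n) \<le> c * ln n / 1" using d1 c L by (intro divide_left_mono) auto
          then show ?thesis using k(3) n big by linarith
        qed
        then have "2 * vol g C ?U \<le> vol g C C" using volU card_le_vol[OF CV(3,2) comp(2)] by linarith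
        then have "?\<Phi> \<le> 2 * (cut g C ?U / vol g C ?U)"
          using volk k(1) by (intro conductance_le[OF gr CV(3) UC]) auto
        also have "\<dots> \<le> 2 * (1 / k)"
          using U(1) cutU volk k(1) by (intro mult_left_mono frac_le) auto
        also have "\<dots> \<le> 4 / c * (p * n / ln n)"
        proof -
          have "2 / y \<le> 4 / x" if "1 \<le> x" "x \<le> 2 * y" for x y :: real
            using that by (simp add: field_simps)
          from this[OF x1 k(2)] show ?thesis by simp
        qed
        also have "\<dots> \<le> b * (p * n / ln n)" using b d1 L by (intro mult_right_mono) auto
        finally show ?thesis .
      qed
      then show "?\<Phi> \<le> b * min (p * n / ln n) 1" using \<Phi>2 b by (auto simp: min_def)
    qed
  qed auto
  then show ?thesis using that[of b] b by simp
qed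

theorem mainTheorem5:
  fixes \<epsilon> :: real and p :: "nat \<Rightarrow> real"
  assumes "\<epsilon> > 0"
    and "\<And>n. 0 \<le> p n \<and> p n \<le> 1"
    and "\<forall>\<^sub>F n in sequentially. p n * real n \<ge> 1 + \<epsilon>"
  shows "\<exists>a b :: real. 0 < a \<and> a \<le> b \<and>
    (\<lambda>n. measure_pmf.prob (Gnp n (p n))
       {g. \<forall>C. largest_component n g C \<longrightarrow>
            a * min (p n * real n / ln (real n)) 1 \<le> conductance (adj g) C \<and>
            conductance (adj g) C \<le> b * min (p n * real n / ln (real n)) 1})
    \<longlonglongrightarrow> 1"
proof -
  obtain a :: real where a: "a > 0" and lower: "whp (\<lambda>n p. 1 + \<epsilon> \<le> p * n) (\<lambda>n p g. \<forall>C. iscomp g {1..n} C \<longrightarrow> 2 \<le> card C \<longrightarrow>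
     a * min (p * n / ln n) 1 \<le> conductance (adj g) C)" using whp_conductance_lower[OF assms(1)] by blast
  obtain b :: real where b: "b > 0" and upper: "whp (\<lambda>n p. 1 + \<epsilon> \<le> p * n) (\<lambda>n p g. \<forall>C. largest_component n g C \<longrightarrow>
     conductance (adj g) C \<le> b * min (p * n / ln n) 1)" using whp_conductance_upper[OF assms(1)] by blast
  \<comment> \<open>The upper constant \<open>max a b\<close> secures the required order of the
    constants without comparing a and b.\<close>
  define E where "E = (\<lambda>n p g. \<forall>C. largest_component n g C \<longrightarrow>
            a * min (p * real n / ln (real n)) 1 \<le> conductance (adj g) C \<and>
            conductance (adj g) C \<le> max a b * min (p * real n / ln (real n)) 1)"
  have "whp (\<lambda>n p. 1 + \<epsilon> \<le> p * n) E"
  proof (rule whp_mono[OF whp_conj[OF lower whp_conj[OF upper whp_largest_component_ge_2[OF assms(1)]]]])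
    show "\<forall>\<^sub>F n in sequentially. \<forall>(p :: real) g. 0 \<le> p \<longrightarrow> p \<le> 1 \<longrightarrow> 1 + \<epsilon> \<le> p * n \<longrightarrow> graph_on n g \<longrightarrow>
      (\<forall>C. iscomp g {1..n} C \<longrightarrow> 2 \<le> card C \<longrightarrow> a * min (p * n / ln n) 1 \<le> conductance (adj g) C) \<and>
      (\<forall>C. largest_component n g C \<longrightarrow> conductance (adj g) C \<le> b * min (p * n / ln n) 1) \<and>
      (\<forall>C. largest_component n g C \<longrightarrow> iscomp g {1..n} C \<and> 2 \<le> card C) \<longrightarrow> E n p g"
    proof (rule eventually_mono[OF eventually_ge_at_top[of 1]], intro allI impI)
      fix n g and p :: real
      assume n: "1 \<le> n" and p: "0 \<le> p" and H: "(\<forall>C. iscomp g {1..n} C \<longrightarrow> 2 \<le> card C \<longrightarrow> a * min (p * n / ln n) 1 \<le> conductance (adj g) C) \<and>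
        (\<forall>C. largest_component n g C \<longrightarrow> conductance (adj g) C \<le> b * min (p * n / ln n) 1) \<and>
        (\<forall>C. largest_component n g C \<longrightarrow> iscomp g {1..n} C \<and> 2 \<le> card C)"
      \<comment> \<open>Enlarging b to the maximum needs a nonnegative factor; at n = 1 the quotient
        is 0 because division by 0 gives 0.\<close>
      have "0 \<le> min (p * n / ln n) 1" using p n by (simp add: ln_ge_zero)
      then have "b * min (p * n / ln n) 1 \<le> max a b * min (p * n / ln n) 1" by (intro mult_right_mono) auto
      then show "E n p g" unfolding E_def using H by (meson order_trans)
    qed
  qed auto
  then obtain f where f: "f \<longlonglongrightarrow> 0" and fev: "\<forall>\<^sub>F n in sequentially. \<forall>p. 0 \<le> p \<and> p \<le> 1 \<and> 1 + \<epsilon> \<le> p * real n \<longrightarrow>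
     measure_pmf.prob (Gnp n p) {g. \<not> E n p g} \<le> f n" unfolding whp_def by blast
  have "(\<lambda>n. measure_pmf.prob (Gnp n (p n)) {g. E n (p n) g}) \<longlonglongrightarrow> 1"
  proof (rule tendsto_sandwich)
    show "\<forall>\<^sub>F n in sequentially. 1 - f n \<le> measure_pmf.prob (Gnp n (p n)) {g. E n (p n) g}"
      using fev assms(3)
    proof eventually_elim
      case (elim n)
      then have "measure_pmf.prob (Gnp n (p n)) {g. \<not> E n (p n) g} \<le> f n" using assms(2) by blast
      moreover have "measure_pmf.prob (Gnp n (p n)) {g. \<not> E n (p n) g} = 1 - measure_pmf.prob (Gnp n (p n)) {g. E n (p n) g}"
        using measure_pmf.prob_compl[of "{g. E n (p n) g}" "Gnp n (p n)"] by (simp add: Collect_neg_eq Compl_eq_Diff_UNIV)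
      ultimately show ?case by linarith
    qed
    show "(\<lambda>n. 1 - f n) \<longlonglongrightarrow> 1" using tendsto_diff[OF tendsto_const f, of 1] by simp
  qed (auto simp: measure_pmf.prob_le_1)
  then show ?thesis using a unfolding E_def by (intro exI[of _ a] exI[of _ "max a b"]) auto
qed

end
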